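(* As rings of holomorphic functions on the upper half plane, $$\mathcal M(\Gamma(5))_{\frac15\mathbb M}=\mathbb C\big[f_{5,1},f_{5,3}\big]=\mathbb C\big[\eta_{\chi_5},\eta_{\overline{\chi_5}}\big],$$ $$\mathcal S(\Gamma(5))_{\frac15\mathbb M}=\mathcal M(\Gamma(5))_{\frac15\mathbb M}\,\eta^{24/5}.$$
   Context: $\mathbb M=\{0,1,2,\dots\}$, $\frac15\mathbb M=\{k/5:k\in\mathbb M\}$; $\mathcal H$ is the upper half plane, $q^r=e^{2\pi i r\tau}$. $\Gamma(5)$ is the principal congruence subgroup of level 5. $\eta=q^{1/24}\prod_{n\ge1}(1-q^n)$, and for real $r$, $\eta^r=q^{r/24}\prod_{n\ge1}(1-q^n)^r$ with principal branches. Rational weight: for $\gamma=\begin{pmatrix}a&b\\c&d\end{pmatrix}\in\Gamma(5)$ the weight $\frac{12}5$ automorphy factor is $J_{12/5}(\gamma,\tau)=\eta^{24/5}(\gamma\tau)/\eta^{24/5}(\tau)$, the weight $1$ factor is $c\tau+d$, and factors multiply when weights add; thus for $k\in\mathbb M$, $J_{k/5}(\gamma,\tau)=J_{12/5}(\gamma,\tau)^m(c\tau+d)^n$ for any integers $m,n$ with $12m+5n=k$ (independent of the choice). $\mathcal M(\Gamma(5))_{k/5}$ is the space of holomorphic $f$ on $\mathcal H$ with $f(\gamma\tau)=J_{k/5}(\gamma,\tau)f(\tau)$ for all $\gamma\in\Gamma(5)$ that are holomorphic at all cusps, i.e. for every $\begin{pmatrix}a&b\\c&d\end{pmatrix}\in\mathrm{SL}_2(\mathbb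 Z)$ the function $|c\tau+d|^{-k/5}\,\big|f\big(\tfrac{a\tau+b}{c\tau+d}\big)\big|$ is bounded as $\operatorname{Im}\tau\to\infty$; $\mathcal S(\Gamma(5))_{k/5}$ is the subspace for which all these functions tend to $0$. $\mathcal M(\Gamma(5))_{\frac15\mathbb M}=\bigoplus_{k\in\mathbb M}\mathcal M(\Gamma(5))_{k/5}$, similarly for $\mathcal S$. $\mathbb C[f,g]$ denotes the $\mathbb C$-subalgebra generated by $f,g$. For $r=1,3$: $f_{5,r}=\eta^{-3/5}\,q^{r^2/40}\sum_{p\in\mathbb Z}(-1)^pq^{(5p^2+rp)/2}$. $\eta_{\chi_5}$ is the series in $q^{1/5}$ with constant term $1$ whose square is $$\frac{\eta(\tau/5)}{\eta(\tau)^{1/5}}+(1-2i)\frac{\eta(5\tau)}{\eta(\tau)^{1/5}},$$ and $\eta_{\overline{\chi_5}}$ is obtained from $\eta_{\chi_5}$ by complex conjugating all coefficients of its $q^{1/5}$-expansion. *)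

theory Defs
  imports "HOL-Analysis.Analysis" "HOL-Number_Theory.Cong"
begin

section \<open>Fractional powers of the eta function\<close>

definition uhp :: "complex set" where
  "uhp = {\<tau>. Im \<tau> > 0}"

text \<open>\<open>q_pow r \<tau>\<close> is $q^r = e^{2\pi i r\tau}$.\<close>
definition q_pow :: "real \<Rightarrow> complex \<Rightarrow> complex" where
  "q_pow r \<tau> = exp (2 * of_real pi * \<i> * of_real r * \<tau>)"

definition eta :: "complex \<Rightarrow> complex" where
  "eta \<tau> = q_pow (1/24) \<tau> * (\<Prod>n. 1 - q_pow (real (Suc n)) \<tau>)"

text \<open>\<open>powr\<close> on complex numbers is the principal branch.\<close>
definition eta_pow :: "real \<Rightarrow> complex \<Rightarrow> complex" where
  "eta_pow r \<tau> = q_pow (r/24) \<tau> * (\<Prod>n. (1 - q_pow (real (Suc n)) \<tau>) powr of_real r)"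

section \<open>Modular forms of rational weight on \<open>\<Gamma>(5)\<close>\<close>

definition SL2Z :: "(int^2^2) set" where
  "SL2Z = {A. det A = 1}"

definition principal_congruence_subgroup :: "int \<Rightarrow> (int^2^2) set" where
  "principal_congruence_subgroup N =
     {A \<in> SL2Z. \<forall>i j. [A $ i $ j = (mat 1 :: int^2^2) $ i $ j] (mod N)}"

text \<open>$c\tau+d$, where $(c, d)$ is the second row of the matrix.\<close>
definition denom :: "int^2^2 \<Rightarrow> complex \<Rightarrow> complex" where
  "denom A \<tau> = of_int (A$2$1) * \<tau> + of_int (A$2$2)"

definition moebius_map :: "int^2^2 \<Rightarrow> complex \<Rightarrow> complex" where
  "moebius_map A \<tau> = (of_int (A$1$1) * \<tau> + of_int (A$1$2)) / denom A \<tau>"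

definition J_12_5 :: "int^2^2 \<Rightarrow> complex \<Rightarrow> complex" where
  "J_12_5 A \<tau> = eta_pow (24/5) (moebius_map A \<tau>) / eta_pow (24/5) \<tau>"

text \<open>
  Invariance in weight $k/5$. The factor $J_{12/5}^m(c\tau+d)^n$ is the same for all integers
  \<open>m\<close>, \<open>n\<close> with $12m+5n=k$, so that it makes no difference whether one requires the equation for
  one or for all of these pairs.
\<close>
definition invariant_of_weight :: "nat \<Rightarrow> (complex \<Rightarrow> complex) \<Rightarrow> bool" where
  "invariant_of_weight k f \<longleftrightarrow>
     (\<forall>A \<in> principal_congruence_subgroup 5. \<forall>\<tau> \<in> uhp. \<forall>m n::int. 12 * m + 5 * n = int k \<longrightarrow>
        f (moebius_map A \<tau>) = J_12_5 A \<tau> powi m * denom A \<tau> powi n * f \<tau>)"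

text \<open>The filter of neighbourhoods of $i\infty$: $\mathrm{Im}\,\tau\to\infty$, uniformly in $\mathrm{Re}\,\tau$.\<close>
definition at_i_infinity :: "complex filter" where
  "at_i_infinity = filtercomap Im at_top"

definition abs_slash :: "nat \<Rightarrow> (complex \<Rightarrow> complex) \<Rightarrow> int^2^2 \<Rightarrow> complex \<Rightarrow> real" where
  "abs_slash k f A \<tau> = norm (denom A \<tau>) powr (- (real k / 5)) * norm (f (moebius_map A \<tau>))"

text \<open>
  A function on the upper half plane is represented by a function on \<open>\<complex>\<close> that takes the
  default value \<open>undefined\<close> outside \<open>uhp\<close>, so that equality of representatives is equality on
  the upper half plane. The index \<open>k\<close> stands for the weight $k/5$.
\<close>
definition modular_forms :: "nat \<Rightarrow> (complex \<Rightarrow> complex) set" where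
  "modular_forms k = {f \<in> extensional uhp. f holomorphic_on uhp \<and> invariant_of_weight k f \<and>
     (\<forall>A \<in> SL2Z. Bfun (abs_slash k f A) at_i_infinity)}"

definition cusp_forms :: "nat \<Rightarrow> (complex \<Rightarrow> complex) set" where
  "cusp_forms k = {f \<in> modular_forms k. \<forall>A \<in> SL2Z. (abs_slash k f A \<longlongrightarrow> 0) at_i_infinity}"

text \<open>
  The internal direct sum of the spaces \<open>V k\<close>. That the sum of the spaces of modular forms is
  indeed direct is shown below in \<open>modular_forms_independent\<close>.
\<close>
definition graded_sum :: "(nat \<Rightarrow> (complex \<Rightarrow> complex) set) \<Rightarrow> (complex \<Rightarrow> complex) set" where
  "graded_sum V = {(\<lambda>\<tau>\<in>uhp. \<Sum>k\<in>K. g k \<tau>) | K g. finite K \<and> (\<forall>k\<in>K. g k \<in> V k)}"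

definition modular_forms_ring :: "(complex \<Rightarrow> complex) set" where
  "modular_forms_ring = graded_sum modular_forms"

definition cusp_forms_ideal :: "(complex \<Rightarrow> complex) set" where
  "cusp_forms_ideal = graded_sum cusp_forms"

text \<open>The \<open>\<complex>\<close>-subalgebra generated by \<open>G\<close> in the algebra of functions on \<open>uhp\<close>.\<close>
inductive_set subalgebra_generated :: "(complex \<Rightarrow> complex) set \<Rightarrow> (complex \<Rightarrow> complex) set"
  for G :: "(complex \<Rightarrow> complex) set" where
  const: "(\<lambda>\<tau>\<in>uhp. c) \<in> subalgebra_generated G"
| gen: "g \<in> G \<Longrightarrow> restrict g uhp \<in> subalgebra_generated G"
| add: "f \<in> subalgebra_generated G \<Longrightarrow> g \<in> subalgebra_generated G \<Longrightarrow>
          (\<lambda>\<tau>\<in>uhp. f \<tau> + g \<tau>) \<in> subalgebra_generated G"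
| mult: "f \<in> subalgebra_generated G \<Longrightarrow> g \<in> subalgebra_generated G \<Longrightarrow>
          (\<lambda>\<tau>\<in>uhp. f \<tau> * g \<tau>) \<in> subalgebra_generated G"

section \<open>The generators\<close>

definition f5 :: "nat \<Rightarrow> complex \<Rightarrow> complex" where
  "f5 r \<tau> = eta_pow (-3/5) \<tau> * q_pow (real (r^2) / 40) \<tau> *
     (\<Sum>\<^sub>\<infinity>p\<in>(UNIV::int set). (-1) powi p * q_pow (real_of_int (5 * p^2 + int r * p) / 2) \<tau>)"

definition eta_chi5_radicand :: "complex \<Rightarrow> complex" where
  "eta_chi5_radicand \<tau> =
     eta (\<tau>/5) / eta_pow (1/5) \<tau> + (1 - 2 * \<i>) * (eta (5 * \<tau>) / eta_pow (1/5) \<tau>)"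

text \<open>The expansion of the radicand in powers of $q^{1/5}$, as a formal power series.\<close>
definition eta_chi5_radicand_fps :: "complex fps" where
  "eta_chi5_radicand_fps =
     (THE G. \<forall>\<tau>\<in>uhp. (\<lambda>n. fps_nth G n * q_pow (1/5) \<tau> ^ n) sums eta_chi5_radicand \<tau>)"

definition eta_chi5_fps :: "complex fps" where
  "eta_chi5_fps = (THE F. fps_nth F 0 = 1 \<and> F^2 = eta_chi5_radicand_fps)"

definition eta_chi5 :: "complex \<Rightarrow> complex" where
  "eta_chi5 \<tau> = eval_fps eta_chi5_fps (q_pow (1/5) \<tau>)"

definition eta_chi5_conj :: "complex \<Rightarrow> complex" where
  "eta_chi5_conj \<tau> = eval_fps (Abs_fps (\<lambda>n. cnj (fps_nth eta_chi5_fps n))) (q_pow (1/5) \<tau>)"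

section \<open>Forms of different weights are linearly independent\<close>

lemma norm_q_pow: "norm (q_pow r \<tau>) = exp (- 2 * pi * r * Im \<tau>)"
  by (simp add: q_pow_def norm_exp_eq_Re)

lemma q_pow_nat: "q_pow (real n) \<tau> = q_pow 1 \<tau> ^ n"
  by (simp add: q_pow_def exp_of_nat_mult [symmetric] mult_ac)

lemma eta_pow_nonzero:
  assumes "\<tau> \<in> uhp"
  shows "eta_pow r \<tau> \<noteq> 0"
proof -
  define z where "z = (\<lambda>n. - q_pow (real (Suc n)) \<tau>)"
  have lt: "norm (q_pow 1 \<tau>) < 1"
    using assms by (simp add: norm_q_pow uhp_def)
  have norm_z: "norm (z n) = norm (q_pow 1 \<tau>) ^ Suc n" for n
    unfolding z_def q_pow_nat norm_minus_cancel norm_power ..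
  have lt_z: "norm (z n) < 1" for n
    unfolding norm_z by (rule power_Suc_less_one) (use lt in \<open>simp_all add: q_pow_def\<close>)
  have sz: "summable (\<lambda>n. norm (z n))"
    unfolding norm_z using lt by (subst summable_Suc_iff) (simp add: summable_geometric)
  have nz: "1 + z n \<noteq> 0" for n
    using lt_z[of n] by (metis add.inverse_inverse eq_neg_iff_add_eq_0 less_irrefl
        norm_minus_cancel norm_one)
  obtain N where "\<And>n. n \<ge> N \<Longrightarrow> norm (z n) < 1/2"
    using summable_LIMSEQ_zero[OF sz]
    by (metis diff_zero dist_norm half_gt_zero_iff less_numeral_extra(1) lim_sequentially
        tendsto_norm_zero_iff)
  then have "summable (\<lambda>n. Ln (1 + z n))"
    by (metis norm_Ln_le summable_comparison_test summable_mult sz)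
  then have "convergent_prod (\<lambda>n. exp (of_real r * Ln (1 + z n)))"
    by (intro convergent_prod_exp summable_mult)
  then have "(\<Prod>n. exp (of_real r * Ln (1 + z n))) \<noteq> 0"
    by (intro prodinf_nonzero) auto
  also have "(\<lambda>n. exp (of_real r * Ln (1 + z n))) =
      (\<lambda>n. (1 - q_pow (real (Suc n)) \<tau>) powr of_real r)"
    using nz unfolding z_def by (auto simp: powr_def)
  finally show ?thesis
    by (simp add: eta_pow_def q_pow_def)
qed

theorem modular_forms_independent:
  assumes K: "finite K" and g: "\<And>k. k \<in> K \<Longrightarrow> g k \<in> modular_forms k"
    and zero: "\<And>\<tau>. \<tau> \<in> uhp \<Longrightarrow> (\<Sum>k\<in>K. g k \<tau>) = 0"
    and "k \<in> K" "\<tau> \<in> uhp"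
  shows "g k \<tau> = 0"
proof (rule ccontr)
  assume nz: "g k \<tau> \<noteq> 0"
  have Im: "Im \<tau> > 0"
    using \<open>\<tau> \<in> uhp\<close> by (simp add: uhp_def)
  define A :: "nat \<Rightarrow> int^2^2" where
    "A t = vector [vector [1, 0], vector [5 * int t, 1]]" for t
  have A [simp]: "A t $ 1 $ 1 = 1" "A t $ 1 $ 2 = 0" "A t $ 2 $ 1 = 5 * int t" "A t $ 2 $ 2 = 1" for t
    by (simp_all add: A_def)
  have A_in: "A t \<in> principal_congruence_subgroup 5" for t
    by (simp add: principal_congruence_subgroup_def SL2Z_def det_2 forall_2 mat_def cong_def)
  have denom_A: "denom (A t) \<tau> = of_nat (5 * t) * \<tau> + 1" for t
    by (simp add: denom_def)
  have denom_nz: "denom (A t) \<tau> \<noteq> 0" for t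
  proof
    assume eq: "denom (A t) \<tau> = 0"
    then have "Im (denom (A t) \<tau>) = 0" by simp
    then have "t = 0" using Im by (simp add: denom_A)
    with eq show False by (simp add: denom_A)
  qed
  have moebius_in: "moebius_map (A t) \<tau> \<in> uhp" for t
  proof -
    let ?d = "denom (A t) \<tau>"
    have "moebius_map (A t) \<tau> = \<tau> * cnj ?d / of_real ((norm ?d)\<^sup>2)"
      using denom_nz[of t]
      unfolding complex_norm_square by (simp add: moebius_map_def)
    then have "Im (moebius_map (A t) \<tau>) = Im (\<tau> * cnj ?d) / (norm ?d)\<^sup>2"
      by (simp only: Im_divide_of_real)
    also have "Im (\<tau> * cnj ?d) = Im \<tau>"
      by (simp add: denom_A algebra_simps)
    finally show ?thesis
      using Im denom_nz[of t] by (simp add: uhp_def)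
  qed
  define z where "z t = J_12_5 (A t) \<tau> powi (-2) * denom (A t) \<tau> powi 5" for t
  have J_nz: "J_12_5 (A t) \<tau> \<noteq> 0" for t
    using eta_pow_nonzero[OF \<open>\<tau> \<in> uhp\<close>] eta_pow_nonzero[OF moebius_in[of t]]
    by (simp add: J_12_5_def)
  have inv: "g l (moebius_map (A t) \<tau>) = J_12_5 (A t) \<tau> powi m * denom (A t) \<tau> powi n * g l \<tau>"
    if "l \<in> K" "12 * m + 5 * n = int l" for l m n t
    using g[OF that(1)] that(2) A_in[of t] \<open>\<tau> \<in> uhp\<close>
    unfolding modular_forms_def invariant_of_weight_def by blast
  have linear: "12 * (-2 * int l) + 5 * (5 * int l) = int l" for l
    by simp
  have transf: "g l (moebius_map (A t) \<tau>) = z t ^ l * g l \<tau>" if "l \<in> K" for l t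
    using inv[OF that, of "-2 * int l" "5 * int l" t, OF linear]
    by (simp only: z_def power_int_mult power_int_of_nat power_mult_distrib)
  define p where "p = (\<Sum>l\<in>K. monom (g l \<tau>) l)"
  have root: "poly p (z t) = 0" for t
    using zero[OF moebius_in[of t]] transf
    by (simp add: p_def poly_sum poly_monom mult.commute)
  have "coeff p k = g k \<tau>"
    using K \<open>k \<in> K\<close> by (simp add: p_def coeff_sum)
  with nz have "p \<noteq> 0" by auto
  then have "finite (range z)"
    using root by (intro finite_subset[OF _ poly_roots_finite[of p]]) auto
  then obtain B where B: "\<And>t. norm (z t) \<le> B"
    using finite_imp_bounded by (metis bounded_iff rangeI)
  have J5: "J_12_5 (A t) \<tau> ^ 5 = denom (A t) \<tau> ^ 12" for t
  proof -
    let ?J = "J_12_5 (A t) \<tau>" and ?d = "denom (A t) \<tau>"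
    have "?J powi (-2 * int k) * ?d powi (5 * int k) * g k \<tau> =
          ?J powi (-2 * int k + 5) * ?d powi (5 * int k - 12) * g k \<tau>"
      using inv[OF \<open>k \<in> K\<close>, of "-2 * int k" "5 * int k" t]
            inv[OF \<open>k \<in> K\<close>, of "-2 * int k + 5" "5 * int k - 12" t] by (simp, metis)
    also have "\<dots> = ?J powi (-2 * int k) * ?J ^ 5 * (?d powi (5 * int k) / ?d ^ 12) * g k \<tau>"
      using J_nz[of t] denom_nz[of t] by (simp add: power_int_add power_int_diff power_int_minus field_simps)
    finally show ?thesis
      using J_nz[of t] denom_nz[of t] nz by (simp add: field_simps)
  qed
  have norm_z5: "norm (z t) ^ 5 = norm (denom (A t) \<tau>)" for t
  proof -
    let ?J = "J_12_5 (A t) \<tau>" and ?d = "denom (A t) \<tau>"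
    have "z t ^ 5 = ?d ^ 25 / (?J ^ 5) ^ 2"
      by (simp add: z_def power_int_minus power_mult_distrib power_mult [symmetric] divide_inverse
            power_inverse mult.commute)
    also have "\<dots> = ?d"
      unfolding J5 using denom_nz[of t]
      by (simp add: power_mult [symmetric] eval_nat_numeral)
    finally show ?thesis
      by (metis norm_power)
  qed
  have "5 * real t * Im \<tau> \<le> B ^ 5" for t
  proof -
    have "5 * real t * Im \<tau> = Im (denom (A t) \<tau>)" by (simp add: denom_A)
    also have "\<dots> \<le> norm (denom (A t) \<tau>)" by (rule order_trans[OF abs_ge_self abs_Im_le_cmod])
    also have "\<dots> = norm (z t) ^ 5" by (simp add: norm_z5)
    also have "\<dots> \<le> B ^ 5" by (intro power_mono B) auto
    finally show ?thesis .
  qed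
  moreover obtain t :: nat where "B ^ 5 / (5 * Im \<tau>) < real t"
    using reals_Archimedean2 by blast
  ultimately show False
    using Im by (simp add: field_simps) (metis mult.commute mult.left_commute not_less)
qed

end

theory Submission
  imports Defs "HOL-Complex_Analysis.Complex_Analysis" "HOL-Real_Asymp.Real_Asymp"
begin

lemma tendsto_infsum_dominated:
  fixes a :: "int \<Rightarrow> 'b \<Rightarrow> complex"
  assumes lim: "\<And>k. ((\<lambda>n. a k n) \<longlongrightarrow> b k) F"
    and bound: "eventually (\<lambda>n. \<forall>k. norm (a k n) \<le> M k) F"
    and M: "M summable_on UNIV" and F: "F \<noteq> bot"
  shows "((\<lambda>n. \<Sum>\<^sub>\<infinity>k. a k n) \<longlongrightarrow> (\<Sum>\<^sub>\<infinity>k. b k)) F" "(\<lambda>k. norm (b k)) summable_on UNIV"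
proof -
  have b_le: "norm (b k) \<le> M k" for k
    using tendsto_norm[OF lim[of k]] by (rule tendsto_upperbound) (use bound F in \<open>auto elim: eventually_mono\<close>)
  show sb: "(\<lambda>k. norm (b k)) summable_on UNIV"
    by (rule Infinite_Sum.abs_summable_on_comparison_test'[OF M]) (use b_le in auto)
  have b: "b summable_on UNIV"
    using sb by (rule abs_summable_summable)
  show "((\<lambda>n. \<Sum>\<^sub>\<infinity>k. a k n) \<longlongrightarrow> (\<Sum>\<^sub>\<infinity>k. b k)) F"
  proof (rule tendstoI)
    fix e :: real assume e: "e > 0"
    have M0: "M k \<ge> 0" for k
      using b_le[of k] norm_ge_zero order_trans by blast
    obtain X where X: "finite X" "dist (sum M X) (infsum M UNIV) \<le> e/4"
      using infsum_finite_approximation[OF M, of "e/4"] e by (auto simp: dist_commute)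
    have MX: "M summable_on (-X)"
      using M by (rule summable_on_subset_banach) auto
    have tail: "infsum M (-X) \<le> e/4"
    proof -
      have "infsum M UNIV = infsum M X + infsum M (-X)"
        using infsum_Un_disjoint[of M X "-X"] MX X(1) by simp
      then show ?thesis using X by (simp add: dist_real_def)
    qed
    have "((\<lambda>n. \<Sum>k\<in>X. a k n) \<longlongrightarrow> (\<Sum>k\<in>X. b k)) F"
      by (intro tendsto_sum lim)
    then have "eventually (\<lambda>n. dist (\<Sum>k\<in>X. a k n) (\<Sum>k\<in>X. b k) < e/4) F"
      using e by (intro tendstoD) auto
    then show "eventually (\<lambda>n. dist (\<Sum>\<^sub>\<infinity>k. a k n) (\<Sum>\<^sub>\<infinity>k. b k) < e) F"
      using bound
    proof eventually_elim
      case (elim n)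
      have tl: "norm (infsum c (-X)) \<le> e/4 \<and> infsum c UNIV = sum c X + infsum c (-X)"
        if c: "\<And>k. norm (c k) \<le> M k" for c :: "int \<Rightarrow> complex"
      proof -
        have cX: "(\<lambda>k. norm (c k)) summable_on (-X)"
          by (rule Infinite_Sum.abs_summable_on_comparison_test'[OF MX]) (use c in auto)
        have "norm (infsum c (-X)) \<le> infsum (\<lambda>k. norm (c k)) (-X)"
          using cX by (rule norm_infsum_bound)
        also have "\<dots> \<le> infsum M (-X)"
          by (rule infsum_mono[OF cX MX]) (rule c)
        finally show ?thesis
          using tail infsum_Un_disjoint[of c X "-X"] abs_summable_summable[OF cX] X(1) by simp
      qed
      have 1: "norm (infsum (\<lambda>k. a k n) (-X)) \<le> e/4" "infsum (\<lambda>k. a k n) UNIV = (\<Sum>k\<in>X. a k n) + infsum (\<lambda>k. a k n) (-X)"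
        using tl[of "\<lambda>k. a k n"] elim by auto
      have 2: "norm (infsum b (-X)) \<le> e/4" "infsum b UNIV = sum b X + infsum b (-X)"
        using tl[of b] b_le by auto
      show ?case
        using 1(1) 2(1) elim(1) norm_triangle_ineq4[of "infsum (\<lambda>k. a k n) (-X)" "infsum b (-X)"]
          norm_triangle_ineq[of "(\<Sum>k\<in>X. a k n) - sum b X" "infsum (\<lambda>k. a k n) (-X) - infsum b (-X)"] e
        unfolding 1(2) 2(2) dist_norm by (simp add: algebra_simps)
    qed
  qed
qed

lemma summable_on_int_geometric:
  fixes r :: real
  assumes "0 \<le> r" "r < 1"
  shows "(\<lambda>k::int. r ^ nat \<bar>k\<bar>) summable_on UNIV"
proof -
  have nat: "(\<lambda>n. r ^ n) summable_on (UNIV :: nat set)"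
    using assms by (intro norm_summable_imp_summable_on) (auto simp: summable_geometric)
  have "(\<lambda>k::int. r ^ nat \<bar>k\<bar>) summable_on range int"
    by (subst summable_on_reindex) (use nat in \<open>auto simp: o_def\<close>)
  moreover have "(\<lambda>k::int. r ^ nat \<bar>k\<bar>) summable_on range (\<lambda>n. - int n)"
    by (subst summable_on_reindex) (use nat in \<open>auto simp: o_def inj_on_def\<close>)
  ultimately have "(\<lambda>k::int. r ^ nat \<bar>k\<bar>) summable_on (range int \<union> range (\<lambda>n. - int n))"
    by (rule summable_on_union)
  moreover have "range int \<union> range (\<lambda>n. - int n) = UNIV"
    by (auto simp: image_iff) (metis int_cases2)
  ultimately show ?thesis by simp
qed

section \<open>The Jacobi triple product\<close>

definition qprod :: "complex \<Rightarrow> complex \<Rightarrow> complex" where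
  "qprod x Q = (\<Prod>n. 1 - x * Q ^ n)"

lemma qprod_convergent:
  assumes "norm Q < 1" "norm x < 1"
  shows "convergent_prod (\<lambda>n. 1 - x * Q ^ n)" "qprod x Q \<noteq> 0"
    "(\<lambda>n. \<Prod>j<n. 1 - x * Q ^ j) \<longlonglongrightarrow> qprod x Q"
    "summable (\<lambda>n. norm (x * Q ^ n))" "norm (x * Q ^ n) < 1"
proof -
  show lt: "norm (x * Q ^ n) < 1" for n
  proof -
    have "norm x * norm Q ^ n \<le> norm x * 1"
      using assms by (intro mult_left_mono power_le_one) auto
    then show ?thesis using assms by (simp add: norm_mult norm_power)
  qed
  show sum: "summable (\<lambda>n. norm (x * Q ^ n))"
    using assms by (simp add: norm_mult norm_power summable_mult summable_geometric)
  have nz: "1 - x * Q ^ n \<noteq> 0" for n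
    using lt[of n] by (metis eq_iff_diff_eq_0 less_irrefl norm_one)
  then have "convergent_prod (\<lambda>n. 1 + - (x * Q ^ n))"
    using sum by (intro summable_imp_convergent_prod_complex) (auto simp: add_eq_0_iff2)
  then show conv: "convergent_prod (\<lambda>n. 1 - x * Q ^ n)" by simp
  show "qprod x Q \<noteq> 0"
    unfolding qprod_def using nz conv by (simp add: prodinf_nonzero)
  have "(\<lambda>n. \<Prod>j\<le>n. 1 - x * Q ^ j) \<longlonglongrightarrow> qprod x Q"
    unfolding qprod_def by (rule convergent_prod_LIMSEQ[OF conv])
  then have "(\<lambda>n. \<Prod>j<Suc n. 1 - x * Q ^ j) \<longlonglongrightarrow> qprod x Q"
    by (simp add: lessThan_Suc_atMost)
  then show "(\<lambda>n. \<Prod>j<n. 1 - x * Q ^ j) \<longlonglongrightarrow> qprod x Q"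
    by (rule LIMSEQ_imp_Suc)
qed

definition qfact :: "complex \<Rightarrow> nat \<Rightarrow> complex" where
  "qfact Q m = (\<Prod>j<m. 1 - Q ^ Suc j)"

lemma qfact_Suc [simp]: "qfact Q (Suc m) = qfact Q m * (1 - Q ^ Suc m)" and qfact_0 [simp]: "qfact Q 0 = 1"
  by (simp_all add: qfact_def)

lemma qfact_nonzero:
  assumes "norm Q < 1"
  shows "qfact Q m \<noteq> 0"
proof -
  have "norm (Q ^ Suc j) < 1" for j
  proof -
    have "norm Q * norm Q ^ j \<le> norm Q * 1"
      using assms by (intro mult_left_mono power_le_one) auto
    then show ?thesis using assms by (simp add: norm_mult norm_power)
  qed
  then have "1 - Q ^ Suc j \<noteq> 0" for j
    by (metis eq_iff_diff_eq_0 less_irrefl norm_one)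
  then show ?thesis by (simp add: qfact_def)
qed

lemma q_binomial_theorem:
  assumes "norm Q < 1"
  shows "(\<Prod>j<m. 1 + x * Q ^ j) =
    (\<Sum>k\<le>m. Q ^ (k * (k - 1) div 2) * (qfact Q m / (qfact Q k * qfact Q (m - k))) * x ^ k)"
proof (induction m)
  case 0
  show ?case by simp
next
  case (Suc m)
  note nz = qfact_nonzero[OF assms]
  define b where "b = (\<lambda>m k. qfact Q m / (qfact Q k * qfact Q (m - k)))"
  define c where "c k = Q ^ (k * (k - 1) div 2)" for k :: nat
  have tri: "c (Suc k) = c k * Q ^ k" for k
  proof -
    have "Suc k * k div 2 = k * (k - 1) div 2 + k"
      by (cases k) (simp_all add: algebra_simps)
    then show ?thesis by (simp add: c_def power_add)
  qed
  have pascal: "b (Suc m) (Suc k) = b m (Suc k) + Q ^ (m - k) * b m k" if km: "k < m" for k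
  proof -
    obtain d where m: "m = Suc k + d"
      using less_imp_Suc_add[OF km] by auto
    have n1: "1 - Q * Q ^ d \<noteq> 0" "1 - Q * Q ^ k \<noteq> 0"
      using nz[of "Suc d"] nz[of "Suc k"] unfolding qfact_Suc power_Suc mult_eq_0_iff by blast+
    have m_diff: "m - k = Suc d" "m - Suc k = d" "Suc m - Suc k = Suc d"
      by (simp_all add: m)
    have Qm: "Q ^ m = Q * Q ^ k * Q ^ d"
      by (simp add: m power_add)
    have alg: "M * (u + w * v) / (K * v * (D * u)) = M / (K * v * D) + w * (M / (K * (D * u)))"
      if "K \<noteq> 0" "D \<noteq> 0" "u \<noteq> 0" "v \<noteq> 0" for M K D u v w :: complex
      using that by (simp add: field_simps)
    have split: "1 - Q * (Q * Q ^ k * Q ^ d) = (1 - Q * Q ^ d) + Q * Q ^ d * (1 - Q * Q ^ k)"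
      by (simp add: algebra_simps)
    show ?thesis
      unfolding b_def m_diff qfact_Suc power_Suc Qm split
      by (rule alg) (use nz n1 in auto)
  qed
  have b0: "b n 0 = 1" "b n n = 1" for n
    using nz by (simp_all add: b_def)
  have "(\<Prod>j<Suc m. 1 + x * Q ^ j) = (\<Sum>k\<le>m. c k * b m k * x ^ k) * (1 + x * Q ^ m)"
    using Suc by (simp add: b_def c_def)
  also have "\<dots> = (\<Sum>k\<le>m. c k * b m k * x ^ k) + (\<Sum>k\<le>m. c k * Q ^ m * b m k * x ^ Suc k)"
    by (simp add: algebra_simps sum_distrib_left sum.distrib)
  also have "(\<Sum>k\<le>m. c k * b m k * x ^ k) = 1 + (\<Sum>k<m. c (Suc k) * b m (Suc k) * x ^ Suc k)"
    by (subst sum.atMost_shift) (simp add: b0 c_def)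
  also have "(\<Sum>k\<le>m. c k * Q ^ m * b m k * x ^ Suc k) =
      (\<Sum>k<m. c (Suc k) * Q ^ (m - k) * b m k * x ^ Suc k) + c (Suc m) * x ^ Suc m"
  proof -
    have "c k * Q ^ m = c (Suc k) * Q ^ (m - k)" if "k \<le> m" for k
      using that by (simp add: tri mult.assoc flip: power_add)
    then show ?thesis
      by (simp add: lessThan_Suc_atMost[symmetric] b0)
  qed
  also have "1 + (\<Sum>k<m. c (Suc k) * b m (Suc k) * x ^ Suc k) +
      ((\<Sum>k<m. c (Suc k) * Q ^ (m - k) * b m k * x ^ Suc k) + c (Suc m) * x ^ Suc m) =
      1 + (\<Sum>k<m. c (Suc k) * b (Suc m) (Suc k) * x ^ Suc k) + c (Suc m) * x ^ Suc m"
    by (simp add: pascal algebra_simps sum.distrib)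
  also have "\<dots> = (\<Sum>k\<le>Suc m. c k * b (Suc m) k * x ^ k)"
    by (subst sum.atMost_shift) (simp add: b0 c_def lessThan_Suc)
  finally show ?case by (simp add: b_def c_def)
qed

lemma finite_triple_product:
  assumes Q: "norm Q < 1" "Q \<noteq> 0" and z: "z \<noteq> 0"
  shows "(\<Prod>j<n. 1 - z * Q ^ j) * (\<Prod>j<n. 1 - Q / z * Q ^ j) =
    (\<Sum>k\<in>{-int n..int n}. (-1) powi k * Q powi (k * (k - 1) div 2) * z powi k *
       (qfact Q (2 * n) / (qfact Q (nat (int n + k)) * qfact Q (nat (int n - k)))))"
proof -
  define x where "x = - z / Q ^ n"
  define B where "B = (\<lambda>k. qfact Q (2 * n) / (qfact Q k * qfact Q (2 * n - k)))"
  define C where "C = (\<Prod>j<n. - z / Q ^ Suc j)"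
  have C: "C = (- z) ^ n / Q ^ (n * (n + 1) div 2)"
  proof -
    have "(\<Prod>j<n. - z / Q ^ Suc j) = (- z) ^ n / Q ^ (n * (n + 1) div 2)"
    proof (induction n)
      case (Suc n)
      have "Suc n * (Suc n + 1) div 2 = n * (n + 1) div 2 + Suc n"
        by simp
      then have "Q ^ (Suc n * (Suc n + 1) div 2) = Q ^ (n * (n + 1) div 2) * Q ^ Suc n"
        by (simp only: power_add)
      with Suc show ?case
        by (simp only: prod.lessThan_Suc power_Suc) simp
    qed auto
    then show ?thesis by (simp add: C_def)
  qed
  have C0: "C \<noteq> 0"
    using Q z by (simp add: C_def)
  have prod_split: "(\<Prod>j<m + l. g j) = (\<Prod>j<m. g j) * (\<Prod>j<l. g (m + j))" for g :: "nat \<Rightarrow> complex" and m l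
    by (induction l) (simp_all add: mult.assoc)
  have "(\<Prod>j<2 * n. 1 + x * Q ^ j) = (\<Prod>j<n. 1 + x * Q ^ j) * (\<Prod>j<n. 1 + x * Q ^ (n + j))"
    using prod_split[of "\<lambda>j. 1 + x * Q ^ j" n n] by (simp add: mult_2)
  also have "(\<Prod>j<n. 1 + x * Q ^ (n + j)) = (\<Prod>j<n. 1 - z * Q ^ j)"
    using Q by (simp add: x_def power_add)
  also have "(\<Prod>j<n. 1 + x * Q ^ j) = (\<Prod>j<n. 1 + x * Q ^ (n - Suc j))"
    by (rule prod.nat_diff_reindex[symmetric])
  also have "\<dots> = (\<Prod>j<n. (- z / Q ^ Suc j) * (1 - Q / z * Q ^ j))"
  proof (rule prod.cong[OF refl])
    fix j assume "j \<in> {..<n}"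
    then have "Q ^ n = Q ^ (n - Suc j) * Q ^ Suc j"
      by (simp del: power_Suc flip: power_add)
    then show "1 + x * Q ^ (n - Suc j) = (- z / Q ^ Suc j) * (1 - Q / z * Q ^ j)"
      using Q z by (simp add: x_def field_simps)
  qed
  also have "\<dots> = C * (\<Prod>j<n. 1 - Q / z * Q ^ j)"
    by (simp only: C_def prod.distrib)
  finally have "(\<Prod>j<n. 1 - z * Q ^ j) * (\<Prod>j<n. 1 - Q / z * Q ^ j) = (\<Prod>j<2 * n. 1 + x * Q ^ j) / C"
    using C0 by (simp add: field_simps)
  also have "\<dots> = (\<Sum>k\<le>2*n. Q ^ (k * (k - 1) div 2) * B k * x ^ k / C)"
    by (simp add: q_binomial_theorem[OF Q(1)] sum_divide_distrib B_def)
  also have "\<dots> = (\<Sum>k\<in>{-int n..int n}. (-1) powi k * Q powi (k * (k - 1) div 2) * z powi k *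
       (qfact Q (2 * n) / (qfact Q (nat (int n + k)) * qfact Q (nat (int n - k)))))"
  proof (rule sum.reindex_bij_witness[of _ "\<lambda>k. nat (int n + k)" "\<lambda>k. int k - int n"])
    fix k assume k: "k \<in> {..2 * n}"
    define l where "l = int k - int n"
    have B: "B k = qfact Q (2 * n) / (qfact Q (nat (int n + l)) * qfact Q (nat (int n - l)))"
    proof -
      have "nat (int n + l) = k" "nat (int n - l) = 2 * n - k"
        using k by (auto simp: l_def)
      then show ?thesis by (simp add: B_def)
    qed
    have e1: "Q ^ (k * (k - 1) div 2) = Q powi (int k * (int k - 1) div 2)"
    proof -
      have "int k * (int k - 1) div 2 = int (k * (k - 1) div 2)"
        by (cases k) (simp_all add: zdiv_int algebra_simps)
      then show ?thesis by (simp only: power_int_of_nat)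
    qed
    have e2: "Q ^ (n * (n + 1) div 2) = Q powi (int n * (int n + 1) div 2)"
    proof -
      have "int n * (int n + 1) div 2 = int (n * (n + 1) div 2)"
        by (simp add: zdiv_int algebra_simps)
      then show ?thesis by (simp only: power_int_of_nat)
    qed
    have x: "x ^ k = (-1) powi int k * z powi int k * Q powi (- (int n * int k))"
    proof -
      have "x = (-1) * z * inverse (Q ^ n)"
        by (simp add: x_def divide_inverse)
      then have "x ^ k = (-1) ^ k * z ^ k * inverse (Q ^ (n * k))"
        by (simp only: power_mult_distrib power_inverse power_mult)
      moreover have "Q powi (- (int n * int k)) = inverse (Q ^ (n * k))"
        by (simp add: power_int_minus flip: of_nat_mult)
      ultimately show ?thesis by simp
    qed
    have C': "1 / C = (-1) powi (- int n) * z powi (- int n) * Q powi (int n * (int n + 1) div 2)"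
      unfolding C e2 using Q z by (simp add: power_int_minus power_minus[of z] field_simps)
    have ex: "int k * (int k - 1) div 2 + - (int n * int k) + int n * (int n + 1) div 2 = l * (l - 1) div 2"
    proof -
      have half: "2 * (int k * (int k - 1) div 2) = int k * (int k - 1)"
        "2 * (int n * (int n + 1) div 2) = int n * (int n + 1)" "2 * (l * (l - 1) div 2) = l * (l - 1)"
        by (auto simp: dvd_mult_div_cancel)
      have "2 * (int k * (int k - 1) div 2 + - (int n * int k) + int n * (int n + 1) div 2) =
          2 * (int k * (int k - 1) div 2) - 2 * (int n * int k) + 2 * (int n * (int n + 1) div 2)"
        by (simp only: algebra_simps)
      also have "\<dots> = 2 * (l * (l - 1) div 2)"
        unfolding half unfolding l_def by (simp add: algebra_simps)
      finally show ?thesis unfolding mult_cancel_left by simp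
    qed
    have "Q ^ (k * (k - 1) div 2) * B k * x ^ k / C =
      ((-1) powi int k * (-1) powi (- int n)) * (Q powi (int k * (int k - 1) div 2) * Q powi (- (int n * int k)) * Q powi (int n * (int n + 1) div 2)) * (z powi int k * z powi (- int n)) * B k"
      unfolding e1 x using C' by (simp add: divide_inverse mult_ac)
    also have "\<dots> = (-1) powi l * Q powi (l * (l - 1) div 2) * z powi l * B k"
      unfolding ex[symmetric] using Q z by (simp add: power_int_add l_def power_int_diff power_int_minus divide_inverse)
    finally show "(-1) powi (int k - int n) * Q powi ((int k - int n) * (int k - int n - 1) div 2) * z powi (int k - int n) *
       (qfact Q (2 * n) / (qfact Q (nat (int n + (int k - int n))) * qfact Q (nat (int n - (int k - int n))))) =
        Q ^ (k * (k - 1) div 2) * B k * x ^ k / C"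
      unfolding B by (simp only: l_def)
  qed auto
  finally show ?thesis .
qed

theorem jacobi_triple_product:
  assumes Q: "norm Q < norm z" and z: "norm z < 1" and Q0: "Q \<noteq> 0"
  shows "(\<Sum>\<^sub>\<infinity>k::int. (-1) powi k * Q powi (k * (k - 1) div 2) * z powi k) =
    qprod Q Q * qprod z Q * qprod (Q / z) Q"
proof -
  have Q1: "norm Q < 1" and z0: "z \<noteq> 0" and Qz: "norm (Q / z) < 1"
    using Q z by (auto simp: norm_divide divide_simps)
  define c where "c k = (-1) powi k * Q powi (k * (k - 1) div 2) * z powi k" for k
  define a where "a k n = (if k \<in> {-int n..int n} then c k *
      (qfact Q (2 * n) / (qfact Q (nat (int n + k)) * qfact Q (nat (int n - k)))) else 0)" for k n
  define P where "P = qprod Q Q"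
  have qf: "qfact Q \<longlonglongrightarrow> P"
    using qprod_convergent(3)[OF Q1 Q1] by (simp add: qfact_def[abs_def] P_def)
  have P0: "P \<noteq> 0"
    unfolding P_def by (rule qprod_convergent(2)[OF Q1 Q1])
  obtain U where U: "\<And>n. norm (qfact Q n) \<le> U"
    using convergent_imp_Bseq[of "qfact Q"] qf unfolding convergent_def by (metis BseqE)
  have "(\<lambda>n. inverse (qfact Q n)) \<longlonglongrightarrow> inverse P"
    by (intro tendsto_inverse qf P0)
  then obtain V where V: "\<And>n. norm (inverse (qfact Q n)) \<le> V"
    using convergent_imp_Bseq[of "\<lambda>n. inverse (qfact Q n)"] unfolding convergent_def by (metis BseqE)
  have UV: "U \<ge> 0" "V \<ge> 0"
    using U[of 0] V[of 0] norm_ge_zero order_trans by blast+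
  define r where "r = max (norm z) (norm (Q / z))"
  have r: "0 \<le> r" "r < 1"
    using z Qz by (auto simp: r_def le_max_iff_disj)
  have c_le: "norm (c k) \<le> r ^ nat \<bar>k\<bar>" for k
  proof (cases "k \<ge> 0")
    case True
    then obtain m where m: "k = int m" by (metis nonneg_int_cases)
    have e: "k * (k - 1) div 2 \<ge> 0"
      using True by (cases "k = 0") auto
    have "norm (c k) = norm Q powi (k * (k - 1) div 2) * norm z ^ m"
      by (simp add: c_def norm_mult norm_power_int norm_power m)
    also have "\<dots> \<le> 1 * r ^ m"
      using Q1 e by (intro mult_mono power_mono) (auto simp: power_int_def r_def power_le_one)
    finally show ?thesis by (simp add: m)
  next
    case False
    then obtain m where m: "k = - int m" by (metis nonneg_int_cases minus_minus neg_0_le_iff_le nle_le)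
    have e: "k * (k - 1) div 2 = int m * (int m - 1) div 2 + int m"
    proof -
      have "2 * (k * (k - 1) div 2) = k * (k - 1)" "2 * (int m * (int m - 1) div 2) = int m * (int m - 1)"
        by (auto simp: dvd_mult_div_cancel)
      then show ?thesis
        unfolding m by (simp add: algebra_simps)
    qed
    have e0: "int m * (int m - 1) div 2 \<ge> 0"
      using False by (auto simp: m)
    have "norm (c k) = norm Q powi (int m * (int m - 1) div 2) * (norm Q ^ m * norm z powi (- int m))"
      unfolding c_def e using Q0 by (simp add: norm_mult norm_power_int norm_power power_int_add m)
    also have "norm Q ^ m * norm z powi (- int m) = norm (Q / z) ^ m"
      by (simp add: norm_divide power_divide power_int_minus field_simps)
    also have "norm Q powi (int m * (int m - 1) div 2) * norm (Q / z) ^ m \<le> 1 * r ^ m"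
      using Q1 e0 by (intro mult_mono power_mono) (auto simp: power_int_def r_def power_le_one)
    finally show ?thesis by (simp add: m)
  qed
  have "(\<lambda>n. \<Sum>\<^sub>\<infinity>k. a k n) \<longlonglongrightarrow> (\<Sum>\<^sub>\<infinity>k. c k * (P / (P * P)))"
  proof (rule tendsto_infsum_dominated)
    fix k
    have 1: "(\<lambda>n. qfact Q (2 * n)) \<longlonglongrightarrow> P"
      by (rule filterlim_compose[OF qf]) (simp add: filterlim_subseq strict_mono_def)
    have 2: "(\<lambda>n. qfact Q (nat (int n + k))) \<longlonglongrightarrow> P" for k
    proof (rule filterlim_compose[OF qf])
      show "filterlim (\<lambda>n. nat (int n + k)) sequentially sequentially"
      proof (rule filterlim_at_top[THEN iffD2], intro allI)
        fix Z :: nat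
        show "eventually (\<lambda>n. Z \<le> nat (int n + k)) sequentially"
          by (rule eventually_sequentiallyI[of "Z + nat \<bar>k\<bar>"]) linarith
      qed
    qed
    have "(\<lambda>n. c k * (qfact Q (2 * n) / (qfact Q (nat (int n + k)) * qfact Q (nat (int n - k))))) \<longlonglongrightarrow> c k * (P / (P * P))"
      using 1 2[of k] 2[of "-k"] P0 by (intro tendsto_intros) auto
    then show "(\<lambda>n. a k n) \<longlonglongrightarrow> c k * (P / (P * P))"
    proof (rule Lim_transform_eventually)
      show "eventually (\<lambda>n. c k * (qfact Q (2 * n) / (qfact Q (nat (int n + k)) * qfact Q (nat (int n - k)))) = a k n) sequentially"
        by (rule eventually_sequentiallyI[of "nat \<bar>k\<bar>"]) (auto simp: a_def)
    qed
  next
    have "norm (a k n) \<le> r ^ nat \<bar>k\<bar> * (U * (V * V))" for k n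
    proof (cases "k \<in> {-int n..int n}")
      case True
      then have "norm (a k n) = norm (c k) * (norm (qfact Q (2 * n)) *
         (norm (inverse (qfact Q (nat (int n + k)))) * norm (inverse (qfact Q (nat (int n - k))))))"
        by (simp add: a_def norm_mult norm_divide divide_inverse norm_inverse)
      also have "\<dots> \<le> r ^ nat \<bar>k\<bar> * (U * (V * V))"
        by (intro mult_mono c_le U V) (use UV r in auto)
      finally show ?thesis .
    qed (use UV r in \<open>auto simp: a_def\<close>)
    then show "eventually (\<lambda>n. \<forall>k. norm (a k n) \<le> r ^ nat \<bar>k\<bar> * (U * (V * V))) sequentially"
      by simp
    show "(\<lambda>k. r ^ nat \<bar>k\<bar> * (U * (V * V))) summable_on UNIV"
      by (rule summable_on_cmult_left[OF summable_on_int_geometric[OF r]])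
  qed simp
  moreover have "(\<Sum>\<^sub>\<infinity>k. a k n) = (\<Prod>j<n. 1 - z * Q ^ j) * (\<Prod>j<n. 1 - Q / z * Q ^ j)" for n
  proof -
    have "(\<Sum>\<^sub>\<infinity>k. a k n) = (\<Sum>\<^sub>\<infinity>k\<in>{-int n..int n}. a k n)"
      by (rule infsum_cong_neutral) (auto simp: a_def)
    also have "\<dots> = (\<Prod>j<n. 1 - z * Q ^ j) * (\<Prod>j<n. 1 - Q / z * Q ^ j)"
      unfolding finite_triple_product[OF Q1 Q0 z0] by (simp add: a_def c_def)
    finally show ?thesis .
  qed
  moreover have "(\<lambda>n. (\<Prod>j<n. 1 - z * Q ^ j) * (\<Prod>j<n. 1 - Q / z * Q ^ j)) \<longlonglongrightarrow> qprod z Q * qprod (Q / z) Q"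
    by (intro tendsto_mult qprod_convergent Q1 z Qz)
  ultimately have "(\<Sum>\<^sub>\<infinity>k. c k * (P / (P * P))) = qprod z Q * qprod (Q / z) Q"
    by (simp add: LIMSEQ_unique)
  then have "(\<Sum>\<^sub>\<infinity>k. c k) * (P / (P * P)) = qprod z Q * qprod (Q / z) Q"
    by (simp only: infsum_cmult_left')
  then have "(\<Sum>\<^sub>\<infinity>k. c k) = P * (qprod z Q * qprod (Q / z) Q)"
    using P0 by (simp add: field_simps)
  then show ?thesis
    by (simp add: c_def P_def mult.assoc)
qed


section \<open>Inversion of theta series\<close>

lemma cos_le_exp_neg_square:
  fixes x :: real
  assumes "\<bar>x\<bar> \<le> pi / 2"
  shows "cos x \<le> exp (- x\<^sup>2 / 2)"
proof -
  have nonneg: "cos y * exp (y\<^sup>2 / 2) \<le> cos 0 * exp (0\<^sup>2 / 2)" if y: "0 \<le> y" "y \<le> pi / 2" for y :: real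
  proof (rule DERIV_nonpos_imp_nonincreasing[OF y(1)])
    fix u assume u: "0 \<le> u" "u \<le> y"
    have *: "u * cos u - sin u \<le> 0 * cos 0 - sin 0"
    proof (rule DERIV_nonpos_imp_nonincreasing[OF u(1)])
      fix v assume v: "0 \<le> v" "v \<le> u"
      have "((\<lambda>u. u * cos u - sin u) has_real_derivative - (v * sin v)) (at v)"
        by (auto intro!: derivative_eq_intros)
      moreover have "sin v \<ge> 0"
        using u v y by (intro sin_ge_zero) auto
      ultimately show "\<exists>d. ((\<lambda>u. u * cos u - sin u) has_real_derivative d) (at v) \<and> d \<le> 0"
        using v by (intro exI[of _ "- (v * sin v)"]) auto
    qed
    have "((\<lambda>u. cos u * exp (u\<^sup>2 / 2)) has_real_derivative (u * cos u - sin u) * exp (u\<^sup>2 / 2)) (at u)"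
      by (auto intro!: derivative_eq_intros simp: algebra_simps)
    then show "\<exists>d. ((\<lambda>u. cos u * exp (u\<^sup>2 / 2)) has_real_derivative d) (at u) \<and> d \<le> 0"
      using * by (intro exI[of _ "(u * cos u - sin u) * exp (u\<^sup>2 / 2)"]) (auto intro: mult_nonpos_nonneg)
  qed
  have "cos \<bar>x\<bar> * exp (\<bar>x\<bar>\<^sup>2 / 2) \<le> 1"
    using nonneg[of "\<bar>x\<bar>"] assms by simp
  then have "cos x * exp (x\<^sup>2 / 2) \<le> 1"
    by simp
  then show ?thesis
    by (simp add: exp_minus field_simps)
qed

lemma artanh_bounds:
  fixes x :: real
  assumes "0 \<le> x" "x < 1"
  shows "(1 - x) / (1 + x) \<le> exp (- 2 * x)" "exp (- 2 * x / (1 - x\<^sup>2)) \<le> (1 - x) / (1 + x)"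
proof -
  define g where "g y = ln (1 + y) - ln (1 - y)" for y :: real
  have "2 * x \<le> g x \<and> g x \<le> 2 * x / (1 - x\<^sup>2)"
  proof (cases "x = 0")
    case False
    then have x: "0 < x" using assms by simp
    have "\<exists>z>0. z < x \<and> g x - g 0 = (x - 0) * (2 / (1 - z\<^sup>2))"
    proof (rule MVT2[OF x])
      fix y assume y: "0 \<le> y" "y \<le> x"
      have sq: "1 - y\<^sup>2 = (1 + y) * (1 - y)" by (simp add: power2_eq_square algebra_simps)
      show "(g has_real_derivative 2 / (1 - y\<^sup>2)) (at y)"
        unfolding g_def using y assms
        by (auto intro!: derivative_eq_intros simp: sq divide_simps)
    qed
    then obtain z where z: "0 < z" "z < x" "g x = x * (2 / (1 - z\<^sup>2))"
      by (auto simp: g_def)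
    have zx: "z\<^sup>2 \<le> x\<^sup>2" using z by (intro power_mono) auto
    have x1: "x\<^sup>2 < 1" using assms by (simp add: power_less_one_iff abs_square_less_1)
    have "2 / (1 - z\<^sup>2) \<ge> 2" using zx x1 by (simp add: field_simps)
    moreover have "2 / (1 - z\<^sup>2) \<le> 2 / (1 - x\<^sup>2)"
      using zx x1 by (intro divide_left_mono) (auto intro: mult_pos_pos)
    ultimately show ?thesis
      unfolding z(3) using x mult_left_mono[of 2 "2 / (1 - z\<^sup>2)" x] mult_left_mono[of "2 / (1 - z\<^sup>2)" "2 / (1 - x\<^sup>2)" x]
      by (simp add: mult.commute)
  qed (auto simp: g_def)
  moreover have "exp (- g x) = (1 - x) / (1 + x)"
    using assms by (simp add: g_def exp_diff)
  ultimately show "(1 - x) / (1 + x) \<le> exp (- 2 * x)" "exp (- 2 * x / (1 - x\<^sup>2)) \<le> (1 - x) / (1 + x)"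
    by (metis exp_le_cancel_iff minus_mult_left neg_le_iff_le, metis exp_le_cancel_iff minus_mult_left neg_le_iff_le minus_divide_left)
qed

lemma binomial_near_centre:
  assumes "E \<le> m"
  defines "x \<equiv> real E / real (m + 1)"
  shows "real ((2 * m + 1) choose (m - E)) \<le> real ((2 * m + 1) choose m) * exp (- real (E * (E + 1)) / real (m + 1))"
    and "real ((2 * m + 1) choose m) * exp (- real (E * (E + 1)) / (real (m + 1) * (1 - x\<^sup>2))) \<le> real ((2 * m + 1) choose (m - E))"
proof -
  have ratio: "real ((2 * m + 1) choose (m - Suc i)) =
     real ((2 * m + 1) choose (m - i)) * ((1 - real (Suc i) / real (m + 1)) / (1 + real (Suc i) / real (m + 1)))"
    if i: "i < m" for i
  proof -
    define j where "j = m - Suc i"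
    have j: "m - i = Suc j" "m - Suc i = j" "m = Suc (i + j)" using i by (auto simp: j_def)
    have "(Suc j) * ((2 * m + 1) choose (Suc j)) = (2 * m + 1 - j) * ((2 * m + 1) choose j)"
      using binomial_absorb_comp[of "2 * m + 1" j] binomial_absorption[of j "2 * m + 1"] by simp
    then have "real (Suc j) * real ((2 * m + 1) choose (Suc j)) = real (2 * m + 1 - j) * real ((2 * m + 1) choose j)"
      by (metis of_nat_mult)
    also have "real (2 * m + 1 - j) = real (m + i + 2)"
      using j by simp
    finally have *: "real ((2 * m + 1) choose j) = real ((2 * m + 1) choose (Suc j)) * (real (Suc j) / real (m + i + 2))"
      by (simp add: field_simps)
    have "(1 - real (Suc i) / real (m + 1)) / (1 + real (Suc i) / real (m + 1)) = real (Suc j) / real (m + i + 2)"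
    proof -
      have gen: "(1 - v / u) / (1 + v / u) = (u - v) / (u + v)" if "u > 0" "v > 0" for u v :: real
      proof -
        have "1 - v / u = (u - v) / u" "1 + v / u = (u + v) / u"
          using that by (simp_all add: diff_divide_distrib add_divide_distrib)
        then show ?thesis using that by simp
      qed
      have "real (m + 1) - real (Suc i) = real (Suc j)" "real (m + 1) + real (Suc i) = real (m + i + 2)"
        unfolding j(3) by simp_all
      then show ?thesis
        using gen[of "real (m + 1)" "real (Suc i)"] by simp
    qed
    with * show ?thesis unfolding j(1,2) by simp
  qed
  have expo: "- real (i * (i + 1)) / (real (m + 1) * w) + - 2 * (real (Suc i) / real (m + 1)) / w =
      - real (Suc i * (Suc i + 1)) / (real (m + 1) * w)" for i w
  proof -
    have "- 2 * (real (Suc i) / real (m + 1)) / w = (- 2 * real (Suc i)) / (real (m + 1) * w)"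
      by simp
    moreover have "- real (Suc i * (Suc i + 1)) = - real (i * (i + 1)) + - 2 * real (Suc i)"
      by (simp add: algebra_simps)
    ultimately show ?thesis
      by (simp only: add_divide_distrib)
  qed
  have "real ((2 * m + 1) choose (m - i)) \<le> real ((2 * m + 1) choose m) * exp (- real (i * (i + 1)) / real (m + 1))"
    if "i \<le> m" for i
    using that
  proof (induction i)
    case (Suc i)
    let ?y = "real (Suc i) / real (m + 1)"
    have "real ((2 * m + 1) choose (m - Suc i)) \<le> real ((2 * m + 1) choose m) * exp (- real (i * (i + 1)) / real (m + 1)) * exp (- 2 * ?y)"
      unfolding ratio[OF Suc_le_lessD[OF Suc.prems]]
      using Suc by (intro mult_mono artanh_bounds) auto
    also have "\<dots> = real ((2 * m + 1) choose m) * exp (- real (Suc i * (Suc i + 1)) / real (m + 1))"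
      using expo[of i 1] by (simp only: mult.assoc mult_1_right div_by_1 flip: exp_add)
    finally show ?case .
  qed simp
  then show "real ((2 * m + 1) choose (m - E)) \<le> real ((2 * m + 1) choose m) * exp (- real (E * (E + 1)) / real (m + 1))"
    using assms by blast
  have x: "0 \<le> x" "x < 1" using assms by (auto simp: x_def)
  have "real ((2 * m + 1) choose m) * exp (- real (i * (i + 1)) / (real (m + 1) * (1 - x\<^sup>2))) \<le> real ((2 * m + 1) choose (m - i))"
    if "i \<le> E" for i
    using that
  proof (induction i)
    case (Suc i)
    let ?y = "real (Suc i) / real (m + 1)"
    have y: "0 \<le> ?y" "?y \<le> x" using Suc.prems by (auto simp: x_def divide_right_mono)
    have y2: "?y\<^sup>2 \<le> x\<^sup>2" "x\<^sup>2 < 1" using y x by (auto intro!: power_mono simp: abs_square_less_1)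
    have "real ((2 * m + 1) choose m) * exp (- real (Suc i * (Suc i + 1)) / (real (m + 1) * (1 - x\<^sup>2))) =
      real ((2 * m + 1) choose m) * exp (- real (i * (i + 1)) / (real (m + 1) * (1 - x\<^sup>2))) * exp (- 2 * ?y / (1 - x\<^sup>2))"
      using expo[of i "1 - x\<^sup>2"] by (simp only: mult.assoc flip: exp_add)
    also have "\<dots> \<le> real ((2 * m + 1) choose (m - i)) * ((1 - ?y) / (1 + ?y))"
    proof (intro mult_mono)
      have "- 2 * ?y / (1 - x\<^sup>2) \<le> - 2 * ?y / (1 - ?y\<^sup>2)"
      proof -
        have le: "2 * v / (1 - u\<^sup>2) \<le> 2 * v / (1 - x\<^sup>2)" if "0 \<le> v" "u\<^sup>2 \<le> x\<^sup>2" for u v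
          using that y2(2) by (intro divide_left_mono mult_pos_pos) auto
        show ?thesis
          using le[OF y(1) y2(1)] by (simp only: mult_minus_left minus_divide_left[symmetric] neg_le_iff_le)
      qed
      then show "exp (- 2 * ?y / (1 - x\<^sup>2)) \<le> (1 - ?y) / (1 + ?y)"
        using artanh_bounds(2)[of ?y] y x by (meson exp_le_cancel_iff le_less_trans order_trans)
    qed (use Suc in auto)
    also have "\<dots> = real ((2 * m + 1) choose (m - Suc i))"
      using ratio[of i] Suc.prems assms by simp
    finally show ?case .
  qed simp
  then show "real ((2 * m + 1) choose m) * exp (- real (E * (E + 1)) / (real (m + 1) * (1 - x\<^sup>2))) \<le> real ((2 * m + 1) choose (m - E))"
    by blast
qed

lemma central_binomial_asymptotics:
  "(\<lambda>m. real ((2 * m + 1) choose m) / 2 ^ (2 * m + 1) * sqrt (real (2 * m + 3))) \<longlonglongrightarrow> sqrt (2 / pi)"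
proof -
  define W where "W n = (\<Prod>k=1..n. (4*real k^2) / (4*real k^2 - 1))" for n
  define c where "c n = real ((2 * n) choose n) / 4 ^ n" for n
  have Wpos: "W n > 0" for n
    unfolding W_def
  proof (intro prod_pos ballI)
    fix k assume "k \<in> {1..n}"
    then have "real k ^ 2 \<ge> 1" by (simp add: one_le_power)
    then show "0 < 4 * (real k)\<^sup>2 / (4 * (real k)\<^sup>2 - 1)" by (intro divide_pos_pos) linarith+
  qed
  have cS: "c (Suc n) = c n * (real (2 * n + 1) / real (2 * n + 2))" for n
  proof -
    have "(Suc n) * (Suc n * ((2 * Suc n) choose Suc n)) = (2 * n + 2) * ((2 * n + 1) * ((2 * n) choose n))"
    proof -
      have "Suc n * ((2 * Suc n) choose Suc n) = (2 * n + 2) * ((2 * n + 1) choose n)"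
        using Suc_times_binomial[of n "2 * n + 1"] by simp
      moreover have "Suc n * ((2 * n + 1) choose n) = (2 * n + 1) * ((2 * n) choose n)"
        using binomial_absorb_comp[of "2 * n + 1" n] by simp
      ultimately show ?thesis
        by (metis mult.left_commute)
    qed
    then have *: "real (Suc n) * (real (Suc n) * real ((2 * Suc n) choose Suc n)) = real (2 * n + 2) * (real (2 * n + 1) * real ((2 * n) choose n))"
      by (metis of_nat_mult)
    have "X / 4 ^ Suc n = Y / 4 ^ n * (d / b)"
      if "a * (a * X) = b * (d * Y)" "b = 2 * a" "a > 0" for a b d X Y :: real
    proof -
      have "X = 2 * d * Y / a" using that by (simp add: field_simps)
      then show ?thesis using that(2,3) by (simp add: field_simps)
    qed
    from this[OF *] show ?thesis
      unfolding c_def by simp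
  qed
  have cW: "c n ^ 2 * real (2 * n + 1) * W n = 1" for n
  proof (induction n)
    case (Suc n)
    have WS: "W (Suc n) = W n * ((4*real (Suc n)^2) / (4*real (Suc n)^2 - 1))"
      by (simp add: W_def)
    have "4*real (Suc n)^2 - 1 = real (2 * n + 1) * real (2 * n + 3)"
      by (simp add: power2_eq_square algebra_simps)
    moreover have "4*real (Suc n)^2 = real (2 * n + 2) ^ 2"
      by (simp add: power2_eq_square algebra_simps)
    ultimately have WS: "W (Suc n) = W n * (real (2 * n + 2) ^ 2 / (real (2 * n + 1) * real (2 * n + 3)))"
      using WS by simp
    have "c (Suc n) ^ 2 * real (2 * Suc n + 1) * W (Suc n) = c n ^ 2 * real (2 * n + 1) * W n * 1"
      unfolding cS WS by (simp add: power2_eq_square divide_simps)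
    then show ?case using Suc by simp
  qed (simp add: c_def W_def)
  have "c n * sqrt (real (2 * n + 1)) = sqrt (1 / W n)" for n
  proof (rule real_sqrt_unique[symmetric])
    show "(c n * sqrt (real (2 * n + 1)))\<^sup>2 = 1 / W n"
      using cW[of n] Wpos[of n] by (simp add: power_mult_distrib field_simps)
  qed (simp_all add: c_def)
  moreover have "(\<lambda>n. sqrt (1 / W n)) \<longlonglongrightarrow> sqrt (1 / (pi / 2))"
    unfolding W_def by (intro tendsto_intros wallis) auto
  ultimately have "(\<lambda>n. c n * sqrt (real (2 * n + 1))) \<longlonglongrightarrow> sqrt (2 / pi)"
    by simp
  then have "(\<lambda>n. c (Suc n) * sqrt (real (2 * Suc n + 1))) \<longlonglongrightarrow> sqrt (2 / pi)"
    by (rule LIMSEQ_Suc)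
  moreover have "c (Suc m) = real ((2 * m + 1) choose m) / 2 ^ (2 * m + 1)" for m
  proof -
    have "(2 * Suc m) choose Suc m = 2 * ((2 * m + 1) choose m)"
      using binomial_symmetric[of "Suc m" "2 * m + 1"] by simp
    then show ?thesis
      by (simp add: c_def power_mult)
  qed
  ultimately show ?thesis
    by (simp add: add.commute)
qed


lemma sum_cis_centred:
  fixes u :: int and p :: nat
  defines "l \<equiv> 2 * p + 1"
  shows "(\<Sum>k\<in>{-int p..int p}. cis (2 * pi * of_int u * of_int k / real l)) = (if int l dvd u then of_nat l else 0)"
proof -
  define \<zeta> where "\<zeta> = cis (2 * pi * of_int u / real l)"
  have l: "l > 0" by (simp add: l_def)
  have pow: "\<zeta> ^ i = cis (2 * pi * of_int u * real i / real l)" for i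
    by (simp add: \<zeta>_def Complex.DeMoivre mult_ac)
  have "(\<Sum>k\<in>{-int p..int p}. cis (2 * pi * of_int u * of_int k / real l)) =
      (\<Sum>i<l. cis (- (2 * pi * of_int u * real p / real l)) * \<zeta> ^ i)"
    by (rule sum.reindex_bij_witness[of _ "\<lambda>i. int i - int p" "\<lambda>k. nat (k + int p)"])
       (auto simp: l_def pow cis_mult add_divide_distrib diff_divide_distrib algebra_simps)
  also have "\<dots> = cis (- (2 * pi * of_int u * real p / real l)) * (\<Sum>i<l. \<zeta> ^ i)"
    by (simp add: sum_distrib_left)
  also have "\<dots> = (if int l dvd u then of_nat l else 0)"
  proof (cases "int l dvd u")
    case True
    then obtain v where v: "u = int l * v" by auto
    have cis_int: "cis x = 1" if "x = 2 * pi * of_int j" for x and j :: int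
      by (simp add: that complex_eq_iff cos_int_2pin sin_int_2pin)
    have "\<zeta> = 1"
      unfolding \<zeta>_def by (rule cis_int[of _ v]) (use l in \<open>simp add: v\<close>)
    moreover have "cis (- (2 * pi * of_int u * real p / real l)) = 1"
      by (rule cis_int[of _ "- v * int p"]) (use l in \<open>simp add: v\<close>)
    ultimately show ?thesis using True by simp
  next
    case False
    have "\<zeta> \<noteq> 1"
    proof
      assume "\<zeta> = 1"
      then have "cos (2 * pi * of_int u / real l) = 1" by (simp add: \<zeta>_def complex_eq_iff)
      then obtain j :: int where "2 * pi * of_int u / real l = of_int j * 2 * pi"
        using cos_one_2pi_int by auto
      then have "real_of_int u = real_of_int (j * int l)" using l by (simp add: field_simps)
      then have "u = j * int l" by linarith
      with False show False by simp
    qed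
    moreover have "\<zeta> ^ l = 1"
      using l by (simp add: pow complex_eq_iff cos_int_2pin sin_int_2pin)
    ultimately have "(\<Sum>i<l. \<zeta> ^ i) = 0"
      by (simp add: sum_gp_strict)
    then show ?thesis using False by simp
  qed
  finally show ?thesis .
qed

lemma cos_power_expansion:
  "complex_of_real (cos x ^ M) = (\<Sum>j\<le>M. of_nat (M choose j) / 2 ^ M * cis ((real M - 2 * real j) * x))"
proof -
  have "complex_of_real (cos x) = (cis (- x) + cis x) / 2"
    by (simp add: complex_eq_iff)
  then have "complex_of_real (cos x ^ M) = (cis (- x) + cis x) ^ M / 2 ^ M"
    by (simp only: of_real_power power_divide)
  also have "(cis (- x) + cis x) ^ M = (\<Sum>j\<le>M. of_nat (M choose j) * cis (- x) ^ j * cis x ^ (M - j))"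
    by (rule binomial_ring)
  also have "\<dots> = (\<Sum>j\<le>M. of_nat (M choose j) * cis ((real M - 2 * real j) * x))"
    by (intro sum.cong refl) (simp add: Complex.DeMoivre cis_mult mult.assoc of_nat_diff algebra_simps)
  finally show ?thesis
    by (simp add: sum_divide_distrib)
qed

lemma alternating_cos_power_sum:
  fixes a :: real and p m :: nat
  defines "l \<equiv> 2 * p + 1" and "M \<equiv> 2 * m + 1"
  shows "(\<Sum>k\<in>{-int p..int p}. (-1) powi k * complex_of_real (cos (pi * (of_int k + a) / real l) ^ M)) =
    (\<Sum>\<nu>\<in>{\<nu>. \<bar>int l * (2 * \<nu> + 1)\<bar> \<le> int M}.
       of_nat l * (of_nat (M choose nat ((int M - int l * (2 * \<nu> + 1)) div 2)) / 2 ^ M) * cis (pi * (2 * of_int \<nu> + 1) * a))"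
proof -
  have l: "l > 0" by (simp add: l_def)
  define u where "u j = (int l + int M) div 2 - int j" for j
  have u: "2 * u j = int l + int M - 2 * int j" for j
    by (simp add: u_def l_def M_def)
  have sign: "(-1) powi k = cis (pi * of_int k)" for k :: int
    using cis_power_int[of pi k] by (simp add: cis_pi mult.commute)
  have "(\<Sum>k\<in>{-int p..int p}. (-1) powi k * complex_of_real (cos (pi * (of_int k + a) / real l) ^ M)) =
      (\<Sum>k\<in>{-int p..int p}. \<Sum>j\<le>M. of_nat (M choose j) / 2 ^ M *
         cis ((real M - 2 * real j) * pi * a / real l) * cis (2 * pi * of_int (u j) * of_int k / real l))"
  proof (intro sum.cong refl)
    fix k :: int
    have *: "cis (pi * of_int k) * cis ((real M - 2 * real j) * (pi * (of_int k + a) / real l)) =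
        cis ((real M - 2 * real j) * pi * a / real l) * cis (2 * pi * of_int (u j) * of_int k / real l)" for j
    proof -
      have uj: "2 * real_of_int (u j) = real l + real M - 2 * real j"
        using arg_cong[OF u[of j], of real_of_int] by simp
      have "2 * pi * of_int (u j) * of_int k / real l = (2 * of_int (u j)) * (pi * of_int k) / real l"
        by simp
      also have "\<dots> = pi * of_int k + (real M - 2 * real j) * (pi * of_int k) / real l"
        unfolding uj using l by (simp add: field_simps)
      finally show ?thesis
        by (simp only: cis_mult) (rule arg_cong[of _ _ cis], simp add: add_divide_distrib distrib_left distrib_right mult_ac)
    qed
    show "(-1) powi k * complex_of_real (cos (pi * (of_int k + a) / real l) ^ M) =
      (\<Sum>j\<le>M. of_nat (M choose j) / 2 ^ M * cis ((real M - 2 * real j) * pi * a / real l) * cis (2 * pi * of_int (u j) * of_int k / real l))"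
      unfolding cos_power_expansion sign sum_distrib_left mult.assoc *[unfolded mult.assoc, symmetric]
      by (intro sum.cong refl) (simp add: mult_ac)
  qed
  also have "\<dots> = (\<Sum>j\<le>M. \<Sum>k\<in>{-int p..int p}. of_nat (M choose j) / 2 ^ M *
         cis ((real M - 2 * real j) * pi * a / real l) * cis (2 * pi * of_int (u j) * of_int k / real l))"
    by (rule sum.swap)
  also have "\<dots> = (\<Sum>j\<le>M. of_nat (M choose j) / 2 ^ M * cis ((real M - 2 * real j) * pi * a / real l) *
      (if int l dvd u j then of_nat l else 0))"
    using sum_cis_centred[of _ p] by (simp only: sum_distrib_left[symmetric] l_def)
  also have "\<dots> = (\<Sum>j\<in>{j. j \<le> M \<and> int l dvd u j}. of_nat l * (of_nat (M choose j) / 2 ^ M) * cis ((real M - 2 * real j) * pi * a / real l))"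
    by (rule sum.mono_neutral_cong_right) auto
  also have "\<dots> = (\<Sum>\<nu>\<in>{\<nu>. \<bar>int l * (2 * \<nu> + 1)\<bar> \<le> int M}.
       of_nat l * (of_nat (M choose nat ((int M - int l * (2 * \<nu> + 1)) div 2)) / 2 ^ M) * cis (pi * (2 * of_int \<nu> + 1) * a))"
  proof (rule sum.reindex_bij_witness[of _ "\<lambda>\<nu>. nat ((int M - int l * (2 * \<nu> + 1)) div 2)" "\<lambda>j. u j div int l - 1"])
    fix j assume "j \<in> {j. j \<le> M \<and> int l dvd u j}"
    then obtain v where v: "u j = int l * v" and jM: "j \<le> M" by auto
    have lv: "int l * (2 * (v - 1) + 1) = int M - 2 * int j"
      using u[of j] unfolding v by (simp add: algebra_simps)
    have uv: "u j div int l - 1 = v - 1" using l by (simp add: v)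
    show j: "nat ((int M - int l * (2 * (u j div int l - 1) + 1)) div 2) = j"
      unfolding uv lv by simp
    show "u j div int l - 1 \<in> {\<nu>. \<bar>int l * (2 * \<nu> + 1)\<bar> \<le> int M}"
      unfolding mem_Collect_eq uv lv using jM by auto
    have Mj: "real M - 2 * real j = real l * (2 * of_int (v - 1) + 1)"
      using arg_cong[OF lv, of real_of_int] by simp
    have "cis ((real M - 2 * real j) * pi * a / real l) = cis (pi * (2 * of_int (v - 1) + 1) * a)"
      unfolding Mj using l by (intro arg_cong[of _ _ cis]) simp
    then show "of_nat l * (of_nat (M choose nat ((int M - int l * (2 * (u j div int l - 1) + 1)) div 2)) / 2 ^ M) *
         cis (pi * (2 * of_int (u j div int l - 1) + 1) * a) =
        of_nat l * (of_nat (M choose j) / 2 ^ M) * cis ((real M - 2 * real j) * pi * a / real l)"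
      unfolding j unfolding uv by simp
  next
    fix \<nu> :: int assume \<nu>: "\<nu> \<in> {\<nu>. \<bar>int l * (2 * \<nu> + 1)\<bar> \<le> int M}"
    define D where "D = (int M - int l * (2 * \<nu> + 1)) div 2"
    have D: "2 * D = int M - int l * (2 * \<nu> + 1)"
      by (simp add: D_def M_def l_def)
    have D0: "D \<ge> 0" "D \<le> int M" using D \<nu> by auto
    have "2 * u (nat D) = 2 * (int l * (\<nu> + 1))"
      unfolding u using D D0 by (simp add: algebra_simps)
    then have uD: "u (nat D) = int l * (\<nu> + 1)" by simp
    show "u (nat ((int M - int l * (2 * \<nu> + 1)) div 2)) div int l - 1 = \<nu>"
      unfolding D_def[symmetric] uD using l by simp
    show "nat ((int M - int l * (2 * \<nu> + 1)) div 2) \<in> {j. j \<le> M \<and> int l dvd u j}"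
      unfolding D_def[symmetric] mem_Collect_eq uD using D0 by simp
  qed
  finally show ?thesis .
qed

lemma odd_binomial_weight:
  fixes d :: int and m :: nat
  assumes d: "odd d" "\<bar>d\<bar> \<le> int (2 * m + 1)"
  defines "w \<equiv> real ((2 * m + 1) choose nat ((int (2 * m + 1) - d) div 2))" and "c \<equiv> real ((2 * m + 1) choose m)"
  shows "w \<le> c * exp (- ((of_int d)\<^sup>2 - 1) / (4 * real (m + 1)))"
    and "c * exp (- ((of_int d)\<^sup>2 - 1) / (4 * real (m + 1) * (1 - (of_int d)\<^sup>2 / (2 * real (m + 1))\<^sup>2))) \<le> w"
proof -
  define E where "E = nat ((\<bar>d\<bar> - 1) div 2)"
  have absd: "\<bar>d\<bar> = 2 * int E + 1"
  proof -
    have "odd \<bar>d\<bar>" using d(1) by simp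
    then obtain b where b: "\<bar>d\<bar> = 2 * b + 1" by (elim oddE)
    then have "b \<ge> 0" by linarith
    then show ?thesis by (simp add: E_def b)
  qed
  have E: "E \<le> m" using d(2) absd by linarith
  have w: "w = real ((2 * m + 1) choose (m - E))"
  proof (cases "d > 0")
    case True
    then have "d = 2 * int E + 1" using absd by simp
    then have "nat ((int (2 * m + 1) - d) div 2) = m - E" using E by simp
    then show ?thesis by (simp add: w_def)
  next
    case False
    then have "d = - (2 * int E + 1)" using absd by simp
    then have "nat ((int (2 * m + 1) - d) div 2) = m + 1 + E" by simp
    moreover have "(2 * m + 1) choose (m + 1 + E) = (2 * m + 1) choose (m - E)"
      using binomial_symmetric[of "m + 1 + E" "2 * m + 1"] E by simp
    ultimately show ?thesis by (simp add: w_def)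
  qed
  have d2: "(real_of_int d)\<^sup>2 = (2 * real E + 1)\<^sup>2"
    using absd by (metis abs_of_nonneg of_int_abs of_int_add of_int_mult of_int_numeral of_int_1 of_int_of_nat_eq power2_abs)
  have EE: "real (E * (E + 1)) = ((of_int d)\<^sup>2 - 1) / 4"
    unfolding d2 by (simp add: power2_eq_square algebra_simps)
  show "w \<le> c * exp (- ((of_int d)\<^sup>2 - 1) / (4 * real (m + 1)))"
    using binomial_near_centre(1)[OF E] unfolding w c_def EE
    by (simp only: minus_divide_left divide_divide_eq_left)
  define x where "x = real E / real (m + 1)"
  define y where "y = (of_int d)\<^sup>2 / (2 * real (m + 1))\<^sup>2"
  have xy: "x\<^sup>2 \<le> y"
    unfolding y_def d2 x_def power_divide[symmetric] by (intro power_mono) (auto simp: divide_simps algebra_simps)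
  have y1: "y < 1"
  proof -
    have "(2 * real E + 1) < 2 * real (m + 1)" using E by simp
    then show ?thesis unfolding y_def d2 power_divide[symmetric]
      by (simp add: power_less_one_iff abs_square_less_1)
  qed
  have "((of_int d)\<^sup>2 - 1) / (4 * real (m + 1) * (1 - x\<^sup>2)) \<le> ((of_int d)\<^sup>2 - 1) / (4 * real (m + 1) * (1 - y))"
  proof (intro divide_left_mono mult_left_mono)
    show "0 \<le> (real_of_int d)\<^sup>2 - 1"
      unfolding d2 by (simp add: power2_eq_square algebra_simps)
    show "0 < 4 * real (m + 1) * (1 - x\<^sup>2) * (4 * real (m + 1) * (1 - y))"
      using xy y1 by (intro mult_pos_pos) auto
  qed (use xy in auto)
  then have "c * exp (- ((of_int d)\<^sup>2 - 1) / (4 * real (m + 1) * (1 - y))) \<le> c * exp (- (((of_int d)\<^sup>2 - 1) / (4 * real (m + 1) * (1 - x\<^sup>2))))"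
    by (intro mult_left_mono) (simp_all only: exp_le_cancel_iff minus_divide_left[symmetric] neg_le_iff_le c_def of_nat_0_le_iff)
  also have "\<dots> = c * exp (- real (E * (E + 1)) / (real (m + 1) * (1 - x\<^sup>2)))"
    unfolding EE by simp
  also have "\<dots> \<le> w"
    using binomial_near_centre(2)[OF E] unfolding w c_def x_def by simp
  finally show "c * exp (- ((of_int d)\<^sup>2 - 1) / (4 * real (m + 1) * (1 - (of_int d)\<^sup>2 / (2 * real (m + 1))\<^sup>2))) \<le> w"
    by (simp only: y_def)
qed

theorem theta_inversion_real:
  fixes t a :: real
  assumes t: "t > 0" and a: "\<bar>a\<bar> < 1/2"
  shows "(\<Sum>\<^sub>\<infinity>k::int. (-1) powi k * complex_of_real (exp (- (pi * t * (of_int k + a)\<^sup>2)))) =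
    of_real (1 / sqrt t) * (\<Sum>\<^sub>\<infinity>\<nu>::int. complex_of_real (exp (- (pi * (2 * of_int \<nu> + 1)\<^sup>2 / (4 * t)))) * cis (pi * (2 * of_int \<nu> + 1) * a))"
proof -
  define l where "l n = 2 * n + 1" for n :: nat
  define m where "m n = nat \<lfloor>t * (real (l n))\<^sup>2 / pi\<rfloor>" for n
  define M where "M n = 2 * m n + 1" for n
  define u where "u n = 1 / (real (l n))\<^sup>2" for n
  define r where "r n = real (m n) / (real (l n))\<^sup>2" for n
  have l0: "real (l n) > 0" for n by (simp add: l_def)
  have u_lim: "u \<longlonglongrightarrow> 0"
    unfolding u_def[abs_def] l_def by real_asymp
  have l_lim: "(\<lambda>n. 1 / real (l n)) \<longlonglongrightarrow> 0"
    unfolding l_def by real_asymp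
  have r_lim: "r \<longlonglongrightarrow> t / pi"
  proof (rule tendsto_sandwich)
    have m_eq: "real (m n) = of_int \<lfloor>t * (real (l n))\<^sup>2 / pi\<rfloor>" for n
      using t by (simp add: m_def)
    have "t / pi - u n \<le> r n \<and> r n \<le> t / pi" for n
    proof -
      have "t * (real (l n))\<^sup>2 / pi - 1 \<le> real (m n)" "real (m n) \<le> t * (real (l n))\<^sup>2 / pi"
        unfolding m_eq by linarith+
      from divide_right_mono[OF this(1), of "(real (l n))\<^sup>2"] divide_right_mono[OF this(2), of "(real (l n))\<^sup>2"]
      show ?thesis
        using l0[of n] by (simp add: r_def u_def diff_divide_distrib)
    qed
    then show "eventually (\<lambda>n. t / pi - u n \<le> r n) sequentially" "eventually (\<lambda>n. r n \<le> t / pi) sequentially"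
      by auto
    show "(\<lambda>n. t / pi - u n) \<longlonglongrightarrow> t / pi"
      using tendsto_diff[OF tendsto_const u_lim] by simp
  qed auto
  have tpi: "t / pi > 0" using t by simp
  have r_ge: "eventually (\<lambda>n. r n > t / (2 * pi)) sequentially"
    using order_tendstoD(1)[OF r_lim, of "t / (2 * pi)"] t by (simp add: field_simps)
  have r_le: "eventually (\<lambda>n. r n < 2 * t / pi) sequentially"
    using order_tendstoD(2)[OF r_lim, of "2 * t / pi"] t by (simp add: field_simps)
  have u_le: "eventually (\<lambda>n. u n < t / pi) sequentially"
    using order_tendstoD(2)[OF u_lim tpi] .

  define A where "A k n = (if k \<in> {-int n..int n} then (-1) powi k * complex_of_real (cos (pi * (of_int k + a) / real (l n)) ^ M n) else 0)"
    for k n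
  have limA: "(\<lambda>n. \<Sum>\<^sub>\<infinity>k. A k n) \<longlonglongrightarrow> (\<Sum>\<^sub>\<infinity>k::int. (-1) powi k * complex_of_real (exp (- (pi * t * (of_int k + a)\<^sup>2))))"
  proof (rule tendsto_infsum_dominated(1))
    fix k :: int
    define c where "c = pi * (of_int k + a)"
    have c_lim: "(\<lambda>n. cos (c / real (l n)) ^ M n) \<longlonglongrightarrow> exp (- (pi * t * (of_int k + a)\<^sup>2))"
    proof -
      have "(\<lambda>n. (2 * r n + u n) * ((real (l n))\<^sup>2 * ln (cos (c / real (l n))))) \<longlonglongrightarrow> (2 * (t / pi) + 0) * (- (c\<^sup>2 / 2))"
      proof (intro tendsto_intros r_lim u_lim)
        show "(\<lambda>n. (real (l n))\<^sup>2 * ln (cos (c / real (l n)))) \<longlonglongrightarrow> - (c\<^sup>2 / 2)"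
          unfolding l_def power2_eq_square[of c] by real_asymp
      qed
      moreover have "(2 * (t / pi) + 0) * (- (c\<^sup>2 / 2)) = - (pi * t * (of_int k + a)\<^sup>2)"
        by (simp add: c_def power2_eq_square)
      moreover have "(2 * r n + u n) * ((real (l n))\<^sup>2 * y) = real (M n) * y" for n y
        using l0[of n] by (simp add: r_def u_def M_def field_simps)
      ultimately have "(\<lambda>n. exp (real (M n) * ln (cos (c / real (l n))))) \<longlonglongrightarrow> exp (- (pi * t * (of_int k + a)\<^sup>2))"
        by (intro tendsto_exp) simp
      then show ?thesis
      proof (rule Lim_transform_eventually)
        have "(\<lambda>n. cos (c * (1 / real (l n)))) \<longlonglongrightarrow> cos (c * 0)"
          by (intro tendsto_intros l_lim)
        then have "eventually (\<lambda>n. cos (c * (1 / real (l n))) > 0) sequentially"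
          by (rule order_tendstoD) simp
        then show "eventually (\<lambda>n. exp (real (M n) * ln (cos (c / real (l n)))) = cos (c / real (l n)) ^ M n) sequentially"
        proof eventually_elim
          case (elim n)
          then show ?case by (simp add: exp_of_nat_mult)
        qed
      qed
    qed
    have "(\<lambda>n. (-1) powi k * complex_of_real (cos (c / real (l n)) ^ M n)) \<longlonglongrightarrow>
        (-1) powi k * complex_of_real (exp (- (pi * t * (of_int k + a)\<^sup>2)))"
      by (intro tendsto_mult tendsto_const tendsto_of_real c_lim)
    then show "A k \<longlonglongrightarrow> (-1) powi k * complex_of_real (exp (- (pi * t * (of_int k + a)\<^sup>2)))"
    proof (rule Lim_transform_eventually)
      show "eventually (\<lambda>n. (-1) powi k * complex_of_real (cos (c / real (l n)) ^ M n) = A k n) sequentially"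
        by (rule eventually_sequentiallyI[of "nat \<bar>k\<bar>"]) (auto simp: A_def c_def)
    qed
  next
    have k_sq: "(real_of_int k + a)\<^sup>2 \<ge> \<bar>of_int k\<bar> / 4" for k
    proof (cases "k = 0")
      case False
      have sq_id: "(y - 1/2)\<^sup>2 - y / 4 = (y - 1) * (y - 1/4)" for y :: real
        by (simp add: power2_eq_square field_simps)
      from False have k1: "\<bar>real_of_int k\<bar> \<ge> 1" by linarith
      have "(real_of_int k + a)\<^sup>2 = \<bar>real_of_int k + a\<bar>\<^sup>2" by simp
      also have "\<dots> \<ge> (\<bar>of_int k\<bar> - 1/2)\<^sup>2"
        using k1 a by (intro power_mono) linarith+
      also have "(\<bar>real_of_int k\<bar> - 1/2)\<^sup>2 - \<bar>of_int k\<bar> / 4 = (\<bar>of_int k\<bar> - 1) * (\<bar>of_int k\<bar> - 1/4)"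
        by (simp only: sq_id)
      moreover have "(\<bar>real_of_int k\<bar> - 1) * (\<bar>of_int k\<bar> - 1/4) \<ge> 0"
        using k1 by (intro mult_nonneg_nonneg) auto
      ultimately show ?thesis by linarith
    qed auto
    show "eventually (\<lambda>n. \<forall>k. norm (A k n) \<le> exp (- (pi * t / 8)) ^ nat \<bar>k\<bar>) sequentially"
      using r_ge
    proof eventually_elim
      case (elim n)
      show ?case
      proof
        fix k :: int
        show "norm (A k n) \<le> exp (- (pi * t / 8)) ^ nat \<bar>k\<bar>"
        proof (cases "k \<in> {-int n..int n}")
          case True
          define x where "x = pi * (of_int k + a) / real (l n)"
          have "\<bar>real_of_int k + a\<bar> \<le> real n + 1/2" using True a by auto
          then have "pi * \<bar>real_of_int k + a\<bar> \<le> pi * (real n + 1/2)" by simp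
          then have x: "\<bar>x\<bar> \<le> pi / 2"
            using l0[of n] unfolding x_def abs_mult abs_divide by (simp add: l_def field_simps)
          have cos0: "cos x \<ge> 0" using x by (intro cos_ge_zero) auto
          have "norm (A k n) = cos x ^ M n"
            using True cos0 by (simp add: A_def x_def norm_mult norm_power norm_power_int)
          also have "\<dots> \<le> exp (- x\<^sup>2 / 2) ^ M n"
            by (intro power_mono cos_le_exp_neg_square x cos0)
          also have "\<dots> = exp (- (real (M n) * x\<^sup>2 / 2))"
            by (simp flip: exp_of_nat_mult)
          also have "\<dots> \<le> exp (- (real (nat \<bar>k\<bar>) * (pi * t / 8)))"
          proof -
            have "real (M n) * x\<^sup>2 / 2 = (2 * r n + u n) * (pi\<^sup>2 * (of_int k + a)\<^sup>2 / 2)"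
            proof -
              have "x\<^sup>2 = pi\<^sup>2 * (of_int k + a)\<^sup>2 * u n"
                by (simp add: x_def u_def power_divide power_mult_distrib)
              moreover have "2 * r n + u n = real (M n) * u n"
                by (simp add: r_def u_def M_def add_divide_distrib)
              ultimately show ?thesis by simp
            qed
            also have "\<dots> \<ge> (t / pi) * (pi\<^sup>2 * (\<bar>of_int k\<bar> / 4) / 2)"
            proof -
              have "2 * (t / (2 * pi)) < 2 * r n" using elim by linarith
              moreover have "2 * (t / (2 * pi)) = t / pi" by simp
              moreover have "u n \<ge> 0" by (simp add: u_def)
              ultimately have "t / pi \<le> 2 * r n + u n" by linarith
              then show ?thesis
                using k_sq[of k] tpi by (intro mult_mono divide_right_mono mult_left_mono) auto
            qed
            also have "(t / pi) * (pi\<^sup>2 * (\<bar>real_of_int k\<bar> / 4) / 2) = real (nat \<bar>k\<bar>) * (pi * t / 8)"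
              by (simp add: power2_eq_square)
            finally show ?thesis by simp
          qed
          also have "\<dots> = exp (- (pi * t / 8)) ^ nat \<bar>k\<bar>"
            by (simp flip: exp_of_nat_mult)
          finally show ?thesis .
        qed (auto simp: A_def)
      qed
    qed
    show "(\<lambda>k. exp (- (pi * t / 8)) ^ nat \<bar>k\<bar>) summable_on UNIV"
      using t by (intro summable_on_int_geometric) auto
  qed auto

  define w where "w \<nu> n = real (M n choose nat ((int (M n) - int (l n) * (2 * \<nu> + 1)) div 2)) / 2 ^ M n" for \<nu> n
  define B where "B \<nu> n = (if \<bar>int (l n) * (2 * \<nu> + 1)\<bar> \<le> int (M n)
     then complex_of_real (real (l n) * w \<nu> n) * cis (pi * (2 * of_int \<nu> + 1) * a) else 0)" for \<nu> n
  define K where "K n = real (l n) * (real (M n choose m n) / 2 ^ M n)" for n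
  have K_lim: "K \<longlonglongrightarrow> 1 / sqrt t"
  proof -
    have "filterlim m sequentially sequentially"
    proof -
      have "filterlim (\<lambda>n. r n * (real (l n))\<^sup>2) at_top sequentially"
        by (rule filterlim_tendsto_pos_mult_at_top[OF r_lim tpi]) (unfold l_def, real_asymp)
      then have "filterlim (\<lambda>n. real (m n)) at_top sequentially"
        using l0 by (simp add: r_def less_imp_neq[THEN not_sym])
      then show ?thesis
        by (simp add: filterlim_sequentially_iff_filterlim_real)
    qed
    from filterlim_compose[OF central_binomial_asymptotics this]
    have "(\<lambda>n. real (M n choose m n) / 2 ^ M n * sqrt (real (2 * m n + 3))) \<longlonglongrightarrow> sqrt (2 / pi)"
      by (simp only: M_def)
    moreover have "(\<lambda>n. 1 / sqrt (2 * r n + 3 * u n)) \<longlonglongrightarrow> 1 / sqrt (2 * (t / pi) + 3 * 0)"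
      using t by (intro tendsto_intros r_lim u_lim) auto
    ultimately have "(\<lambda>n. (real (M n choose m n) / 2 ^ M n * sqrt (real (2 * m n + 3))) * (1 / sqrt (2 * r n + 3 * u n))) \<longlonglongrightarrow>
        sqrt (2 / pi) * (1 / sqrt (2 * (t / pi) + 3 * 0))"
      by (rule tendsto_mult)
    moreover have "sqrt (2 / pi) * (1 / sqrt (2 * (t / pi) + 3 * 0)) = 1 / sqrt t"
      using t by (simp add: real_sqrt_divide real_sqrt_mult)
    moreover have "(real (M n choose m n) / 2 ^ M n * sqrt (real (2 * m n + 3))) * (1 / sqrt (2 * r n + 3 * u n)) = K n" for n
    proof -
      have "2 * r n + 3 * u n = real (2 * m n + 3) / (real (l n))\<^sup>2"
        by (simp add: r_def u_def add_divide_distrib)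
      then have "sqrt (2 * r n + 3 * u n) = sqrt (real (2 * m n + 3)) / real (l n)"
        using l0[of n] by (simp add: real_sqrt_divide)
      then show ?thesis
        using l0[of n] by (simp add: K_def)
    qed
    ultimately show ?thesis by simp
  qed
  have odd: "odd (int (l n) * (2 * \<nu> + 1))" for n \<nu>
    by (simp add: l_def)
  have scale1: "((real_of_int (int (l n) * (2 * \<nu> + 1)))\<^sup>2 - 1) / (4 * real (m n + 1)) =
      ((2 * of_int \<nu> + 1)\<^sup>2 - u n) / (4 * (r n + u n))" for n \<nu>
    using l0[of n] by (simp add: r_def u_def power_mult_distrib divide_simps) (simp add: algebra_simps)
  have scale2: "(real_of_int (int (l n) * (2 * \<nu> + 1)))\<^sup>2 / (2 * real (m n + 1))\<^sup>2 =
      (2 * of_int \<nu> + 1)\<^sup>2 * u n / (4 * (r n + u n)\<^sup>2)" for n \<nu>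
  proof -
    have gen: "(x * c)\<^sup>2 / (2 * y)\<^sup>2 = c\<^sup>2 * (1 / x\<^sup>2) / (4 * (y / x\<^sup>2)\<^sup>2)" if "x > 0" "y > 0" for x y c :: real
      using that by (simp add: power2_eq_square)
    have "r n + u n = real (m n + 1) / (real (l n))\<^sup>2"
      by (simp add: r_def u_def add_divide_distrib)
    then show ?thesis
      using gen[of "real (l n)" "real (m n + 1)" "2 * of_int \<nu> + 1"] l0[of n] by (simp add: u_def)
  qed
  have w_upper: "real (l n) * w \<nu> n \<le> K n * exp (- (((2 * of_int \<nu> + 1)\<^sup>2 - u n) / (4 * (r n + u n))))"
    if "\<bar>int (l n) * (2 * \<nu> + 1)\<bar> \<le> int (M n)" for n \<nu>
  proof -
    have "w \<nu> n \<le> real (M n choose m n) / 2 ^ M n * exp (- (((2 * of_int \<nu> + 1)\<^sup>2 - u n) / (4 * (r n + u n))))"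
    proof -
      have "0 \<le> (2::real) ^ (2 * m n + 1)" by simp
      from divide_right_mono[OF odd_binomial_weight(1)[OF odd that[unfolded M_def]] this] show ?thesis
        unfolding w_def scale1[symmetric] M_def by (simp only: times_divide_eq_left minus_divide_left)
    qed
    then show ?thesis
      unfolding K_def mult.assoc by (intro mult_left_mono) auto
  qed
  have w_lower: "real (l n) * w \<nu> n \<ge> K n * exp (- (((2 * of_int \<nu> + 1)\<^sup>2 - u n) / (4 * (r n + u n)) / (1 - (2 * of_int \<nu> + 1)\<^sup>2 * u n / (4 * (r n + u n)\<^sup>2))))"
    if "\<bar>int (l n) * (2 * \<nu> + 1)\<bar> \<le> int (M n)" for n \<nu>
  proof -
    have "w \<nu> n \<ge> real (M n choose m n) / 2 ^ M n * exp (- (((2 * of_int \<nu> + 1)\<^sup>2 - u n) / (4 * (r n + u n)) / (1 - (2 * of_int \<nu> + 1)\<^sup>2 * u n / (4 * (r n + u n)\<^sup>2))))"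
    proof -
      have "0 \<le> (2::real) ^ (2 * m n + 1)" by simp
      from divide_right_mono[OF odd_binomial_weight(2)[OF odd that[unfolded M_def]] this] show ?thesis
        unfolding w_def scale1[symmetric] scale2[symmetric] M_def
        by (simp only: times_divide_eq_left minus_divide_left divide_divide_eq_left)
    qed
    then show ?thesis
      unfolding K_def mult.assoc by (intro mult_left_mono) auto
  qed
  have ev_small: "eventually (\<lambda>n. \<bar>int (l n) * (2 * \<nu> + 1)\<bar> \<le> int (M n)) sequentially" for \<nu>
  proof -
    have "(\<lambda>n. \<bar>2 * real_of_int \<nu> + 1\<bar> * (1 / real (l n))) \<longlonglongrightarrow> \<bar>2 * real_of_int \<nu> + 1\<bar> * 0"
      by (intro tendsto_intros l_lim)
    then have "eventually (\<lambda>n. \<bar>2 * real_of_int \<nu> + 1\<bar> * (1 / real (l n)) < t / pi) sequentially"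
      by (rule order_tendstoD) (use tpi in simp)
    then show ?thesis
      using r_ge
    proof eventually_elim
      case (elim n)
      have "\<bar>2 * real_of_int \<nu> + 1\<bar> * (1 / real (l n)) \<le> 2 * r n"
        using elim by simp
      then have "\<bar>2 * real_of_int \<nu> + 1\<bar> * (1 / real (l n)) * (real (l n))\<^sup>2 \<le> 2 * r n * (real (l n))\<^sup>2"
        by (rule mult_right_mono) simp
      then have "\<bar>2 * real_of_int \<nu> + 1\<bar> * real (l n) \<le> 2 * real (m n)"
        using l0[of n] by (simp add: r_def power2_eq_square)
      then have "real_of_int \<bar>int (l n) * (2 * \<nu> + 1)\<bar> \<le> real_of_int (int (M n))"
        by (simp add: M_def abs_mult mult.commute)
      then show ?case by linarith
    qed
  qed
  have w_lim: "(\<lambda>n. real (l n) * w \<nu> n) \<longlonglongrightarrow> 1 / sqrt t * exp (- (pi * (2 * of_int \<nu> + 1)\<^sup>2 / (4 * t)))" for \<nu>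
  proof (rule tendsto_sandwich)
    have "((2 * real_of_int \<nu> + 1)\<^sup>2 - 0) / (4 * (t / pi + 0)) = pi * (2 * of_int \<nu> + 1)\<^sup>2 / (4 * t)"
      using t by (simp add: field_simps)
    then have e: "1 / sqrt t * exp (- (((2 * real_of_int \<nu> + 1)\<^sup>2 - 0) / (4 * (t / pi + 0)))) = 1 / sqrt t * exp (- (pi * (2 * of_int \<nu> + 1)\<^sup>2 / (4 * t)))"
       "1 / sqrt t * exp (- (((2 * real_of_int \<nu> + 1)\<^sup>2 - 0) / (4 * (t / pi + 0)) / (1 - (2 * of_int \<nu> + 1)\<^sup>2 * 0 / (4 * (t / pi + 0)\<^sup>2)))) = 1 / sqrt t * exp (- (pi * (2 * of_int \<nu> + 1)\<^sup>2 / (4 * t)))"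
      by simp_all
    show "eventually (\<lambda>n. K n * exp (- (((2 * of_int \<nu> + 1)\<^sup>2 - u n) / (4 * (r n + u n)) / (1 - (2 * of_int \<nu> + 1)\<^sup>2 * u n / (4 * (r n + u n)\<^sup>2)))) \<le> real (l n) * w \<nu> n) sequentially"
      using ev_small[of \<nu>] by eventually_elim (rule w_lower)
    show "eventually (\<lambda>n. real (l n) * w \<nu> n \<le> K n * exp (- (((2 * of_int \<nu> + 1)\<^sup>2 - u n) / (4 * (r n + u n))))) sequentially"
      using ev_small[of \<nu>] by eventually_elim (rule w_upper)
    show "(\<lambda>n. K n * exp (- (((2 * of_int \<nu> + 1)\<^sup>2 - u n) / (4 * (r n + u n)) / (1 - (2 * of_int \<nu> + 1)\<^sup>2 * u n / (4 * (r n + u n)\<^sup>2))))) \<longlonglongrightarrow> 1 / sqrt t * exp (- (pi * (2 * of_int \<nu> + 1)\<^sup>2 / (4 * t)))"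
      unfolding e(2)[symmetric] using t by (intro tendsto_intros K_lim r_lim u_lim) auto
    show "(\<lambda>n. K n * exp (- (((2 * of_int \<nu> + 1)\<^sup>2 - u n) / (4 * (r n + u n))))) \<longlonglongrightarrow> 1 / sqrt t * exp (- (pi * (2 * of_int \<nu> + 1)\<^sup>2 / (4 * t)))"
      unfolding e(1)[symmetric] using t by (intro tendsto_intros K_lim r_lim u_lim) auto
  qed
  define q where "q = exp (- (pi / (3 * t)))"
  have q: "0 \<le> q" "q < 1" using t by (auto simp: q_def)
  obtain K1 where K1: "\<And>n. norm (K n) \<le> K1"
    using convergent_imp_Bseq[of K] K_lim unfolding convergent_def by (metis BseqE)
  have limB: "(\<lambda>n. \<Sum>\<^sub>\<infinity>\<nu>. B \<nu> n) \<longlonglongrightarrow> (\<Sum>\<^sub>\<infinity>\<nu>::int. of_real (1 / sqrt t * exp (- (pi * (2 * of_int \<nu> + 1)\<^sup>2 / (4 * t)))) * cis (pi * (2 * of_int \<nu> + 1) * a))"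
  proof (rule tendsto_infsum_dominated(1))
    fix \<nu> :: int
    have "(\<lambda>n. complex_of_real (real (l n) * w \<nu> n) * cis (pi * (2 * of_int \<nu> + 1) * a)) \<longlonglongrightarrow>
       of_real (1 / sqrt t * exp (- (pi * (2 * of_int \<nu> + 1)\<^sup>2 / (4 * t)))) * cis (pi * (2 * of_int \<nu> + 1) * a)"
      by (intro tendsto_mult tendsto_const tendsto_of_real w_lim)
    then show "B \<nu> \<longlonglongrightarrow> of_real (1 / sqrt t * exp (- (pi * (2 * of_int \<nu> + 1)\<^sup>2 / (4 * t)))) * cis (pi * (2 * of_int \<nu> + 1) * a)"
      by (rule Lim_transform_eventually) (use ev_small[of \<nu>] in \<open>auto simp: B_def elim: eventually_mono\<close>)
  next
    show "eventually (\<lambda>n. \<forall>\<nu>. norm (B \<nu> n) \<le> K1 * (1 / q) * q ^ nat \<bar>\<nu>\<bar>) sequentially"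
      using r_le u_le
    proof eventually_elim
      case (elim n)
      show ?case
      proof
        fix \<nu> :: int
        have K1': "0 \<le> K1" using K1[of 0] norm_ge_zero order_trans by blast
        show "norm (B \<nu> n) \<le> K1 * (1 / q) * q ^ nat \<bar>\<nu>\<bar>"
        proof (cases "\<bar>int (l n) * (2 * \<nu> + 1)\<bar> \<le> int (M n)")
          case True
          have "norm (B \<nu> n) = real (l n) * w \<nu> n"
            using True by (simp add: B_def norm_mult norm_divide norm_power w_def)
          also have "\<dots> \<le> K n * exp (- (((2 * of_int \<nu> + 1)\<^sup>2 - u n) / (4 * (r n + u n))))"
            by (rule w_upper[OF True])
          also have "\<dots> \<le> K1 * exp (- ((real (nat \<bar>\<nu>\<bar>) - 1) * (pi / (3 * t))))"
          proof (intro mult_mono)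
            have un: "0 < u n" "u n \<le> 1" by (simp_all add: u_def l_def)
            have ru: "0 < r n + u n" "r n + u n \<le> 3 * t / pi"
              using elim un by (auto simp: r_def intro: add_nonneg_pos)
            have h: "real_of_int (\<bar>\<nu>\<bar> - 1) \<le> real_of_int (\<nu> * (\<nu> + 1))"
            proof (unfold of_int_le_iff, cases "\<nu> \<ge> 0")
              case True
              then show "\<bar>\<nu>\<bar> - 1 \<le> \<nu> * (\<nu> + 1)" by (simp add: algebra_simps)
            next
              case False
              then have "(\<nu> + 1) * (\<nu> + 1) \<ge> 0" by simp
              then show "\<bar>\<nu>\<bar> - 1 \<le> \<nu> * (\<nu> + 1)" using False by (simp add: algebra_simps)
            qed
            have nu: "4 * (real (nat \<bar>\<nu>\<bar>) - 1) \<le> (2 * real_of_int \<nu> + 1)\<^sup>2 - 1" "0 \<le> (2 * real_of_int \<nu> + 1)\<^sup>2 - 1"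
            proof -
              have e: "(2 * real_of_int \<nu> + 1)\<^sup>2 - 1 = 4 * real_of_int (\<nu> * (\<nu> + 1))"
                by (simp add: power2_eq_square algebra_simps)
              show "4 * (real (nat \<bar>\<nu>\<bar>) - 1) \<le> (2 * real_of_int \<nu> + 1)\<^sup>2 - 1"
                unfolding e using h by simp
              have "\<nu> * (\<nu> + 1) \<ge> 0"
                by (cases "\<nu> \<ge> 0") (auto intro: mult_nonneg_nonneg mult_nonpos_nonpos)
              then show "0 \<le> (2 * real_of_int \<nu> + 1)\<^sup>2 - 1" unfolding e by (metis mult_nonneg_nonneg of_int_0_le_iff zero_le_numeral)
            qed
            have "(real (nat \<bar>\<nu>\<bar>) - 1) * (pi / (3 * t)) = 4 * (real (nat \<bar>\<nu>\<bar>) - 1) / (4 * (3 * t / pi))"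
              using t by (simp add: field_simps)
            also have "\<dots> \<le> ((2 * of_int \<nu> + 1)\<^sup>2 - 1) / (4 * (3 * t / pi))"
              using nu(1) t by (intro divide_right_mono) auto
            also have "\<dots> \<le> ((2 * of_int \<nu> + 1)\<^sup>2 - 1) / (4 * (r n + u n))"
              using nu(2) ru t by (intro divide_left_mono) (auto intro: mult_pos_pos)
            also have "\<dots> \<le> ((2 * of_int \<nu> + 1)\<^sup>2 - u n) / (4 * (r n + u n))"
              using un ru by (intro divide_right_mono) auto
            finally show "exp (- (((2 * of_int \<nu> + 1)\<^sup>2 - u n) / (4 * (r n + u n)))) \<le> exp (- ((real (nat \<bar>\<nu>\<bar>) - 1) * (pi / (3 * t))))"
              by simp
          qed (use K1[of n] K1' in auto)
          also have "exp (- ((real (nat \<bar>\<nu>\<bar>) - 1) * (pi / (3 * t)))) = (1 / q) * q ^ nat \<bar>\<nu>\<bar>"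
          proof -
            have "exp (- ((real N - 1) * s)) = 1 / exp (- s) * exp (- s) ^ N" for s :: real and N
            proof -
              have "1 / exp (- s) * exp (- s) ^ N = exp (s + real N * (- s))"
                unfolding exp_add exp_of_nat_mult by (simp add: exp_minus divide_inverse)
              then show ?thesis by (simp add: algebra_simps)
            qed
            then show ?thesis unfolding q_def .
          qed
          finally show ?thesis by (simp add: mult.assoc)
        qed (use K1' q in \<open>auto simp: B_def\<close>)
      qed
    qed
    show "(\<lambda>\<nu>. K1 * (1 / q) * q ^ nat \<bar>\<nu>\<bar>) summable_on UNIV"
      by (intro summable_on_cmult_right summable_on_int_geometric q)
  qed auto
  have "(\<Sum>\<^sub>\<infinity>k. A k n) = (\<Sum>\<^sub>\<infinity>\<nu>. B \<nu> n)" for n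
  proof -
    have "(\<Sum>\<^sub>\<infinity>k. A k n) = (\<Sum>\<^sub>\<infinity>k\<in>{-int n..int n}. A k n)"
      by (rule infsum_cong_neutral) (auto simp: A_def)
    also have "\<dots> = (\<Sum>k\<in>{-int n..int n}. (-1) powi k * complex_of_real (cos (pi * (of_int k + a) / real (l n)) ^ M n))"
      by (simp add: A_def)
    also have "\<dots> = (\<Sum>\<nu>\<in>{\<nu>. \<bar>int (l n) * (2 * \<nu> + 1)\<bar> \<le> int (M n)}. B \<nu> n)"
      unfolding l_def M_def alternating_cos_power_sum
      by (intro sum.cong refl) (simp add: B_def w_def l_def M_def)
    also have "\<dots> = (\<Sum>\<^sub>\<infinity>\<nu>\<in>{\<nu>. \<bar>int (l n) * (2 * \<nu> + 1)\<bar> \<le> int (M n)}. B \<nu> n)"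
    proof (rule infsum_finite[symmetric])
      have "\<bar>\<nu>\<bar> \<le> int (M n) + 1" if "\<bar>int (l n) * (2 * \<nu> + 1)\<bar> \<le> int (M n)" for \<nu>
      proof -
        have "1 * \<bar>2 * \<nu> + 1\<bar> \<le> \<bar>int (l n)\<bar> * \<bar>2 * \<nu> + 1\<bar>"
          by (intro mult_right_mono) (auto simp: l_def)
        from order_trans[OF this that[unfolded abs_mult]] have "\<bar>2 * \<nu> + 1\<bar> \<le> int (M n)"
          by simp
        then show ?thesis by linarith
      qed
      then have "{\<nu>. \<bar>int (l n) * (2 * \<nu> + 1)\<bar> \<le> int (M n)} \<subseteq> {- int (M n) - 1..int (M n) + 1}"
        by (fastforce simp: abs_le_iff)
      then show "finite {\<nu>. \<bar>int (l n) * (2 * \<nu> + 1)\<bar> \<le> int (M n)}"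
        by (rule finite_subset) simp
    qed
    also have "\<dots> = (\<Sum>\<^sub>\<infinity>\<nu>. B \<nu> n)"
      by (rule infsum_cong_neutral) (auto simp: B_def)
    finally show ?thesis .
  qed
  then have "(\<Sum>\<^sub>\<infinity>k::int. (-1) powi k * complex_of_real (exp (- (pi * t * (of_int k + a)\<^sup>2)))) =
     (\<Sum>\<^sub>\<infinity>\<nu>::int. of_real (1 / sqrt t * exp (- (pi * (2 * of_int \<nu> + 1)\<^sup>2 / (4 * t)))) * cis (pi * (2 * of_int \<nu> + 1) * a))"
    using LIMSEQ_unique[OF limA] limB by simp
  also have "\<dots> = of_real (1 / sqrt t) * (\<Sum>\<^sub>\<infinity>\<nu>::int. complex_of_real (exp (- (pi * (2 * of_int \<nu> + 1)\<^sup>2 / (4 * t)))) * cis (pi * (2 * of_int \<nu> + 1) * a))"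
    by (simp only: of_real_mult mult.assoc infsum_cmult_right')
  finally show ?thesis .
qed


section \<open>The eta function and theta series on the upper half plane\<close>

lemma holomorphic_on_unit_disc:
  assumes "\<And>r. 0 < r \<Longrightarrow> r < 1 \<Longrightarrow> f holomorphic_on ball 0 r"
  shows "f holomorphic_on ball (0::complex) 1"
  unfolding holomorphic_on_open[OF open_ball]
proof
  fix z :: complex assume "z \<in> ball 0 1"
  then have r: "0 < (1 + norm z) / 2" "(1 + norm z) / 2 < 1" "z \<in> ball 0 ((1 + norm z) / 2)"
    by (auto intro: add_pos_nonneg)
  from assms[OF r(1,2)] r(3) show "\<exists>f'. (f has_field_derivative f') (at z)"
    unfolding holomorphic_on_open[OF open_ball] by blast
qed

lemma holomorphic_infsum_disc:
  fixes c :: "int \<Rightarrow> complex" and e :: "int \<Rightarrow> nat"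
  assumes c: "\<And>p. norm (c p) \<le> 1" and e: "\<And>p. nat \<bar>p\<bar> \<le> e p"
  shows "(\<lambda>q. \<Sum>\<^sub>\<infinity>p. c p * q ^ e p) holomorphic_on ball 0 1"
proof -
  have "(\<lambda>q. \<Sum>\<^sub>\<infinity>p. c p * q ^ e p) holomorphic_on ball 0 r" if r: "0 < r" "r < 1" for r
  proof (rule holomorphic_uniform_limit)
    show "eventually (\<lambda>X. continuous_on (cball 0 r) (\<lambda>q. \<Sum>p\<in>X. c p * q ^ e p) \<and>
        (\<lambda>q. \<Sum>p\<in>X. c p * q ^ e p) holomorphic_on ball 0 r) (finite_subsets_at_top UNIV)"
      by (auto intro!: always_eventually continuous_intros holomorphic_intros)
    show "uniform_limit (cball 0 r) (\<lambda>X q. \<Sum>p\<in>X. c p * q ^ e p) (\<lambda>q. \<Sum>\<^sub>\<infinity>p. c p * q ^ e p) (finite_subsets_at_top UNIV)"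
    proof (rule Weierstrass_m_test_general)
      fix p and q :: complex assume q: "q \<in> cball 0 r"
      have "norm (c p * q ^ e p) \<le> 1 * norm q ^ e p"
        unfolding norm_mult norm_power by (intro mult_right_mono c) auto
      also have "\<dots> \<le> 1 * norm q ^ nat \<bar>p\<bar>"
        using q r e[of p] by (intro mult_left_mono power_decreasing) auto
      also have "\<dots> \<le> r ^ nat \<bar>p\<bar>"
        using q by (simp add: power_mono)
      finally show "norm (c p * q ^ e p) \<le> r ^ nat \<bar>p\<bar>" .
    qed (use r in \<open>auto intro: summable_on_int_geometric\<close>)
  qed auto
  then show ?thesis by (rule holomorphic_on_unit_disc)
qed

definition log_euler :: "complex \<Rightarrow> complex" where
  "log_euler q = (\<Sum>n. Ln (1 - q ^ Suc n))"

lemma norm_power_Suc_less_1: "norm (q ^ Suc n) < 1" if "norm q < 1" for q :: complex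
proof -
  have "norm q * norm q ^ n \<le> norm q * 1"
    using that by (intro mult_left_mono power_le_one) auto
  then show ?thesis using that by (simp add: norm_mult norm_power)
qed

lemma log_euler_uniform:
  assumes r: "0 \<le> r" "r < 1"
  shows "eventually (\<lambda>n. \<forall>q\<in>cball 0 r. norm (Ln (1 - q ^ Suc n)) \<le> 2 * r ^ Suc n) sequentially" "summable (\<lambda>n. 2 * r ^ Suc n)"
proof -
  have "(\<lambda>n. r ^ Suc n) \<longlonglongrightarrow> 0"
    using r by (intro LIMSEQ_Suc LIMSEQ_power_zero) auto
  then have "eventually (\<lambda>n. r ^ Suc n < 1/2) sequentially"
    by (rule order_tendstoD) simp
  then show "eventually (\<lambda>n. \<forall>q\<in>cball 0 r. norm (Ln (1 - q ^ Suc n)) \<le> 2 * r ^ Suc n) sequentially"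
  proof eventually_elim
    case (elim n)
    show ?case
    proof
      fix q :: complex assume "q \<in> cball 0 r"
      then have le: "norm (- (q ^ Suc n)) \<le> r ^ Suc n"
        unfolding norm_minus_cancel norm_power by (intro power_mono) auto
      then have "norm (Ln (1 + - (q ^ Suc n))) \<le> 2 * norm (- (q ^ Suc n))"
        using elim by (intro norm_Ln_le) auto
      with le show "norm (Ln (1 - q ^ Suc n)) \<le> 2 * r ^ Suc n" by simp
    qed
  qed
  show "summable (\<lambda>n. 2 * r ^ Suc n)"
    using r by (intro summable_mult) (subst summable_Suc_iff, simp add: summable_geometric)
qed

lemma Ln_euler_summable:
  assumes "norm q < 1"
  shows "summable (\<lambda>n. Ln (1 - q ^ Suc n))"
proof (rule summable_comparison_test_ev)
  have r: "0 \<le> norm q" by simp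
  show "eventually (\<lambda>n. norm (Ln (1 - q ^ Suc n)) \<le> 2 * norm q ^ Suc n) sequentially"
    using log_euler_uniform(1)[OF r assms] by (rule eventually_mono) (drule bspec[of _ _ q], simp_all del: power_Suc)
  show "summable (\<lambda>n. 2 * norm q ^ Suc n)"
    by (rule log_euler_uniform(2)[OF r assms])
qed

lemma log_euler_holomorphic: "log_euler holomorphic_on ball 0 1"
proof -
  have "log_euler holomorphic_on ball 0 r" if r: "0 < r" "r < 1" for r
  proof (rule holomorphic_uniform_limit)
    have nz: "1 - q ^ Suc n \<notin> \<real>\<^sub>\<le>\<^sub>0" if "norm q \<le> r" for q :: complex and n
    proof -
      have "norm (q ^ Suc n) < 1" by (rule norm_power_Suc_less_1) (use that r in simp)
      then have "Re (q ^ Suc n) < 1" using complex_Re_le_cmod le_less_trans by blast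
      then show ?thesis by (auto simp: complex_nonpos_Reals_iff)
    qed
    have hol: "(\<lambda>q. \<Sum>i<n. Ln (1 - q ^ Suc i)) holomorphic_on cball 0 r" for n
      using nz by (intro holomorphic_intros) auto
    then show "eventually (\<lambda>n. continuous_on (cball 0 r) (\<lambda>q. \<Sum>i<n. Ln (1 - q ^ Suc i)) \<and>
        (\<lambda>q. \<Sum>i<n. Ln (1 - q ^ Suc i)) holomorphic_on ball 0 r) sequentially"
      using holomorphic_on_imp_continuous_on[OF hol] holomorphic_on_subset[OF hol, of "ball 0 r"] by auto
    show "uniform_limit (cball 0 r) (\<lambda>n q. \<Sum>i<n. Ln (1 - q ^ Suc i)) log_euler sequentially"
      unfolding log_euler_def[abs_def] using r by (intro Weierstrass_m_test_ev[OF log_euler_uniform]) auto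
  qed auto
  then show ?thesis by (rule holomorphic_on_unit_disc)
qed

lemma log_euler_0 [simp]: "log_euler 0 = 0"
  by (simp add: log_euler_def)

lemma exp_log_euler:
  assumes "norm q < 1"
  shows "exp (of_real r * log_euler q) = (\<Prod>n. (1 - q ^ Suc n) powr of_real r)"
proof -
  have nz: "1 - q ^ Suc n \<noteq> 0" for n
    using norm_power_Suc_less_1[OF assms, of n] by (metis eq_iff_diff_eq_0 less_irrefl norm_one)
  have "(\<Prod>n. (1 - q ^ Suc n) powr of_real r) = (\<Prod>n. exp (of_real r * Ln (1 - q ^ Suc n)))"
    using nz by (simp add: powr_def)
  also have "\<dots> = exp (\<Sum>n. of_real r * Ln (1 - q ^ Suc n))"
    by (intro prodinf_exp summable_mult Ln_euler_summable assms)
  also have "(\<Sum>n. of_real r * Ln (1 - q ^ Suc n)) = of_real r * log_euler q"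
    unfolding log_euler_def by (intro suminf_mult Ln_euler_summable assms)
  finally show ?thesis ..
qed

lemma exp_log_euler_qprod:
  assumes "norm q < 1"
  shows "exp (log_euler q) = qprod q q"
proof -
  have nz: "1 - q ^ Suc n \<noteq> 0" for n
    using norm_power_Suc_less_1[OF assms, of n] by (metis eq_iff_diff_eq_0 less_irrefl norm_one)
  have "exp (log_euler q) = (\<Prod>n. (1 - q ^ Suc n) powr of_real 1)"
    using exp_log_euler[OF assms, of 1] by simp
  also have "\<dots> = qprod q q"
    unfolding qprod_def using nz by simp
  finally show ?thesis .
qed

subsection \<open>The upper half plane\<close>

lemma uhp_open: "open uhp" and uhp_convex: "convex uhp" and uhp_connected: "connected uhp"
proof -
  show "open uhp" unfolding uhp_def by (rule open_halfspace_Im_gt)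
  show "convex uhp" unfolding uhp_def by (rule convex_halfspace_Im_gt)
  then show "connected uhp" by (rule convex_connected)
qed

lemma q_pow_add: "q_pow (r + s) \<tau> = q_pow r \<tau> * q_pow s \<tau>"
  by (simp add: q_pow_def exp_add[symmetric] algebra_simps)

lemma q_pow_power: "q_pow r \<tau> ^ n = q_pow (real n * r) \<tau>"
  by (simp add: q_pow_def exp_of_nat_mult[symmetric] algebra_simps)

lemma q_pow_nonzero [simp]: "q_pow r \<tau> \<noteq> 0"
  by (simp add: q_pow_def)

lemma q_pow_0 [simp]: "q_pow 0 \<tau> = 1"
  by (simp add: q_pow_def)

lemma norm_q_pow_less_1: "\<tau> \<in> uhp \<Longrightarrow> r > 0 \<Longrightarrow> norm (q_pow r \<tau>) < 1"
  by (simp add: norm_q_pow uhp_def)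

lemma q_pow_in_ball: "\<tau> \<in> uhp \<Longrightarrow> r > 0 \<Longrightarrow> q_pow r \<tau> \<in> ball 0 1"
  using norm_q_pow_less_1 by simp

lemma q_pow_holomorphic [holomorphic_intros]:
  "f holomorphic_on A \<Longrightarrow> (\<lambda>\<tau>. q_pow r (f \<tau>)) holomorphic_on A"
  unfolding q_pow_def by (intro holomorphic_intros)

lemma q_pow_translate: "q_pow r (\<tau> + of_real s) = cis (2 * pi * r * s) * q_pow r \<tau>"
  by (simp add: q_pow_def cis_conv_exp exp_add[symmetric] algebra_simps)

lemma q_pow_1_translate [simp]: "q_pow 1 (\<tau> + of_int n) = q_pow 1 \<tau>"
proof -
  have "cis (2 * pi * of_int n) = 1"
    unfolding complex_eq_iff cis.sel cos_int_2pin sin_int_2pin by simp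
  then show ?thesis
    using q_pow_translate[of 1 \<tau> "of_int n"] by simp
qed

definition log_eta :: "complex \<Rightarrow> complex" where
  "log_eta \<tau> = of_real pi * \<i> * \<tau> / 12 + log_euler (q_pow 1 \<tau>)"

lemma log_eta_holomorphic: "log_eta holomorphic_on uhp"
proof -
  have "(\<lambda>\<tau>. log_euler (q_pow 1 \<tau>)) holomorphic_on uhp"
    by (rule holomorphic_on_compose_gen[unfolded o_def, OF q_pow_holomorphic[OF holomorphic_on_ident] log_euler_holomorphic])
       (use q_pow_in_ball in auto)
  then show ?thesis
    unfolding log_eta_def[abs_def] by (intro holomorphic_intros) auto
qed

lemma q_pow_exp: "q_pow (r / 24) \<tau> = exp (of_real r * (of_real pi * \<i> * \<tau> / 12))"
  unfolding q_pow_def by (rule arg_cong[of _ _ exp]) (simp add: field_simps)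

lemma eta_pow_eq_q: "\<tau> \<in> uhp \<Longrightarrow> eta_pow r \<tau> = q_pow (r / 24) \<tau> * exp (of_real r * log_euler (q_pow 1 \<tau>))"
  by (simp add: eta_pow_def exp_log_euler[OF norm_q_pow_less_1] q_pow_nat[symmetric] del: of_nat_Suc power_Suc)

lemma eta_pow_eq: "\<tau> \<in> uhp \<Longrightarrow> eta_pow r \<tau> = exp (of_real r * log_eta \<tau>)"
  by (simp add: eta_pow_eq_q q_pow_exp log_eta_def exp_add[symmetric] distrib_left)

lemma eta_eq_q: "\<tau> \<in> uhp \<Longrightarrow> eta \<tau> = q_pow (1 / 24) \<tau> * qprod (q_pow 1 \<tau>) (q_pow 1 \<tau>)"
proof -
  have "q_pow (real (Suc n)) \<tau> = q_pow 1 \<tau> * q_pow 1 \<tau> ^ n" for n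
    by (simp only: q_pow_nat power_Suc)
  then show ?thesis by (simp only: eta_def qprod_def)
qed

lemma eta_eq: "\<tau> \<in> uhp \<Longrightarrow> eta \<tau> = exp (log_eta \<tau>)"
  using q_pow_exp[of 1 \<tau>] by (simp add: eta_eq_q exp_log_euler_qprod[OF norm_q_pow_less_1, symmetric] log_eta_def exp_add)

subsection \<open>Theta series\<close>

definition theta :: "int \<Rightarrow> int \<Rightarrow> complex \<Rightarrow> complex" where
  "theta N r \<tau> = (\<Sum>\<^sub>\<infinity>p. (-1) powi p * q_pow (of_int N / 2 * (of_int p + of_int r / (2 * of_int N))\<^sup>2) \<tau>)"

definition theta_exponent :: "int \<Rightarrow> int \<Rightarrow> int \<Rightarrow> nat" where
  "theta_exponent N r p = nat ((N * p\<^sup>2 + r * p) div 2)"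

definition theta_q :: "int \<Rightarrow> int \<Rightarrow> complex \<Rightarrow> complex" where
  "theta_q N r q = (\<Sum>\<^sub>\<infinity>p. (-1) powi p * q ^ theta_exponent N r p)"

locale theta_param =
  fixes N r :: int
  assumes r_less: "\<bar>r\<bar> < N" and parity: "even (N + r)"
begin

lemma N_pos: "N > 0" using r_less by linarith

lemma exponent_even: "even (N * p\<^sup>2 + r * p)"
  using parity by (auto simp: even_add power2_eq_square)

lemma exponent_ge: "nat \<bar>p\<bar> \<le> theta_exponent N r p" and exponent_eq: "2 * int (theta_exponent N r p) = N * p\<^sup>2 + r * p"
proof -
  have abs_le: "\<bar>p\<bar> \<le> p\<^sup>2"
  proof (cases "p = 0")
    case False
    then have "\<bar>p\<bar> * 1 \<le> \<bar>p\<bar> * \<bar>p\<bar>" by (intro mult_left_mono) auto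
    then show ?thesis by (simp add: power2_eq_square)
  qed simp
  have "N - \<bar>r\<bar> \<noteq> 1" using parity by presburger
  then have "2 \<le> N - \<bar>r\<bar>" using r_less by linarith
  then have "2 * \<bar>p\<bar> \<le> (N - \<bar>r\<bar>) * \<bar>p\<bar>" by (rule mult_right_mono) simp
  also have "\<dots> \<le> (N - \<bar>r\<bar>) * p\<^sup>2"
    using r_less abs_le by (intro mult_left_mono) auto
  also have "\<dots> \<le> N * p\<^sup>2 + r * p"
  proof -
    have "\<bar>r * p\<bar> \<le> \<bar>r\<bar> * p\<^sup>2"
      unfolding abs_mult using abs_le by (intro mult_left_mono) auto
    then show ?thesis by (simp add: algebra_simps abs_le_iff)
  qed
  finally have *: "2 * \<bar>p\<bar> \<le> N * p\<^sup>2 + r * p" .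
  then show "nat \<bar>p\<bar> \<le> theta_exponent N r p" "2 * int (theta_exponent N r p) = N * p\<^sup>2 + r * p"
    using exponent_even[of p] by (auto simp: theta_exponent_def)
qed

lemma theta_q_holomorphic: "theta_q N r holomorphic_on ball 0 1"
  unfolding theta_q_def[abs_def]
  by (rule holomorphic_infsum_disc) (use exponent_ge in \<open>auto simp: norm_power_int\<close>)

lemma theta_q_0: "theta_q N r 0 = 1"
proof -
  have "theta_exponent N r p = 0 \<longleftrightarrow> p = 0" for p
    using exponent_ge[of p] by (auto simp: theta_exponent_def)
  then have "theta_q N r 0 = (\<Sum>\<^sub>\<infinity>p::int. if p = 0 then 1 else 0)"
    unfolding theta_q_def by (intro infsum_cong) (auto simp: power_0_left)
  also have "\<dots> = (\<Sum>\<^sub>\<infinity>p\<in>{0::int}. 1)"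
    by (rule infsum_cong_neutral) auto
  finally show ?thesis by simp
qed

lemma theta_eq_q: "theta N r \<tau> = q_pow ((of_int r)\<^sup>2 / (8 * of_int N)) \<tau> * theta_q N r (q_pow 1 \<tau>)"
proof -
  have "q_pow (of_int N / 2 * (of_int p + of_int r / (2 * of_int N))\<^sup>2) \<tau> =
      q_pow ((of_int r)\<^sup>2 / (8 * of_int N)) \<tau> * q_pow 1 \<tau> ^ theta_exponent N r p" for p
  proof -
    have "2 * real (theta_exponent N r p) = of_int N * (of_int p)\<^sup>2 + of_int r * of_int p"
      using arg_cong[OF exponent_eq[of p], of real_of_int] by simp
    then have E: "real (theta_exponent N r p) = (of_int N * (of_int p)\<^sup>2 + of_int r * of_int p) / 2"
      by simp
    have "of_int N / 2 * (of_int p + of_int r / (2 * of_int N))\<^sup>2 = (of_int r)\<^sup>2 / (8 * of_int N) + real (theta_exponent N r p) * 1"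
      unfolding E using N_pos by (simp add: power2_eq_square field_simps)
    then show ?thesis
      by (simp only: q_pow_add q_pow_power)
  qed
  then show ?thesis
    unfolding theta_def theta_q_def
    by (simp add: mult.left_commute[of _ "q_pow ((of_int r)\<^sup>2 / (8 * of_int N)) \<tau>"] infsum_cmult_right')
qed

lemma theta_holomorphic: "theta N r holomorphic_on uhp"
proof -
  have "(\<lambda>\<tau>. theta_q N r (q_pow 1 \<tau>)) holomorphic_on uhp"
    by (rule holomorphic_on_compose_gen[unfolded o_def, OF q_pow_holomorphic[OF holomorphic_on_ident] theta_q_holomorphic])
       (use q_pow_in_ball in auto)
  then show ?thesis
    unfolding theta_eq_q[abs_def] by (intro holomorphic_intros) auto
qed

lemma theta_q_product:
  assumes "norm q < 1" "q \<noteq> 0"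
  shows "theta_q N r q = qprod (q ^ nat N) (q ^ nat N) * qprod (q ^ nat ((N + r) div 2)) (q ^ nat N) * qprod (q ^ nat ((N - r) div 2)) (q ^ nat N)"
proof -
  define a where "a = nat ((N + r) div 2)"
  define b where "b = nat ((N - r) div 2)"
  have half: "2 * ((N + r) div 2) = N + r" "2 * ((N - r) div 2) = N - r"
    using parity by simp_all
  then have pos: "(N + r) div 2 > 0" "(N - r) div 2 > 0"
    using r_less by linarith+
  then have int: "int a = (N + r) div 2" "int b = (N - r) div 2"
    by (simp_all add: a_def b_def)
  have ab: "2 * int a = N + r" "2 * int b = N - r" "nat N = a + b" "a > 0" "b > 0"
    using half pos int by linarith+
  define Q where "Q = q ^ (a + b)"
  have lt: "norm (q ^ k) < 1" if "k > 0" for k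
    using norm_power_Suc_less_1[OF assms(1), of "k - 1"] that by simp
  have "norm q ^ a * norm q ^ b < norm q ^ a * 1"
    using lt[OF ab(5)] assms(2) by (intro mult_strict_left_mono) (auto simp: norm_power)
  then have QZ: "norm Q < norm (q ^ a)"
    by (simp add: Q_def norm_power power_add norm_mult)
  have "theta_q N r q = (\<Sum>\<^sub>\<infinity>k::int. (-1) powi k * Q powi (k * (k - 1) div 2) * (q ^ a) powi k)"
    unfolding theta_q_def
  proof (rule infsum_cong)
    fix k :: int
    have "2 * (k * (k - 1) div 2) = k * (k - 1)" by (auto simp: dvd_mult_div_cancel)
    then have "2 * (int (a + b) * (k * (k - 1) div 2) + int a * k) = int (a + b) * (k * (k - 1)) + 2 * int a * k"
      by (simp only: distrib_left mult.left_commute[of 2] mult.assoc)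
    also have "\<dots> = N * k\<^sup>2 + r * k"
    proof -
      have "int (a + b) = N" using ab N_pos by linarith
      then show ?thesis by (simp only: ab(1)) (simp add: algebra_simps power2_eq_square)
    qed
    finally have ex: "int (a + b) * (k * (k - 1) div 2) + int a * k = int (theta_exponent N r k)"
      unfolding exponent_eq[of k, symmetric] mult_cancel_left by simp
    have "Q powi (k * (k - 1) div 2) * (q ^ a) powi k = q powi (int (a + b) * (k * (k - 1) div 2)) * q powi (int a * k)"
      by (simp only: Q_def power_int_mult power_int_of_nat)
    also have "\<dots> = q ^ theta_exponent N r k"
      by (simp only: power_int_add[OF disjI1[OF assms(2)], symmetric] ex power_int_of_nat)
    finally show "(-1) powi k * q ^ theta_exponent N r k = (-1) powi k * Q powi (k * (k - 1) div 2) * (q ^ a) powi k"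
      by (simp add: mult.assoc)
  qed
  also have "\<dots> = qprod Q Q * qprod (q ^ a) Q * qprod (Q / q ^ a) Q"
    by (rule jacobi_triple_product[OF QZ lt[OF ab(4)]]) (simp add: Q_def assms)
  also have "Q / q ^ a = q ^ b"
    using assms(2) by (simp add: Q_def power_add)
  finally show ?thesis
    by (simp add: Q_def ab(3) a_def b_def)
qed

end

interpretation theta51: theta_param 5 1 by unfold_locales auto
interpretation theta53: theta_param 5 3 by unfold_locales auto
interpretation theta31: theta_param 3 1 by unfold_locales auto

lemma qprod_split_residues:
  assumes "norm q < 1" and N: "N > 0"
  shows "qprod q q = (\<Prod>i<N. qprod (q ^ Suc i) (q ^ N))"
proof -
  have lt: "norm (q ^ k) < 1" if "k > 0" for k
    using norm_power_Suc_less_1[OF assms(1), of "k - 1"] that by simp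
  have "filterlim (\<lambda>n. n * N) sequentially sequentially"
    using N by (intro filterlim_subseq) (auto simp: strict_mono_def)
  then have "(\<lambda>n. \<Prod>j<n * N. 1 - q * q ^ j) \<longlonglongrightarrow> qprod q q"
    by (rule filterlim_compose[OF qprod_convergent(3)[OF assms(1,1)]])
  moreover have "(\<Prod>j<n * N. 1 - q * q ^ j) = (\<Prod>i<N. \<Prod>m<n. 1 - q ^ Suc i * (q ^ N) ^ m)" for n
  proof -
    have "(\<Prod>j<n * N. 1 - q * q ^ j) = (\<Prod>m<n. \<Prod>j\<in>{m * N..<m * N + N}. 1 - q * q ^ j)"
      by (rule prod.nat_group[symmetric])
    also have "\<dots> = (\<Prod>m<n. \<Prod>i<N. 1 - q ^ Suc i * (q ^ N) ^ m)"
    proof (rule prod.cong[OF refl])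
      fix m
      show "(\<Prod>j\<in>{m * N..<m * N + N}. 1 - q * q ^ j) = (\<Prod>i<N. 1 - q ^ Suc i * (q ^ N) ^ m)"
        by (rule prod.reindex_bij_witness[of _ "\<lambda>i. m * N + i" "\<lambda>j. j - m * N"])
           (auto simp: power_mult[symmetric] mult.commute mult.left_commute simp flip: power_add)
    qed
    finally show ?thesis by (simp only: prod.swap[of _ "{..<n}"])
  qed
  moreover have "(\<lambda>n. \<Prod>i<N. \<Prod>m<n. 1 - q ^ Suc i * (q ^ N) ^ m) \<longlonglongrightarrow> (\<Prod>i<N. qprod (q ^ Suc i) (q ^ N))"
    by (intro tendsto_prod qprod_convergent lt N) simp
  ultimately show ?thesis
    using LIMSEQ_unique by auto
qed

theorem eta_eq_theta:
  assumes "\<tau> \<in> uhp"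
  shows "eta \<tau> = theta 3 1 \<tau>"
proof -
  define q where "q = q_pow 1 \<tau>"
  have q: "norm q < 1" "q \<noteq> 0" using norm_q_pow_less_1[OF assms] by (auto simp: q_def)
  have "theta_q 3 1 q = qprod q q"
    using theta31.theta_q_product[OF q] qprod_split_residues[OF q(1), of 3]
    by (simp add: eval_nat_numeral mult_ac)
  then show ?thesis
    unfolding theta31.theta_eq_q eta_eq_q[OF assms] q_def by simp
qed

theorem theta5_mult:
  assumes "\<tau> \<in> uhp"
  shows "theta 5 1 \<tau> * theta 5 3 \<tau> = eta \<tau> * eta (5 * \<tau>)"
proof -
  define q where "q = q_pow 1 \<tau>"
  have q: "norm q < 1" "q \<noteq> 0" using norm_q_pow_less_1[OF assms] by (auto simp: q_def)
  have 5: "q_pow r (5 * \<tau>) = q_pow (5 * r) \<tau>" for r by (simp add: q_pow_def mult_ac)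
  have q5: "q_pow 5 \<tau> = q ^ 5" using q_pow_nat[of 5 \<tau>] by (simp add: q_def)
  have "theta_q 5 1 q * theta_q 5 3 q = qprod q q * qprod (q ^ 5) (q ^ 5)"
    using theta51.theta_q_product[OF q] theta53.theta_q_product[OF q] qprod_split_residues[OF q(1), of 5]
    by (simp add: eval_nat_numeral mult_ac)
  moreover have "5 * \<tau> \<in> uhp" using assms by (simp add: uhp_def)
  moreover have "q_pow (1 / 40) \<tau> * q_pow (9 / 40) \<tau> = q_pow (1 / 24) \<tau> * q_pow (5 / 24) \<tau>"
    by (simp flip: q_pow_add)
  ultimately have "eta (5 * \<tau>) = q_pow (5 / 24) \<tau> * qprod (q ^ 5) (q ^ 5)"
      "theta_q 5 1 q * theta_q 5 3 q = qprod q q * qprod (q ^ 5) (q ^ 5)"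
      "q_pow (1 / 40) \<tau> * q_pow (9 / 40) \<tau> = q_pow (1 / 24) \<tau> * q_pow (5 / 24) \<tau>"
    by (simp_all add: eta_eq_q 5 q5)
  then show ?thesis
    unfolding theta51.theta_eq_q theta53.theta_eq_q eta_eq_q[OF assms] q_def[symmetric] by (simp add: mult_ac)
qed


subsection \<open>The transformation under inversion\<close>

lemma theta_reflect: "theta N (2 * N - s) \<tau> = - theta N s \<tau>" if "N \<noteq> 0"
proof -
  have "theta N (2 * N - s) \<tau> = (\<Sum>\<^sub>\<infinity>p. - ((-1) powi p * q_pow (of_int N / 2 * (of_int p + of_int s / (2 * of_int N))\<^sup>2) \<tau>))"
    unfolding theta_def
  proof (rule infsum_reindex_bij_witness[of _ "\<lambda>p. - 1 - p" "\<lambda>p. - 1 - p"])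
    fix p :: int
    have "(-1 :: complex) powi (- 1 - p) = - ((-1) powi p)"
      by (simp add: power_int_minus_left)
    moreover have "(of_int (- 1 - p) + of_int s / (2 * of_int N))\<^sup>2 = (of_int p + of_int (2 * N - s) / (2 * real_of_int N))\<^sup>2"
    proof -
      have "of_int p + of_int (2 * N - s) / (2 * real_of_int N) = - (of_int (- 1 - p) + of_int s / (2 * of_int N))"
        using that by (simp add: field_simps)
      then show ?thesis by (simp only: power2_minus)
    qed
    ultimately show "- ((-1) powi (- 1 - p) * q_pow (of_int N / 2 * (of_int (- 1 - p) + of_int s / (2 * of_int N))\<^sup>2) \<tau>) =
      (-1) powi p * q_pow (of_int N / 2 * (of_int p + of_int (2 * N - s) / (2 * of_int N))\<^sup>2) \<tau>"
      by simp
  qed auto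
  also have "\<dots> = - theta N s \<tau>"
    unfolding theta_def by (rule infsum_uminus)
  finally show ?thesis .
qed

lemma theta_self: "N \<noteq> 0 \<Longrightarrow> theta N N \<tau> = 0"
proof -
  assume "N \<noteq> 0"
  from theta_reflect[OF this, of N \<tau>] have "theta N N \<tau> = - theta N N \<tau>" by simp
  then have "Re (theta N N \<tau>) = - Re (theta N N \<tau>)" "Im (theta N N \<tau>) = - Im (theta N N \<tau>)"
    by (metis uminus_complex.sel(1), metis uminus_complex.sel(2))
  then show ?thesis by (simp add: complex_eq_iff)
qed

lemma theta_inversion_imaginary:
  fixes y :: real and N r :: int
  assumes y: "y > 0" and r: "\<bar>r\<bar> < N" and odd: "odd r"
  shows "theta N r (\<i> / of_real y) = of_real (sqrt (y / of_int N)) *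
    (\<Sum>j\<in>{0..<N}. cis (pi * of_int ((2 * j + 1) * r) / (2 * of_int N)) * theta N (2 * j + 1) (\<i> * of_real y))"
proof -
  have N: "N > 0" using r by linarith
  define a where "a = real_of_int r / (2 * of_int N)"
  define t where "t = of_int N / y"
  have t: "t > 0" using N y by (simp add: t_def)
  have "real_of_int \<bar>r\<bar> < real_of_int N" using r by (simp only: of_int_less_iff)
  then have a: "\<bar>a\<bar> < 1/2" using N by (simp add: a_def abs_divide field_simps)
  define g where "g \<nu> = complex_of_real (exp (- (pi * (2 * of_int \<nu> + 1)\<^sup>2 / (4 * t)))) * cis (pi * (2 * of_int \<nu> + 1) * a)" for \<nu> :: int
  have "theta N r (\<i> / of_real y) = (\<Sum>\<^sub>\<infinity>k::int. (-1) powi k * complex_of_real (exp (- (pi * t * (of_int k + a)\<^sup>2))))"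
    unfolding theta_def
  proof (rule infsum_cong)
    fix k :: int
    have "q_pow (of_int N / 2 * (of_int k + a)\<^sup>2) (\<i> / of_real y) = of_real (exp (- (pi * t * (of_int k + a)\<^sup>2)))"
      using y by (simp add: q_pow_def t_def field_simps flip: exp_of_real)
    then show "(-1) powi k * q_pow (of_int N / 2 * (of_int k + of_int r / (2 * of_int N))\<^sup>2) (\<i> / of_real y) =
       (-1) powi k * complex_of_real (exp (- (pi * t * (of_int k + a)\<^sup>2)))"
      by (simp add: a_def)
  qed
  also have "\<dots> = of_real (1 / sqrt t) * (\<Sum>\<^sub>\<infinity>\<nu>. g \<nu>)"
    unfolding g_def by (rule theta_inversion_real[OF t a])
  also have "(\<Sum>\<^sub>\<infinity>\<nu>. g \<nu>) = (\<Sum>j\<in>{0..<N}. \<Sum>\<^sub>\<infinity>p. g (N * p + j))"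
  proof -
    define \<rho> where "\<rho> = exp (- (pi / (4 * t)))"
    have \<rho>: "0 \<le> \<rho>" "\<rho> < 1" using t by (auto simp: \<rho>_def)
    have g_sum: "g summable_on UNIV"
    proof (rule abs_summable_summable, rule Infinite_Sum.abs_summable_on_comparison_test'[OF summable_on_int_geometric[OF \<rho>]])
      fix \<nu> :: int
      have "\<bar>\<nu>\<bar> \<le> (2 * \<nu> + 1)\<^sup>2"
      proof -
        have ge: "1 \<le> \<bar>2 * \<nu> + 1\<bar>" by presburger
        have "\<bar>\<nu>\<bar> \<le> \<bar>2 * \<nu> + 1\<bar> * 1" by presburger
        also have "\<dots> \<le> \<bar>2 * \<nu> + 1\<bar> * \<bar>2 * \<nu> + 1\<bar>"
          by (rule mult_left_mono[OF ge]) simp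
        finally show ?thesis by (simp add: power2_eq_square)
      qed
      then have "real_of_int \<bar>\<nu>\<bar> \<le> real_of_int ((2 * \<nu> + 1)\<^sup>2)" by (simp only: of_int_le_iff)
      then have "real (nat \<bar>\<nu>\<bar>) * (pi / (4 * t)) \<le> (2 * of_int \<nu> + 1)\<^sup>2 * (pi / (4 * t))"
        using t by (intro mult_right_mono) auto
      then have "exp (- (pi * (2 * of_int \<nu> + 1)\<^sup>2 / (4 * t))) \<le> exp (real (nat \<bar>\<nu>\<bar>) * (- (pi / (4 * t))))"
        by (simp add: mult.commute)
      also have "\<dots> = \<rho> ^ nat \<bar>\<nu>\<bar>"
        unfolding \<rho>_def by (rule exp_of_nat_mult)
      finally show "norm (g \<nu>) \<le> \<rho> ^ nat \<bar>\<nu>\<bar>"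
        by (simp add: g_def norm_mult)
    qed
    have bij: "bij_betw (\<lambda>(j, p). N * p + j) ({0..<N} \<times> UNIV) (UNIV :: int set)"
      by (rule bij_betw_byWitness[where f' = "\<lambda>\<nu>. (\<nu> mod N, \<nu> div N)"]) (use N in auto)
    have "(\<Sum>\<^sub>\<infinity>\<nu>. g \<nu>) = (\<Sum>\<^sub>\<infinity>x\<in>{0..<N} \<times> UNIV. g (case x of (j, p) \<Rightarrow> N * p + j))"
      by (rule infsum_reindex_bij_betw[OF bij, symmetric])
    also have "\<dots> = (\<Sum>\<^sub>\<infinity>j\<in>{0..<N}. \<Sum>\<^sub>\<infinity>p. g (N * p + j))"
    proof (subst infsum_Sigma_banach[symmetric])
      show "(\<lambda>x. g (case x of (j, p) \<Rightarrow> N * p + j)) summable_on {0..<N} \<times> UNIV"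
        using summable_on_reindex_bij_betw[OF bij, of g] g_sum by simp
    qed simp
    finally show ?thesis by simp
  qed
  also have "\<dots> = (\<Sum>j\<in>{0..<N}. cis (pi * of_int ((2 * j + 1) * r) / (2 * of_int N)) * theta N (2 * j + 1) (\<i> * of_real y))"
  proof (rule sum.cong[OF refl])
    fix j
    have "g (N * p + j) = cis (pi * of_int ((2 * j + 1) * r) / (2 * of_int N)) *
        ((-1) powi p * q_pow (of_int N / 2 * (of_int p + of_int (2 * j + 1) / (2 * of_int N))\<^sup>2) (\<i> * of_real y))" for p
    proof -
      have "pi * (2 * of_int (N * p + j) + 1)\<^sup>2 / (4 * t) = pi * of_int N * y * (of_int p + of_int (2 * j + 1) / (2 * of_int N))\<^sup>2"
      proof -
        have "of_int p + of_int (2 * j + 1) / (2 * of_int N) = (2 * of_int (N * p + j) + 1) / (2 * real_of_int N)"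
          using N by (simp add: field_simps)
        then show ?thesis
          using N y by (simp add: t_def power_divide power2_eq_square)
      qed
      then have 1: "complex_of_real (exp (- (pi * (2 * of_int (N * p + j) + 1)\<^sup>2 / (4 * t)))) =
         q_pow (of_int N / 2 * (of_int p + of_int (2 * j + 1) / (2 * of_int N))\<^sup>2) (\<i> * of_real y)"
        by (simp add: q_pow_def algebra_simps flip: exp_of_real)
      have "pi * (2 * of_int (N * p + j) + 1) * a = of_int (p * r) * pi + pi * of_int ((2 * j + 1) * r) / (2 * of_int N)"
        using N by (simp add: a_def field_simps)
      then have "cis (pi * (2 * of_int (N * p + j) + 1) * a) = cis (of_int (p * r) * pi) * cis (pi * of_int ((2 * j + 1) * r) / (2 * of_int N))"
        by (simp only: cis_mult)
      also have "cis (of_int (p * r) * pi) = (-1) powi (p * r)"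
        using cis_power_int[of pi "p * r"] by (simp only: cis_pi)
      also have "(-1 :: complex) powi (p * r) = (-1) powi p"
        using odd by (simp add: power_int_minus_left)
      finally have 2: "cis (pi * (2 * of_int (N * p + j) + 1) * a) = (-1) powi p * cis (pi * of_int ((2 * j + 1) * r) / (2 * of_int N))" .
      show ?thesis
        unfolding g_def 1 2 by (simp only: mult_ac)
    qed
    then show "(\<Sum>\<^sub>\<infinity>p. g (N * p + j)) = cis (pi * of_int ((2 * j + 1) * r) / (2 * of_int N)) * theta N (2 * j + 1) (\<i> * of_real y)"
      unfolding theta_def by (simp only: infsum_cmult_right')
  qed
  also have "1 / sqrt t = sqrt (y / of_int N)"
    using y N by (simp add: t_def real_sqrt_divide)
  finally show ?thesis .
qed

definition csqrt_tau :: "complex \<Rightarrow> complex" where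
  "csqrt_tau \<tau> = exp (Ln (- \<i> * \<tau>) / 2)"

lemma half_Ln_holomorphic: "(\<lambda>\<tau>. Ln (- \<i> * \<tau>) / 2) holomorphic_on uhp"
proof -
  have "- \<i> * \<tau> \<notin> \<real>\<^sub>\<le>\<^sub>0" if "\<tau> \<in> uhp" for \<tau>
    using that by (auto simp: uhp_def complex_nonpos_Reals_iff)
  then have "(\<lambda>\<tau>. Ln (- \<i> * \<tau>)) holomorphic_on uhp"
    by (intro holomorphic_intros) auto
  then show ?thesis by (rule holomorphic_on_divide) auto
qed

lemma inversion_in_uhp: "\<tau> \<in> uhp \<Longrightarrow> - 1 / \<tau> \<in> uhp"
proof -
  assume "\<tau> \<in> uhp"
  then have "Im \<tau> > 0" by (simp add: uhp_def)
  then have "(Re \<tau>)\<^sup>2 + (Im \<tau>)\<^sup>2 > 0" by (simp add: add_nonneg_pos)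
  then show ?thesis using \<open>Im \<tau> > 0\<close> by (simp add: uhp_def Im_divide)
qed

lemma uhp_nonzero: "\<tau> \<in> uhp \<Longrightarrow> \<tau> \<noteq> 0"
  by (auto simp: uhp_def)

lemma holomorphic_inversion:
  assumes "f holomorphic_on uhp"
  shows "(\<lambda>\<tau>. f (- 1 / \<tau>)) holomorphic_on uhp"
proof -
  have "(\<lambda>\<tau>. - 1 / \<tau>) holomorphic_on uhp"
    using uhp_nonzero by (intro holomorphic_intros) auto
  then show ?thesis
    by (rule holomorphic_on_compose_gen[unfolded o_def, OF _ assms]) (use inversion_in_uhp in auto)
qed

lemma eq_on_uhp_if_eq_on_imaginary_axis:
  assumes f: "f holomorphic_on uhp" and g: "g holomorphic_on uhp"
    and eq: "\<And>y. y > 0 \<Longrightarrow> f (\<i> * of_real y) = g (\<i> * of_real y)" and \<tau>: "\<tau> \<in> uhp"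
  shows "f \<tau> = g \<tau>"
proof -
  have "f \<tau> - g \<tau> = 0"
  proof (rule analytic_continuation[of "\<lambda>\<tau>. f \<tau> - g \<tau>" uhp "(\<lambda>y. \<i> * of_real y) ` {0<..}" \<i>])
    show "\<i> islimpt (\<lambda>y. \<i> * of_real y) ` {0<..}"
      unfolding islimpt_approachable
    proof (intro allI impI)
      fix e :: real assume "e > 0"
      then have "\<i> * of_real (1 + e / 2) \<in> (\<lambda>y. \<i> * of_real y) ` {0<..}" "\<i> * of_real (1 + e / 2) \<noteq> \<i>"
        "dist (\<i> * of_real (1 + e / 2)) \<i> < e"
        by (auto simp: dist_norm algebra_simps norm_mult norm_divide complex_eq_iff intro!: imageI)
      then show "\<exists>x'\<in>(\<lambda>y. \<i> * of_real y) ` {0<..}. x' \<noteq> \<i> \<and> dist x' \<i> < e" by blast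
    qed
  qed (use f g eq \<tau> uhp_open uhp_connected in \<open>auto simp: uhp_def intro!: holomorphic_intros\<close>)
  then show ?thesis by simp
qed

lemma csqrt_tau_holomorphic: "csqrt_tau holomorphic_on uhp"
  using holomorphic_on_exp'[OF half_Ln_holomorphic] unfolding csqrt_tau_def[abs_def] .

lemma csqrt_tau_imaginary: "y > 0 \<Longrightarrow> csqrt_tau (\<i> * of_real y) = of_real (sqrt y)"
proof -
  assume y: "y > 0"
  have "- \<i> * (\<i> * of_real y) = complex_of_real y" by simp
  then have "csqrt_tau (\<i> * of_real y) = exp (of_real (ln y / 2))"
    unfolding csqrt_tau_def using y by (simp add: Ln_of_real)
  also have "\<dots> = of_real (exp (ln y / 2))" by (rule exp_of_real)
  also have "exp (ln y / 2) = sqrt y"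
    using y by (simp add: ln_sqrt[symmetric])
  finally show ?thesis .
qed

lemma cis_pi_minus: "cis (pi - x) = - cis (- x)"
  by (simp add: complex_eq_iff)

lemma minus_inverse_imaginary: "- 1 / (\<i> * of_real y) = \<i> / of_real y"
proof -
  have "- 1 / (\<i> * of_real y) = (\<i> * \<i>) / (\<i> * of_real y)" by simp
  also have "\<dots> = \<i> / of_real y" by (rule mult_divide_mult_cancel_left) simp
  finally show ?thesis .
qed

theorem eta_inversion:
  assumes "\<tau> \<in> uhp"
  shows "eta (- 1 / \<tau>) = csqrt_tau \<tau> * eta \<tau>"
proof -
  have "theta 3 1 (- 1 / \<tau>) = csqrt_tau \<tau> * theta 3 1 \<tau>"
  proof (rule eq_on_uhp_if_eq_on_imaginary_axis[OF _ _ _ assms])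
    show "(\<lambda>\<tau>. theta 3 1 (- 1 / \<tau>)) holomorphic_on uhp"
      by (rule holomorphic_inversion[OF theta31.theta_holomorphic])
    show "(\<lambda>\<tau>. csqrt_tau \<tau> * theta 3 1 \<tau>) holomorphic_on uhp"
      by (intro holomorphic_intros csqrt_tau_holomorphic theta31.theta_holomorphic)
    fix y :: real assume y: "y > 0"
    have set: "{0..<3::int} = {0, 1, 2}" by auto
    have "theta 3 1 (\<i> / of_real y) = of_real (sqrt (y / 3)) *
       (cis (pi / 6) * theta 3 1 (\<i> * of_real y) + cis (pi / 2) * theta 3 3 (\<i> * of_real y) + cis (5 * pi / 6) * theta 3 5 (\<i> * of_real y))"
      using theta_inversion_imaginary[OF y, of 1 3] by (simp add: set add.assoc mult.commute[of pi])
    also have "theta 3 3 (\<i> * of_real y) = 0" by (rule theta_self) simp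
    also have "theta 3 5 (\<i> * of_real y) = - theta 3 1 (\<i> * of_real y)"
      using theta_reflect[of 3 1] by simp
    also have "cis (pi / 6) * theta 3 1 (\<i> * of_real y) + cis (pi / 2) * 0 + cis (5 * pi / 6) * - theta 3 1 (\<i> * of_real y) =
       (cis (pi / 6) - cis (5 * pi / 6)) * theta 3 1 (\<i> * of_real y)"
      by (simp add: algebra_simps)
    also have "cis (5 * pi / 6) = - cis (- (pi / 6))"
    proof -
      have "5 * pi / 6 = pi - pi / 6" by simp
      then show ?thesis by (simp only: cis_pi_minus)
    qed
    also have "cis (pi / 6) - - cis (- (pi / 6)) = of_real (sqrt 3)"
      by (simp add: complex_eq_iff cos_30)
    also have "complex_of_real (sqrt (y / 3)) * (of_real (sqrt 3) * theta 3 1 (\<i> * of_real y)) = of_real (sqrt y) * theta 3 1 (\<i> * of_real y)"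
      by (simp add: real_sqrt_divide)
    finally show "theta 3 1 (- 1 / (\<i> * of_real y)) = csqrt_tau (\<i> * of_real y) * theta 3 1 (\<i> * of_real y)"
      unfolding minus_inverse_imaginary csqrt_tau_imaginary[OF y] .
  qed
  then show ?thesis
    using assms inversion_in_uhp by (simp add: eta_eq_theta)
qed

lemma log_eta_inversion:
  assumes "\<tau> \<in> uhp"
  shows "log_eta (- 1 / \<tau>) = log_eta \<tau> + Ln (- \<i> * \<tau>) / 2"
proof -
  define D where "D \<tau> = log_eta (- 1 / \<tau>) - (log_eta \<tau> + Ln (- \<i> * \<tau>) / 2)" for \<tau>
  have D_hol: "D holomorphic_on uhp"
    unfolding D_def[abs_def]
    using holomorphic_on_diff[OF holomorphic_inversion[OF log_eta_holomorphic]
        holomorphic_on_add[OF log_eta_holomorphic half_Ln_holomorphic]] .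
  have expD: "exp (D \<tau>) = 1" if "\<tau> \<in> uhp" for \<tau>
    using eta_inversion[OF that]
    unfolding eta_eq[OF that] eta_eq[OF inversion_in_uhp[OF that]] D_def exp_diff exp_add csqrt_tau_def by simp
  have "\<exists>c. \<forall>\<tau>\<in>uhp. D \<tau> = c"
  proof (rule has_field_derivative_zero_constant[OF uhp_convex])
    fix \<tau> assume \<tau>: "\<tau> \<in> uhp"
    obtain D' where D': "(D has_field_derivative D') (at \<tau>)"
      using D_hol \<tau> unfolding holomorphic_on_open[OF uhp_open] by blast
    then have "((\<lambda>\<tau>. exp (D \<tau>)) has_field_derivative exp (D \<tau>) * D') (at \<tau>)"
      by (auto intro!: derivative_eq_intros)
    moreover have "((\<lambda>\<tau>. exp (D \<tau>)) has_field_derivative 0) (at \<tau>)"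
      by (rule has_field_derivative_transform_within_open[OF DERIV_const uhp_open \<tau>]) (use expD in simp)
    ultimately have "exp (D \<tau>) * D' = 0" by (rule DERIV_unique)
    then have "D' = 0" by simp
    with D' show "(D has_field_derivative 0) (at \<tau> within uhp)"
      using has_field_derivative_at_within by blast
  qed
  then obtain c where c: "\<And>\<tau>. \<tau> \<in> uhp \<Longrightarrow> D \<tau> = c" by blast
  have "\<i> \<in> uhp" by (simp add: uhp_def)
  from c[OF this] have "c = 0" by (simp add: D_def)
  with c[OF assms] show ?thesis by (simp add: D_def)
qed

lemma log_eta_translate: "log_eta (\<tau> + of_int n) = log_eta \<tau> + of_real pi * \<i> * of_int n / 12"
proof -
  have "of_real pi * \<i> * (\<tau> + of_int n) / 12 = of_real pi * \<i> * \<tau> / 12 + of_real pi * \<i> * of_int n / 12"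
    by (simp only: distrib_left add_divide_distrib)
  then show ?thesis
    unfolding log_eta_def q_pow_1_translate by simp
qed

definition cS :: "real" where "cS = 2 / sqrt 5 * cos (pi / 10)"
definition cS' :: "real" where "cS' = 2 / sqrt 5 * cos (3 * pi / 10)"

theorem theta5_inversion:
  assumes "\<tau> \<in> uhp"
  shows "theta 5 1 (- 1 / \<tau>) = csqrt_tau \<tau> * (of_real cS * theta 5 1 \<tau> + of_real cS' * theta 5 3 \<tau>)"
    and "theta 5 3 (- 1 / \<tau>) = csqrt_tau \<tau> * (of_real cS' * theta 5 1 \<tau> - of_real cS * theta 5 3 \<tau>)"
proof -
  have set: "{0..<5::int} = {0, 1, 2, 3, 4}"
    unfolding set_eq_iff atLeastLessThan_iff insert_iff empty_iff by presburger
  have t: "theta 5 5 \<tau> = 0" "theta 5 7 \<tau> = - theta 5 3 \<tau>" "theta 5 9 \<tau> = - theta 5 1 \<tau>" for \<tau>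
    using theta_self[of 5] theta_reflect[of 5 3] theta_reflect[of 5 1] by auto
  have c7: "cis (7 * pi / 10) = - cis (- (3 * pi / 10))"
    unfolding cis_pi_minus[symmetric] by (rule arg_cong[of _ _ cis]) simp
  have c9: "cis (9 * pi / 10) = - cis (- (pi / 10))"
    unfolding cis_pi_minus[symmetric] by (rule arg_cong[of _ _ cis]) simp
  have period: "cis (x + 2 * pi) = cis x" for x
    by (simp add: complex_eq_iff)
  have c21: "cis (21 * pi / 10) = cis (pi / 10)"
    unfolding period[of "pi / 10", symmetric] by (rule arg_cong[of _ _ cis]) simp
  have c27: "cis (27 * pi / 10) = - cis (- (3 * pi / 10))"
    unfolding c7[symmetric] period[of "7 * pi / 10", symmetric] by (rule arg_cong[of _ _ cis]) simp
  have twice: "cis x + cis (- x) = of_real (2 * cos x)" for x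
    by (simp add: complex_eq_iff)
  have 1: "theta 5 1 (\<i> / of_real y) = of_real (sqrt y) * (of_real cS * theta 5 1 (\<i> * of_real y) + of_real cS' * theta 5 3 (\<i> * of_real y))"
    if y: "y > 0" for y
  proof -
    have "theta 5 1 (\<i> / of_real y) = of_real (sqrt (y / 5)) *
       ((cis (pi / 10) + cis (- (pi / 10))) * theta 5 1 (\<i> * of_real y) + (cis (3 * pi / 10) + cis (- (3 * pi / 10))) * theta 5 3 (\<i> * of_real y))"
      using theta_inversion_imaginary[OF y, of 1 5]
      by (simp add: set t c7 c9 mult.commute[of pi]) (simp add: algebra_simps)
    then show ?thesis
      unfolding twice by (simp add: cS_def cS'_def real_sqrt_divide field_simps)
  qed
  have 2: "theta 5 3 (\<i> / of_real y) = of_real (sqrt y) * (of_real cS' * theta 5 1 (\<i> * of_real y) - of_real cS * theta 5 3 (\<i> * of_real y))"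
    if y: "y > 0" for y
  proof -
    have "theta 5 3 (\<i> / of_real y) = of_real (sqrt (y / 5)) *
       ((cis (3 * pi / 10) + cis (- (3 * pi / 10))) * theta 5 1 (\<i> * of_real y) - (cis (pi / 10) + cis (- (pi / 10))) * theta 5 3 (\<i> * of_real y))"
      using theta_inversion_imaginary[OF y, of 3 5]
      by (simp add: set t c9 c21 c27 mult.commute[of pi]) (simp add: algebra_simps)
    then show ?thesis
      unfolding twice by (simp add: cS_def cS'_def real_sqrt_divide field_simps)
  qed
  show "theta 5 1 (- 1 / \<tau>) = csqrt_tau \<tau> * (of_real cS * theta 5 1 \<tau> + of_real cS' * theta 5 3 \<tau>)"
  proof (rule eq_on_uhp_if_eq_on_imaginary_axis[OF _ _ _ assms])
    show "(\<lambda>\<tau>. theta 5 1 (- 1 / \<tau>)) holomorphic_on uhp"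
      by (rule holomorphic_inversion[OF theta51.theta_holomorphic])
    show "(\<lambda>\<tau>. csqrt_tau \<tau> * (of_real cS * theta 5 1 \<tau> + of_real cS' * theta 5 3 \<tau>)) holomorphic_on uhp"
      by (intro holomorphic_intros csqrt_tau_holomorphic theta51.theta_holomorphic theta53.theta_holomorphic)
  qed (simp only: minus_inverse_imaginary csqrt_tau_imaginary 1)
  show "theta 5 3 (- 1 / \<tau>) = csqrt_tau \<tau> * (of_real cS' * theta 5 1 \<tau> - of_real cS * theta 5 3 \<tau>)"
  proof (rule eq_on_uhp_if_eq_on_imaginary_axis[OF _ _ _ assms])
    show "(\<lambda>\<tau>. theta 5 3 (- 1 / \<tau>)) holomorphic_on uhp"
      by (rule holomorphic_inversion[OF theta53.theta_holomorphic])
    show "(\<lambda>\<tau>. csqrt_tau \<tau> * (of_real cS' * theta 5 1 \<tau> - of_real cS * theta 5 3 \<tau>)) holomorphic_on uhp"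
      by (intro holomorphic_intros csqrt_tau_holomorphic theta51.theta_holomorphic theta53.theta_holomorphic)
  qed (simp only: minus_inverse_imaginary csqrt_tau_imaginary 2)
qed


no_notation fps_nth (infixl "$" 75)

section \<open>The modular group\<close>

definition mat2 :: "'a \<Rightarrow> 'a \<Rightarrow> 'a \<Rightarrow> 'a \<Rightarrow> 'a::zero^2^2" where
  "mat2 a b c d = vector [vector [a, b], vector [c, d]]"

lemma mat2_nth [simp]:
  "mat2 a b c d $ 1 $ 1 = a" "mat2 a b c d $ 1 $ 2 = b" "mat2 a b c d $ 2 $ 1 = c" "mat2 a b c d $ 2 $ 2 = d"
  by (simp_all add: mat2_def)

lemma mat2_eq_iff: "A = B \<longleftrightarrow> A$1$1 = B$1$1 \<and> A$1$2 = B$1$2 \<and> A$2$1 = B$2$1 \<and> A$2$2 = B$2$2"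
  for A B :: "'a^2^2"
  by (simp only: vec_eq_iff forall_2 conj_assoc)

lemma mat2_mult_nth:
  fixes A B :: "'a::semiring_1^2^2"
  shows "(A ** B) $ i $ j = A$i$1 * B$1$j + A$i$2 * B$2$j"
  by (simp add: matrix_matrix_mult_def sum_2)

lemma mat_1_nth [simp]:
  "(mat 1 :: 'a::zero_neq_one^2^2) $ 1 $ 1 = 1" "(mat 1 :: 'a^2^2) $ 1 $ 2 = 0" "(mat 1 :: 'a^2^2) $ 2 $ 1 = 0" "(mat 1 :: 'a^2^2) $ 2 $ 2 = 1"
  by (simp_all add: mat_def)

lemma SL2Z_iff: "A \<in> SL2Z \<longleftrightarrow> A$1$1 * A$2$2 - A$1$2 * A$2$1 = 1"
  by (simp add: SL2Z_def det_2)

lemma SL2Z_mult: "A \<in> SL2Z \<Longrightarrow> B \<in> SL2Z \<Longrightarrow> A ** B \<in> SL2Z"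
  by (simp add: SL2Z_def det_mul)

lemma SL2Z_1: "mat 1 \<in> SL2Z"
  by (simp add: SL2Z_def)

definition T_mat :: "int \<Rightarrow> int^2^2" where "T_mat k = mat2 1 k 0 1"
definition S_mat :: "int^2^2" where "S_mat = mat2 0 (-1) 1 0"
definition inv2 :: "int^2^2 \<Rightarrow> int^2^2" where "inv2 A = mat2 (A$2$2) (- A$1$2) (- A$2$1) (A$1$1)"

lemma T_S_inv2_SL2Z: "T_mat k \<in> SL2Z" "S_mat \<in> SL2Z" "A \<in> SL2Z \<Longrightarrow> inv2 A \<in> SL2Z"
  by (simp_all add: SL2Z_iff T_mat_def S_mat_def inv2_def mult.commute)

lemma inv2_mult: "A \<in> SL2Z \<Longrightarrow> A ** inv2 A = mat 1" "A \<in> SL2Z \<Longrightarrow> inv2 A ** A = mat 1"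
  by (simp_all add: SL2Z_iff mat2_eq_iff mat2_mult_nth inv2_def mult.commute)

lemma denom_nonzero:
  assumes "A \<in> SL2Z" "\<tau> \<in> uhp"
  shows "denom A \<tau> \<noteq> 0"
proof
  assume eq: "denom A \<tau> = 0"
  then have "Im (denom A \<tau>) = 0" by simp
  then have "A$2$1 = 0" using assms(2) by (simp add: denom_def uhp_def)
  with eq have "A$2$2 = 0" by (simp add: denom_def)
  with \<open>A$2$1 = 0\<close> assms(1) show False by (simp add: SL2Z_iff)
qed

lemma Im_moebius:
  assumes "A \<in> SL2Z" "\<tau> \<in> uhp"
  shows "Im (moebius_map A \<tau>) = Im \<tau> / (norm (denom A \<tau>))\<^sup>2"
proof -
  let ?n = "of_int (A$1$1) * \<tau> + of_int (A$1$2) :: complex"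
  have "moebius_map A \<tau> = ?n * cnj (denom A \<tau>) / of_real ((norm (denom A \<tau>))\<^sup>2)"
    using denom_nonzero[OF assms] unfolding complex_norm_square by (simp add: moebius_map_def)
  then have "Im (moebius_map A \<tau>) = Im (?n * cnj (denom A \<tau>)) / (norm (denom A \<tau>))\<^sup>2"
    by (simp only: Im_divide_of_real)
  also have "Im (?n * cnj (denom A \<tau>)) = of_int (A$1$1 * A$2$2 - A$1$2 * A$2$1) * Im \<tau>"
    by (simp add: denom_def algebra_simps)
  also have "A$1$1 * A$2$2 - A$1$2 * A$2$1 = 1" using assms(1) by (simp only: SL2Z_iff)
  finally show ?thesis by simp
qed

lemma moebius_in_uhp: "A \<in> SL2Z \<Longrightarrow> \<tau> \<in> uhp \<Longrightarrow> moebius_map A \<tau> \<in> uhp"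
  using Im_moebius[of A \<tau>] denom_nonzero[of A \<tau>] by (simp add: uhp_def)

lemma denom_mult:
  assumes "B \<in> SL2Z" "\<tau> \<in> uhp"
  shows "denom (A ** B) \<tau> = denom A (moebius_map B \<tau>) * denom B \<tau>"
  using denom_nonzero[OF assms] unfolding moebius_map_def
  by (simp add: denom_def[of A] denom_def[of "A ** B"] mat2_mult_nth field_simps) (simp add: denom_def algebra_simps)

lemma moebius_mult:
  assumes "A \<in> SL2Z" "B \<in> SL2Z" "\<tau> \<in> uhp"
  shows "moebius_map (A ** B) \<tau> = moebius_map A (moebius_map B \<tau>)"
proof -
  have dB: "denom B \<tau> \<noteq> 0" by (rule denom_nonzero[OF assms(2,3)])
  have dAB: "denom A (moebius_map B \<tau>) \<noteq> 0"
    by (rule denom_nonzero[OF assms(1) moebius_in_uhp[OF assms(2,3)]])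
  have "(of_int (A$1$1) * moebius_map B \<tau> + of_int (A$1$2)) * denom B \<tau> =
     of_int ((A ** B)$1$1) * \<tau> + of_int ((A ** B)$1$2)"
    using dB by (simp add: moebius_map_def mat2_mult_nth field_simps) (simp add: denom_def algebra_simps)
  then show ?thesis
    unfolding moebius_map_def[of "A ** B"] moebius_map_def[of A] denom_mult[OF assms(2,3)]
    using dB dAB by (metis mult_divide_mult_cancel_right)
qed

lemma moebius_simps:
  "moebius_map (mat 1) \<tau> = \<tau>" "denom (mat 1) \<tau> = 1"
  "moebius_map (T_mat k) \<tau> = \<tau> + of_int k" "denom (T_mat k) \<tau> = 1"
  "moebius_map S_mat \<tau> = - 1 / \<tau>" "denom S_mat \<tau> = \<tau>"
  by (simp_all add: moebius_map_def denom_def T_mat_def S_mat_def)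

lemma moebius_inv2:
  assumes "A \<in> SL2Z" "\<tau> \<in> uhp"
  shows "moebius_map (inv2 A) (moebius_map A \<tau>) = \<tau>" "moebius_map A (moebius_map (inv2 A) \<tau>) = \<tau>"
  using moebius_mult[OF T_S_inv2_SL2Z(3)[OF assms(1)] assms] moebius_mult[OF assms(1) T_S_inv2_SL2Z(3)[OF assms(1)] assms(2)]
  by (simp_all add: inv2_mult assms moebius_simps)

lemma SL2Z_induct [consumes 1, case_names one translate invert]:
  assumes "A \<in> SL2Z"
    and one: "P (mat 1)"
    and T: "\<And>A k. A \<in> SL2Z \<Longrightarrow> P A \<Longrightarrow> P (A ** T_mat k)"
    and S: "\<And>A. A \<in> SL2Z \<Longrightarrow> P A \<Longrightarrow> P (A ** S_mat)"
  shows "P A"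
  using assms(1)
proof (induction "nat \<bar>A$2$1\<bar>" arbitrary: A rule: less_induct)
  case less
  have S2: "P B" if "B \<in> SL2Z" "P (B ** S_mat)" for B
  proof -
    have "B ** S_mat ** S_mat ** S_mat ** S_mat = B"
      by (simp add: mat2_eq_iff mat2_mult_nth S_mat_def)
    then show ?thesis using S that T_S_inv2_SL2Z(2) SL2Z_mult by metis
  qed
  have TT: "P B" if "B \<in> SL2Z" "P (B ** T_mat k)" for B k
  proof -
    have "B ** T_mat k ** T_mat (- k) = B"
      by (simp add: mat2_eq_iff mat2_mult_nth T_mat_def)
    then show ?thesis using T that T_S_inv2_SL2Z(1) SL2Z_mult by metis
  qed
  have A: "A$1$1 * A$2$2 - A$1$2 * A$2$1 = 1" using less.prems by (simp add: SL2Z_iff)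
  show ?case
  proof (cases "A$2$1 = 0")
    case True
    then have "A$1$1 * A$2$2 = 1" using A by simp
    then consider "A$1$1 = 1" "A$2$2 = 1" | "A$1$1 = -1" "A$2$2 = -1"
      by (auto simp: zmult_eq_1_iff)
    then show ?thesis
    proof cases
      case 1
      then have "A = mat 1 ** T_mat (A$1$2)"
        using True by (simp add: mat2_eq_iff mat2_mult_nth T_mat_def)
      then show ?thesis using T[OF SL2Z_1 one] by metis
    next
      case 2
      then have "A ** S_mat ** S_mat = mat 1 ** T_mat (- A$1$2)"
        using True by (simp add: mat2_eq_iff mat2_mult_nth T_mat_def S_mat_def)
      then have "P (A ** S_mat ** S_mat)" using T[OF SL2Z_1 one] by metis
      then show ?thesis using S2 less.prems SL2Z_mult T_S_inv2_SL2Z(2) by metis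
    qed
  next
    case False
    define k where "k = - (A$2$2 div A$2$1)"
    define B where "B = A ** T_mat k ** S_mat"
    have B: "B \<in> SL2Z"
      unfolding B_def by (intro SL2Z_mult less.prems T_S_inv2_SL2Z)
    have "B$2$1 = A$2$2 mod A$2$1"
      by (simp add: B_def k_def mat2_mult_nth T_mat_def S_mat_def minus_mult_div_eq_mod[symmetric] algebra_simps)
    then have "\<bar>B$2$1\<bar> < \<bar>A$2$1\<bar>"
      using False by (simp add: abs_mod_less)
    then have "P B" by (intro less.hyps B) linarith
    then show ?thesis
      unfolding B_def using S2 TT less.prems SL2Z_mult T_S_inv2_SL2Z by metis
  qed
qed

lemma exists_large_Im:
  assumes "\<tau> \<in> uhp"
  obtains A where "A \<in> SL2Z" "Im (moebius_map A \<tau>) \<ge> 1 / 2"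
proof -
  define D where "D = {A \<in> SL2Z. norm (denom A \<tau>) \<le> 1}"
  define B where "B = \<lceil>1 / Im \<tau>\<rceil>"
  define C where "C = \<lceil>1 + of_int B * norm \<tau>\<rceil>"
  have y: "Im \<tau> > 0" using assms by (simp add: uhp_def)
  have "(\<lambda>A. norm (denom A \<tau>)) ` D \<subseteq> (\<lambda>(c, d). norm (of_int c * \<tau> + of_int d)) ` ({-B..B} \<times> {-C..C})"
  proof
    fix x assume "x \<in> (\<lambda>A. norm (denom A \<tau>)) ` D"
    then obtain A where A: "x = norm (denom A \<tau>)" "norm (denom A \<tau>) \<le> 1" by (auto simp: D_def)
    have "\<bar>of_int (A$2$1)\<bar> * Im \<tau> \<le> 1"
      using abs_Im_le_cmod[of "denom A \<tau>"] A(2) y by (simp add: denom_def abs_mult)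
    then have c: "\<bar>of_int (A$2$1)\<bar> \<le> 1 / Im \<tau>" using y by (simp add: field_simps)
    then have c': "\<bar>A$2$1\<bar> \<le> B" unfolding B_def by linarith
    have "norm (of_int (A$2$2) :: complex) \<le> norm (denom A \<tau>) + norm (of_int (A$2$1) * \<tau>)"
      using norm_triangle_ineq4[of "denom A \<tau>" "of_int (A$2$1) * \<tau>"] by (simp add: denom_def)
    also have "\<dots> \<le> 1 + of_int B * norm \<tau>"
      using A(2) c' by (intro add_mono) (auto simp: norm_mult intro!: mult_right_mono)
    finally have "\<bar>of_int (A$2$2)\<bar> \<le> 1 + of_int B * norm \<tau>" by simp
    then have "\<bar>A$2$2\<bar> \<le> C" unfolding C_def by linarith
    with c' A(1) show "x \<in> (\<lambda>(c, d). norm (of_int c * \<tau> + of_int d)) ` ({-B..B} \<times> {-C..C})"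
      by (auto simp: denom_def intro!: rev_image_eqI[of "(A$2$1, A$2$2)"])
  qed
  then have fin: "finite ((\<lambda>A. norm (denom A \<tau>)) ` D)"
    by (rule finite_subset) simp
  have "mat 1 \<in> D" by (simp add: D_def SL2Z_1 moebius_simps)
  then have ne: "(\<lambda>A. norm (denom A \<tau>)) ` D \<noteq> {}" by blast
  from Min_in[OF fin ne] obtain A where A: "A \<in> D" "norm (denom A \<tau>) = Min ((\<lambda>A. norm (denom A \<tau>)) ` D)"
    by auto
  have min: "norm (denom A \<tau>) \<le> norm (denom A' \<tau>)" if "A' \<in> SL2Z" for A'
  proof (cases "norm (denom A' \<tau>) \<le> 1")
    case True
    then show ?thesis unfolding A(2) using that fin by (intro Min_le) (auto simp: D_def)
  qed (use A(1) in \<open>auto simp: D_def\<close>)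
  have AS: "A \<in> SL2Z" using A(1) by (simp add: D_def)
  have dA: "norm (denom A \<tau>) > 0" using denom_nonzero[OF AS assms] by simp
  define \<sigma> where "\<sigma> = moebius_map A \<tau>"
  define k where "k = - round (Re \<sigma>)"
  define A' where "A' = T_mat k ** A"
  have A': "A' \<in> SL2Z" unfolding A'_def by (intro SL2Z_mult T_S_inv2_SL2Z AS)
  have \<sigma>: "\<sigma> \<in> uhp" unfolding \<sigma>_def by (rule moebius_in_uhp[OF AS assms])
  have m: "moebius_map A' \<tau> = \<sigma> + of_int k"
    unfolding A'_def \<sigma>_def moebius_mult[OF T_S_inv2_SL2Z(1) AS assms] moebius_simps ..
  have dA': "denom A' \<tau> = denom A \<tau>"
    unfolding A'_def denom_mult[OF AS assms] moebius_simps by simp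
  have "denom (S_mat ** A') \<tau> = (\<sigma> + of_int k) * denom A \<tau>"
    unfolding denom_mult[OF A' assms] moebius_simps m dA' ..
  with min[OF SL2Z_mult[OF T_S_inv2_SL2Z(2) A']] have "norm (denom A \<tau>) \<le> norm (\<sigma> + of_int k) * norm (denom A \<tau>)"
    by (simp add: norm_mult)
  then have "1 \<le> norm (\<sigma> + of_int k)" using dA by simp
  then have "1 \<le> (norm (\<sigma> + of_int k))\<^sup>2" by (simp add: one_le_power)
  also have "\<dots> = (Re \<sigma> + of_int k)\<^sup>2 + (Im \<sigma>)\<^sup>2" by (simp add: cmod_power2)
  also have "(Re \<sigma> + of_int k)\<^sup>2 \<le> (1 / 2)\<^sup>2"
  proof (rule abs_le_square_iff[THEN iffD1])
    show "\<bar>Re \<sigma> + of_int k\<bar> \<le> \<bar>1 / 2\<bar>"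
      using of_int_round_abs_le[of "Re \<sigma>"] by (simp add: k_def abs_minus_commute)
  qed
  finally have "(1 / 2)\<^sup>2 \<le> (Im \<sigma>)\<^sup>2" by (simp add: power2_eq_square)
  then have "1 / 2 \<le> Im \<sigma>"
    using abs_le_square_iff[of "1/2" "Im \<sigma>"] \<sigma> by (simp add: uhp_def)
  then show ?thesis using that[OF AS] by (simp add: \<sigma>_def)
qed

subsection \<open>The group \<open>\<Gamma>(5)\<close>\<close>

definition mat_cong :: "int^2^2 \<Rightarrow> int^2^2 \<Rightarrow> bool" where
  "mat_cong A B \<longleftrightarrow> (\<forall>i j. [A $ i $ j = B $ i $ j] (mod 5))"

abbreviation "\<Gamma>5 \<equiv> principal_congruence_subgroup 5"

lemma mat_cong_refl [simp]: "mat_cong A A"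
  by (simp add: mat_cong_def)

lemma mat_cong_sym: "mat_cong A B \<Longrightarrow> mat_cong B A"
  by (simp add: mat_cong_def cong_sym_eq)

lemma mat_cong_trans [trans]: "mat_cong A B \<Longrightarrow> mat_cong B C \<Longrightarrow> mat_cong A C"
  unfolding mat_cong_def using cong_trans by blast

lemma mat_cong_mult: "mat_cong A A' \<Longrightarrow> mat_cong B B' \<Longrightarrow> mat_cong (A ** B) (A' ** B')"
  unfolding mat_cong_def mat2_mult_nth by (intro allI cong_add cong_mult) auto

lemma Gamma5_iff: "A \<in> \<Gamma>5 \<longleftrightarrow> A \<in> SL2Z \<and> mat_cong A (mat 1)"
  by (simp add: principal_congruence_subgroup_def mat_cong_def)

lemma mat_cong_imp_Gamma5:
  assumes "A \<in> SL2Z" "B \<in> SL2Z" "mat_cong A B"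
  shows "A ** inv2 B \<in> \<Gamma>5"
  unfolding Gamma5_iff
proof
  show "A ** inv2 B \<in> SL2Z" by (intro SL2Z_mult assms T_S_inv2_SL2Z)
  show "mat_cong (A ** inv2 B) (mat 1)"
    using mat_cong_mult[OF assms(3) mat_cong_refl[of "inv2 B"]] inv2_mult(1)[OF assms(2)] by simp
qed

lemma finite_classes: "\<exists>F. finite F \<and> F \<subseteq> SL2Z \<and> (\<forall>A\<in>SL2Z. \<exists>B\<in>F. mat_cong A B)"
proof -
  define r where "r A = (\<lambda>i j. A $ i $ j mod 5)" for A :: "int^2^2"
  have "r ` SL2Z \<subseteq> (\<lambda>(a, b, c, d). \<lambda>i j. mat2 a b c d $ i $ j) ` ({0..<5} \<times> {0..<5} \<times> {0..<5} \<times> {0..<5})"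
  proof
    fix x assume "x \<in> r ` SL2Z"
    then obtain A where "x = r A" by blast
    then have "x = (\<lambda>(a, b, c, d). \<lambda>i j. mat2 a b c d $ i $ j) (A$1$1 mod 5, A$1$2 mod 5, A$2$1 mod 5, A$2$2 mod 5)"
      by (auto simp: r_def fun_eq_iff forall_2)
    then show "x \<in> (\<lambda>(a, b, c, d). \<lambda>i j. mat2 a b c d $ i $ j) ` ({0..<5} \<times> {0..<5} \<times> {0..<5} \<times> {0..<5})"
      by (rule image_eqI) auto
  qed
  then have "finite (r ` SL2Z)" by (rule finite_subset) simp
  then obtain F where F: "finite F" "F \<subseteq> SL2Z" "r ` F = r ` SL2Z"
    by (metis finite_subset_image subset_refl)
  have ex: "\<exists>B\<in>F. mat_cong A B" if "A \<in> SL2Z" for A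
  proof -
    have "r A \<in> r ` F" using F(3) that by blast
    then obtain B where "B \<in> F" "r A = r B" by blast
    then show ?thesis by (auto simp: r_def mat_cong_def cong_def fun_eq_iff)
  qed
  show ?thesis
    by (intro exI[of _ F] conjI F ballI ex)
qed


section \<open>Weight \<open>1/5\<close>\<close>

abbreviation h :: "complex \<Rightarrow> complex" where "h \<equiv> eta_pow (24/5)"

definition J15 :: "int^2^2 \<Rightarrow> complex \<Rightarrow> complex" where
  "J15 A \<tau> = denom A \<tau> ^ 5 * (h \<tau> / h (moebius_map A \<tau>))\<^sup>2"

lemma h_power5:
  assumes "\<tau> \<in> uhp"
  shows "h \<tau> ^ 5 = exp (24 * log_eta \<tau>)"
  unfolding eta_pow_eq[OF assms] by (simp flip: exp_of_nat_mult)

lemma Delta_moebius: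
  assumes "A \<in> SL2Z" "\<tau> \<in> uhp"
  shows "h (moebius_map A \<tau>) ^ 5 = denom A \<tau> ^ 12 * h \<tau> ^ 5"
  using assms
proof (induction A arbitrary: \<tau> rule: SL2Z_induct)
  case one
  then show ?case by (simp add: moebius_simps)
next
  case (translate A k)
  have \<tau>: "\<tau> + of_int k \<in> uhp" using translate(3) by (simp add: uhp_def)
  have "exp (24 * log_eta (\<tau> + of_int k)) = exp (24 * log_eta \<tau>)"
  proof -
    have "24 * log_eta (\<tau> + of_int k) = 24 * log_eta \<tau> + \<i> * (of_int k * (of_real pi * 2))"
      by (simp add: log_eta_translate algebra_simps)
    then show ?thesis by (simp only: exp_plus_2pin)
  qed
  then have "h (\<tau> + of_int k) ^ 5 = h \<tau> ^ 5"
    using \<tau> translate(3) by (simp add: h_power5)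
  then show ?case
    using translate.IH[OF \<tau>] translate.hyps translate.prems
    by (simp add: moebius_mult T_S_inv2_SL2Z denom_mult moebius_simps)
next
  case (invert A)
  have \<tau>: "- 1 / \<tau> \<in> uhp" using inversion_in_uhp[OF invert(3)] .
  have "exp (24 * log_eta (- 1 / \<tau>)) = exp (24 * log_eta \<tau>) * exp (12 * Ln (- \<i> * \<tau>))"
    unfolding log_eta_inversion[OF invert(3)] exp_add[symmetric]
    by (rule arg_cong[of _ _ exp]) simp
  also have "exp (12 * Ln (- \<i> * \<tau>)) = (- \<i> * \<tau>) ^ 12"
    using uhp_nonzero[OF invert(3)] exp_of_nat_mult[of 12 "Ln (- \<i> * \<tau>)"] by simp
  also have "\<dots> = \<tau> ^ 12"
  proof -
    have "(- \<i>) ^ 12 = ((- \<i>) ^ 4) ^ 3" by (simp only: power_mult[symmetric]) simp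
    also have "(- \<i>) ^ 4 = 1" by (simp add: power4_eq_xxxx)
    finally show ?thesis by (simp only: power_mult_distrib) simp
  qed
  finally have "h (- 1 / \<tau>) ^ 5 = \<tau> ^ 12 * h \<tau> ^ 5"
    unfolding h_power5[OF \<tau>] h_power5[OF invert(3)] by simp
  then show ?case
    using invert.IH[OF \<tau>] invert.hyps invert.prems
    by (simp add: moebius_mult T_S_inv2_SL2Z denom_mult moebius_simps power_mult_distrib)
qed

lemma J15_nonzero: "A \<in> SL2Z \<Longrightarrow> \<tau> \<in> uhp \<Longrightarrow> J15 A \<tau> \<noteq> 0"
  by (simp add: J15_def denom_nonzero eta_pow_nonzero moebius_in_uhp)

lemma J15_1 [simp]: "\<tau> \<in> uhp \<Longrightarrow> J15 (mat 1) \<tau> = 1"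
  by (simp add: J15_def moebius_simps eta_pow_nonzero)

lemma J15_mult:
  assumes "A \<in> SL2Z" "B \<in> SL2Z" "\<tau> \<in> uhp"
  shows "J15 (A ** B) \<tau> = J15 A (moebius_map B \<tau>) * J15 B \<tau>"
  using eta_pow_nonzero[OF moebius_in_uhp[OF assms(2,3)], of "24/5"]
  by (simp add: J15_def moebius_mult[OF assms] denom_mult[OF assms(2,3)] power_mult_distrib power_divide)

lemma norm_J15:
  assumes "A \<in> SL2Z" "\<tau> \<in> uhp"
  shows "norm (J15 A \<tau>) = norm (denom A \<tau>) powr (1/5)"
proof -
  have d: "norm (denom A \<tau>) > 0" using denom_nonzero[OF assms] by simp
  have "J15 A \<tau> ^ 5 = denom A \<tau> ^ 25 * (h \<tau> ^ 5)\<^sup>2 / (h (moebius_map A \<tau>) ^ 5)\<^sup>2"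
    by (simp add: J15_def power_mult_distrib power_divide flip: power_mult)
  also have "\<dots> = denom A \<tau>"
    unfolding Delta_moebius[OF assms] using eta_pow_nonzero[OF assms(2), of "24/5"] denom_nonzero[OF assms]
    by (simp add: power_mult_distrib divide_simps flip: power_mult power_add) (simp add: eval_nat_numeral)
  finally have "norm (J15 A \<tau>) ^ 5 = norm (denom A \<tau>)"
    by (metis norm_power)
  moreover have "(norm (denom A \<tau>) powr (1/5)) ^ 5 = norm (denom A \<tau>)"
    using d by (simp add: powr_realpow[symmetric] powr_powr)
  ultimately show ?thesis
    using power_eq_imp_eq_base[of "norm (J15 A \<tau>)" 5 "norm (denom A \<tau>) powr (1/5)"] by simp
qed

definition slash :: "nat \<Rightarrow> (complex \<Rightarrow> complex) \<Rightarrow> int^2^2 \<Rightarrow> complex \<Rightarrow> complex" where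
  "slash k f A \<tau> = f (moebius_map A \<tau>) / J15 A \<tau> ^ k"

lemma slash_mult_matrix:
  assumes "A \<in> SL2Z" "B \<in> SL2Z" "\<tau> \<in> uhp"
  shows "slash k f (A ** B) \<tau> = slash k f A (moebius_map B \<tau>) / J15 B \<tau> ^ k"
  by (simp add: slash_def moebius_mult[OF assms] J15_mult[OF assms] power_mult_distrib)

lemma abs_slash_eq:
  assumes "A \<in> SL2Z" "\<tau> \<in> uhp"
  shows "abs_slash k f A \<tau> = norm (slash k f A \<tau>)"
proof -
  have "norm (denom A \<tau>) > 0" using denom_nonzero[OF assms] by simp
  then have "(norm (denom A \<tau>) powr (1/5)) ^ k = norm (denom A \<tau>) powr (real k / 5)"
    by (simp add: powr_realpow[symmetric] powr_powr)
  then show ?thesis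
    unfolding abs_slash_def slash_def norm_divide norm_power norm_J15[OF assms] powr_minus
    by (simp only: divide_inverse mult.commute)
qed

lemma invariant_iff_slash:
  "invariant_of_weight k f \<longleftrightarrow> (\<forall>A\<in>\<Gamma>5. \<forall>\<tau>\<in>uhp. slash k f A \<tau> = f \<tau>)"
proof -
  have "(\<forall>m n::int. 12 * m + 5 * n = int k \<longrightarrow> f (moebius_map A \<tau>) = J_12_5 A \<tau> powi m * denom A \<tau> powi n * f \<tau>)
     \<longleftrightarrow> slash k f A \<tau> = f \<tau>" if A: "A \<in> \<Gamma>5" and \<tau>: "\<tau> \<in> uhp" for A \<tau>
  proof -
    have AS: "A \<in> SL2Z" using A by (simp add: Gamma5_iff)
    let ?J = "J_12_5 A \<tau>" and ?d = "denom A \<tau>"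
    have nz: "h \<tau> \<noteq> 0" "h (moebius_map A \<tau>) \<noteq> 0" "?d \<noteq> 0" "?J \<noteq> 0"
      using eta_pow_nonzero \<tau> moebius_in_uhp[OF AS \<tau>] denom_nonzero[OF AS \<tau>] by (auto simp: J_12_5_def)
    have "J15 A \<tau> = ?d ^ 5 * ?J powi (-2)"
      by (simp add: J15_def J_12_5_def power_int_minus power_divide)
    then have Jk: "J15 A \<tau> ^ k = ?J powi (- 2 * int k) * ?d powi (5 * int k)"
      using power_int_mult[of ?J "-2" "int k"] power_int_mult[of ?d 5 "int k"]
      by (simp add: power_mult_distrib)
    have J5: "?J ^ 5 = ?d ^ 12"
      using Delta_moebius[OF AS \<tau>] nz by (simp add: J_12_5_def power_divide)
    have all: "?J powi m * ?d powi n = J15 A \<tau> ^ k" if mn: "12 * m + 5 * n = int k" for m n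
    proof -
      have "5 dvd 12 * (m + 2 * int k)"
      proof -
        have "12 * (m + 2 * int k) = 5 * (5 * int k - n)" using mn by simp
        then show ?thesis by simp
      qed
      then have "5 dvd m + 2 * int k" by presburger
      then obtain s where s: "m + 2 * int k = 5 * s" by (elim dvdE)
      have m: "m = - 2 * int k + 5 * s" and n: "n = 5 * int k - 12 * s" using s mn by auto
      have "?J powi m * ?d powi n = ?J powi (- 2 * int k) * ?d powi (5 * int k) * (?J powi (5 * s) / ?d powi (12 * s))"
        unfolding m n power_int_add[OF disjI1[OF nz(4)]] power_int_diff[OF disjI1[OF nz(3)]] by simp
      also have "?J powi (5 * s) / ?d powi (12 * s) = 1"
        using power_int_mult[of ?J 5 s] power_int_mult[of ?d 12 s] J5 nz by simp
      finally show ?thesis unfolding Jk by simp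
    qed
    have eq: "slash k f A \<tau> = f \<tau> \<longleftrightarrow> f (moebius_map A \<tau>) = J15 A \<tau> ^ k * f \<tau>"
      using J15_nonzero[OF AS \<tau>] by (auto simp: slash_def field_simps)
    show ?thesis
      unfolding eq
    proof
      assume *: "\<forall>m n::int. 12 * m + 5 * n = int k \<longrightarrow> f (moebius_map A \<tau>) = ?J powi m * ?d powi n * f \<tau>"
      have "12 * (- 2 * int k) + 5 * (5 * int k) = int k" by simp
      from *[rule_format, OF this] all[OF this] show "f (moebius_map A \<tau>) = J15 A \<tau> ^ k * f \<tau>" by simp
    next
      assume *: "f (moebius_map A \<tau>) = J15 A \<tau> ^ k * f \<tau>"
      show "\<forall>m n::int. 12 * m + 5 * n = int k \<longrightarrow> f (moebius_map A \<tau>) = ?J powi m * ?d powi n * f \<tau>"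
        using all * by auto
    qed
  qed
  then show ?thesis unfolding invariant_of_weight_def by blast
qed

lemma slash_cong_class:
  assumes inv: "invariant_of_weight k f" and AB: "A \<in> SL2Z" "B \<in> SL2Z" "mat_cong A B" and \<tau>: "\<tau> \<in> uhp"
  shows "slash k f A \<tau> = slash k f B \<tau>"
proof -
  define C where "C = A ** inv2 B"
  have C: "C \<in> \<Gamma>5" "C \<in> SL2Z" using mat_cong_imp_Gamma5[OF AB] by (auto simp: C_def Gamma5_iff)
  have "A = C ** B"
    by (simp add: C_def matrix_mul_assoc[symmetric] inv2_mult(2)[OF AB(2)])
  then have "slash k f A \<tau> = slash k f C (moebius_map B \<tau>) / J15 B \<tau> ^ k"
    using slash_mult_matrix[OF C(2) AB(2) \<tau>] by simp
  also have "slash k f C (moebius_map B \<tau>) = f (moebius_map B \<tau>)"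
    using inv C(1) moebius_in_uhp[OF AB(2) \<tau>] by (auto simp: invariant_iff_slash)
  finally show ?thesis by (simp add: slash_def)
qed

lemma J15_T:
  assumes "\<tau> \<in> uhp"
  shows "J15 (T_mat k) \<tau> = cis (- (4 * pi * of_int k / 5))"
proof -
  have \<tau>: "\<tau> + of_int k \<in> uhp" using assms by (simp add: uhp_def)
  have "h (\<tau> + of_int k) = h \<tau> * cis (2 * pi * of_int k / 5)"
    unfolding eta_pow_eq[OF \<tau>] eta_pow_eq[OF assms] log_eta_translate cis_conv_exp exp_add[symmetric]
    by (rule arg_cong[of _ _ exp]) (simp add: field_simps)
  then have "h \<tau> / h (\<tau> + of_int k) = cis (- (2 * pi * of_int k / 5))"
    using eta_pow_nonzero[OF assms, of "24/5"] by (simp add: cis_divide[symmetric] cis_inverse[symmetric] field_simps)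
  then have "J15 (T_mat k) \<tau> = cis (- (2 * pi * of_int k / 5)) ^ 2"
    by (simp only: J15_def moebius_simps power_one mult_1)
  also have "\<dots> = cis (- (4 * pi * of_int k / 5))"
    unfolding Complex.DeMoivre by (rule arg_cong[of _ _ cis]) simp
  finally show ?thesis .
qed

lemma J15_S:
  assumes "\<tau> \<in> uhp"
  shows "J15 S_mat \<tau> = \<i> * exp (Ln (- \<i> * \<tau>) / 5)"
proof -
  define w where "w = Ln (- \<i> * \<tau>)"
  have \<tau>: "- 1 / \<tau> \<in> uhp" by (rule inversion_in_uhp[OF assms])
  have ew: "exp w = - \<i> * \<tau>" using uhp_nonzero[OF assms] by (simp add: w_def)
  have "h \<tau> / h (- 1 / \<tau>) = exp (- (12 / 5 * w))"
    unfolding eta_pow_eq[OF \<tau>] eta_pow_eq[OF assms] log_eta_inversion[OF assms] w_def[symmetric] exp_diff[symmetric]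
    by (rule arg_cong[of _ _ exp]) (simp add: field_simps)
  moreover have "\<tau> = \<i> * exp w" unfolding ew by simp
  then have "\<tau> ^ 5 = \<i> * exp (5 * w)"
  proof -
    have "\<i> ^ 5 = \<i>" by (simp add: eval_nat_numeral)
    moreover have "exp (5 * w) = exp w ^ 5" using exp_of_nat_mult[of 5 w] by simp
    ultimately show ?thesis
      using \<open>\<tau> = \<i> * exp w\<close> by (simp only: power_mult_distrib)
  qed
  ultimately have "J15 S_mat \<tau> = \<i> * exp (5 * w) * exp (- (12 / 5 * w)) ^ 2"
    by (simp add: J15_def moebius_simps)
  also have "\<dots> = \<i> * exp (w / 5)"
    by (simp add: mult.assoc flip: exp_of_nat_mult exp_add)
  finally show ?thesis by (simp add: w_def)
qed

subsection \<open>The action on \<open>f\<^sub>5\<^sub>,\<^sub>1\<close> and \<open>f\<^sub>5\<^sub>,\<^sub>3\<close>\<close>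

lemma f5_eq:
  assumes "\<tau> \<in> uhp"
  shows "f5 r \<tau> = exp (- 3 / 5 * log_eta \<tau>) * theta 5 (int r) \<tau>"
proof -
  have "q_pow (of_int 5 / 2 * (of_int p + of_int (int r) / (2 * of_int 5))\<^sup>2) \<tau> =
      q_pow (real (r^2) / 40) \<tau> * q_pow (real_of_int (5 * p^2 + int r * p) / 2) \<tau>" for p
    unfolding q_pow_add[symmetric] by (rule arg_cong[of _ _ "\<lambda>x. q_pow x \<tau>"]) (simp add: power2_eq_square field_simps)
  then have "theta 5 (int r) \<tau> = (\<Sum>\<^sub>\<infinity>p::int. q_pow (real (r^2) / 40) \<tau> * ((-1) powi p * q_pow (real_of_int (5 * p^2 + int r * p) / 2) \<tau>))"
    unfolding theta_def by (intro infsum_cong) (simp only: mult.left_commute)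
  also have "\<dots> = q_pow (real (r^2) / 40) \<tau> *
     (\<Sum>\<^sub>\<infinity>p::int. (-1) powi p * q_pow (real_of_int (5 * p^2 + int r * p) / 2) \<tau>)"
    by (rule infsum_cmult_right')
  finally have "theta 5 (int r) \<tau> = q_pow (real (r^2) / 40) \<tau> *
     (\<Sum>\<^sub>\<infinity>p::int. (-1) powi p * q_pow (real_of_int (5 * p^2 + int r * p) / 2) \<tau>)" .
  then show ?thesis
    by (simp add: f5_def eta_pow_eq[OF assms] mult.assoc)
qed

abbreviation f1 :: "complex \<Rightarrow> complex" where "f1 \<equiv> f5 1"
abbreviation f3 :: "complex \<Rightarrow> complex" where "f3 \<equiv> f5 3"

lemma f13_eq:
  assumes "\<tau> \<in> uhp"
  shows "f1 \<tau> = exp (- 3 / 5 * log_eta \<tau>) * theta 5 1 \<tau>" "f3 \<tau> = exp (- 3 / 5 * log_eta \<tau>) * theta 5 3 \<tau>"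
  using f5_eq[OF assms, of 1] f5_eq[OF assms, of 3] by (simp_all only: of_nat_1 of_nat_numeral)

definition acts :: "int^2^2 \<Rightarrow> complex^2^2 \<Rightarrow> bool" where
  "acts A R \<longleftrightarrow> A \<in> SL2Z \<and> (\<forall>\<tau>\<in>uhp.
     slash 1 f1 A \<tau> = R$1$1 * f1 \<tau> + R$1$2 * f3 \<tau> \<and>
     slash 1 f3 A \<tau> = R$2$1 * f1 \<tau> + R$2$2 * f3 \<tau>)"

definition \<zeta> :: complex where "\<zeta> = cis (2 * pi / 5)"

definition rep_T :: "int \<Rightarrow> complex^2^2" where
  "rep_T k = mat2 (\<zeta> powi (2 * k)) 0 0 (\<zeta> powi (3 * k))"

definition rep_S :: "complex^2^2" where
  "rep_S = mat2 (- \<i> * of_real cS) (- \<i> * of_real cS') (- \<i> * of_real cS') (\<i> * of_real cS)"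

lemma acts_1: "acts (mat 1) (mat 1)"
  by (simp add: acts_def SL2Z_1 slash_def moebius_simps)

lemma acts_T: "acts (T_mat k) (rep_T k)"
  unfolding acts_def
proof (intro conjI ballI T_S_inv2_SL2Z)
  fix \<tau> assume \<tau>: "\<tau> \<in> uhp"
  have \<tau>': "\<tau> + of_int k \<in> uhp" using \<tau> by (simp add: uhp_def)
  have e: "exp (- 3 / 5 * log_eta (\<tau> + of_int k)) = exp (- 3 / 5 * log_eta \<tau>) * cis (- (pi * of_int k / 20))"
    unfolding log_eta_translate cis_conv_exp exp_add[symmetric]
    by (rule arg_cong[of _ _ exp]) (simp add: field_simps)
  have t1: "theta 5 1 (\<tau> + of_int k) = cis (pi * of_int k / 20) * theta 5 1 \<tau>"
    using q_pow_translate[of "1/40" \<tau> "of_int k"] unfolding theta51.theta_eq_q by (simp add: field_simps)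
  have t3: "theta 5 3 (\<tau> + of_int k) = cis (9 * pi * of_int k / 20) * theta 5 3 \<tau>"
    using q_pow_translate[of "9/40" \<tau> "of_int k"] unfolding theta53.theta_eq_q by (simp add: field_simps)
  have j: "inverse (J15 (T_mat k) \<tau>) = cis (4 * pi * of_int k / 5)"
    unfolding J15_T[OF \<tau>] by (simp add: cis_inverse)
  have z: "\<zeta> powi m = cis (2 * pi * of_int m / 5)" for m
    unfolding \<zeta>_def cis_power_int by (simp add: mult.commute)
  have "slash 1 f1 (T_mat k) \<tau> = cis (- (pi * of_int k / 20)) * cis (pi * of_int k / 20) * cis (4 * pi * of_int k / 5) * f1 \<tau>"
    unfolding slash_def moebius_simps power_one_right divide_inverse j[unfolded divide_inverse] f13_eq[OF \<tau>] f13_eq[OF \<tau>'] e[unfolded divide_inverse] t1[unfolded divide_inverse]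
    by (simp only: mult_ac)
  also have "cis (- (pi * of_int k / 20)) * cis (pi * of_int k / 20) * cis (4 * pi * of_int k / 5) = \<zeta> powi (2 * k)"
    unfolding z cis_mult by (rule arg_cong[of _ _ cis]) (simp add: field_simps)
  finally show "slash 1 f1 (T_mat k) \<tau> = rep_T k $ 1 $ 1 * f1 \<tau> + rep_T k $ 1 $ 2 * f3 \<tau>"
    by (simp add: rep_T_def)
  have "slash 1 f3 (T_mat k) \<tau> = cis (- (pi * of_int k / 20)) * cis (9 * pi * of_int k / 20) * cis (4 * pi * of_int k / 5) * f3 \<tau>"
    unfolding slash_def moebius_simps power_one_right divide_inverse j[unfolded divide_inverse] f13_eq[OF \<tau>] f13_eq[OF \<tau>'] e[unfolded divide_inverse] t3[unfolded divide_inverse]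
    by (simp only: mult_ac)
  also have "cis (- (pi * of_int k / 20)) * cis (9 * pi * of_int k / 20) * cis (4 * pi * of_int k / 5) = \<zeta> powi (3 * k)"
    unfolding z cis_mult by (rule arg_cong[of _ _ cis]) (simp add: field_simps)
  finally show "slash 1 f3 (T_mat k) \<tau> = rep_T k $ 2 $ 1 * f1 \<tau> + rep_T k $ 2 $ 2 * f3 \<tau>"
    by (simp add: rep_T_def)
qed

lemma f5_inversion:
  assumes "\<tau> \<in> uhp"
  shows "f1 (- 1 / \<tau>) = exp (Ln (- \<i> * \<tau>) / 5) * (of_real cS * f1 \<tau> + of_real cS' * f3 \<tau>)"
    and "f3 (- 1 / \<tau>) = exp (Ln (- \<i> * \<tau>) / 5) * (of_real cS' * f1 \<tau> - of_real cS * f3 \<tau>)"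
proof -
  have e: "exp (- 3 / 5 * log_eta (- 1 / \<tau>)) * csqrt_tau \<tau> = exp (- 3 / 5 * log_eta \<tau>) * exp (Ln (- \<i> * \<tau>) / 5)"
    unfolding log_eta_inversion[OF assms] csqrt_tau_def exp_add[symmetric]
    by (rule arg_cong[of _ _ exp]) (simp add: field_simps)
  have dist: "E * (x * A + y * B) = x * (E * A) + y * (E * B)" "E * (x * A - y * B) = x * (E * A) - y * (E * B)" for E x y A B :: complex
    by (simp_all add: algebra_simps)
  have "f1 (- 1 / \<tau>) = exp (- 3 / 5 * log_eta (- 1 / \<tau>)) * csqrt_tau \<tau> * (of_real cS * theta 5 1 \<tau> + of_real cS' * theta 5 3 \<tau>)"
    by (simp only: f13_eq(1)[OF inversion_in_uhp[OF assms]] theta5_inversion[OF assms] mult.assoc)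
  then show "f1 (- 1 / \<tau>) = exp (Ln (- \<i> * \<tau>) / 5) * (of_real cS * f1 \<tau> + of_real cS' * f3 \<tau>)"
    unfolding e f13_eq[OF assms] dist by (simp only: mult_ac)
  have "f3 (- 1 / \<tau>) = exp (- 3 / 5 * log_eta (- 1 / \<tau>)) * csqrt_tau \<tau> * (of_real cS' * theta 5 1 \<tau> - of_real cS * theta 5 3 \<tau>)"
    by (simp only: f13_eq(2)[OF inversion_in_uhp[OF assms]] theta5_inversion[OF assms] mult.assoc)
  then show "f3 (- 1 / \<tau>) = exp (Ln (- \<i> * \<tau>) / 5) * (of_real cS' * f1 \<tau> - of_real cS * f3 \<tau>)"
    unfolding e f13_eq[OF assms] dist by (simp only: mult_ac)
qed

lemma acts_S: "acts S_mat rep_S"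
  unfolding acts_def
proof (intro conjI ballI T_S_inv2_SL2Z)
  fix \<tau> assume \<tau>: "\<tau> \<in> uhp"
  have i: "(E * X) / (\<i> * E) = - \<i> * X" if "E \<noteq> 0" for E X :: complex
    using that by (simp add: field_simps)
  show "slash 1 f1 S_mat \<tau> = rep_S $ 1 $ 1 * f1 \<tau> + rep_S $ 1 $ 2 * f3 \<tau>"
    unfolding slash_def moebius_simps power_one_right J15_S[OF \<tau>] f5_inversion[OF \<tau>] i[OF exp_not_eq_zero]
    by (simp add: rep_S_def algebra_simps)
  show "slash 1 f3 S_mat \<tau> = rep_S $ 2 $ 1 * f1 \<tau> + rep_S $ 2 $ 2 * f3 \<tau>"
    unfolding slash_def moebius_simps power_one_right J15_S[OF \<tau>] f5_inversion[OF \<tau>] i[OF exp_not_eq_zero]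
    by (simp add: rep_S_def algebra_simps)
qed

lemma acts_mult:
  assumes "acts A R" "acts B R'"
  shows "acts (A ** B) (R ** R')"
proof -
  have AB: "A \<in> SL2Z" "B \<in> SL2Z" using assms by (auto simp: acts_def)
  show ?thesis
    unfolding acts_def
  proof (intro conjI ballI SL2Z_mult AB)
    fix \<tau> assume \<tau>: "\<tau> \<in> uhp"
    have B\<tau>: "moebius_map B \<tau> \<in> uhp" by (rule moebius_in_uhp[OF AB(2) \<tau>])
    have lin: "(x * f1 (moebius_map B \<tau>) + y * f3 (moebius_map B \<tau>)) / J15 B \<tau> ^ 1 = x * slash 1 f1 B \<tau> + y * slash 1 f3 B \<tau>" for x y
      by (simp add: slash_def add_divide_distrib)
    have A: "slash 1 f1 A (moebius_map B \<tau>) = R$1$1 * f1 (moebius_map B \<tau>) + R$1$2 * f3 (moebius_map B \<tau>)"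
      "slash 1 f3 A (moebius_map B \<tau>) = R$2$1 * f1 (moebius_map B \<tau>) + R$2$2 * f3 (moebius_map B \<tau>)"
      using assms(1) B\<tau> by (auto simp: acts_def)
    have B: "slash 1 f1 B \<tau> = R'$1$1 * f1 \<tau> + R'$1$2 * f3 \<tau>" "slash 1 f3 B \<tau> = R'$2$1 * f1 \<tau> + R'$2$2 * f3 \<tau>"
      using assms(2) \<tau> by (auto simp: acts_def)
    show "slash 1 f1 (A ** B) \<tau> = (R ** R') $ 1 $ 1 * f1 \<tau> + (R ** R') $ 1 $ 2 * f3 \<tau>"
      unfolding slash_mult_matrix[OF AB \<tau>] A lin B mat2_mult_nth by (simp add: algebra_simps)
    show "slash 1 f3 (A ** B) \<tau> = (R ** R') $ 2 $ 1 * f1 \<tau> + (R ** R') $ 2 $ 2 * f3 \<tau>"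
      unfolding slash_mult_matrix[OF AB \<tau>] A lin B mat2_mult_nth by (simp add: algebra_simps)
  qed
qed


subsection \<open>The action factors through \<open>SL\<^sub>2(\<int>/5\<int>)\<close>\<close>

lemma zeta_cyclotomic: "1 + \<zeta> + \<zeta>^2 + \<zeta>^3 + \<zeta>^4 = 0" and zeta_power5: "\<zeta>^5 = 1" and zeta_nonzero [simp]: "\<zeta> \<noteq> 0"
proof -
  show p5: "\<zeta>^5 = 1"
    by (simp add: \<zeta>_def Complex.DeMoivre)
  show "\<zeta> \<noteq> 0" by (simp add: \<zeta>_def)
  have "\<zeta> \<noteq> 1"
  proof
    assume "\<zeta> = 1"
    then have "cos (2 * pi / 5) = 1" by (simp add: \<zeta>_def complex_eq_iff)
    moreover have "cos (2 * pi / 5) < cos 0"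
      by (rule cos_monotone_0_pi) auto
    ultimately show False by simp
  qed
  moreover have "(1 + \<zeta> + \<zeta>^2 + \<zeta>^3 + \<zeta>^4) * (\<zeta> - 1) = \<zeta>^5 - 1"
    by (simp add: algebra_simps eval_nat_numeral)
  ultimately show "1 + \<zeta> + \<zeta>^2 + \<zeta>^3 + \<zeta>^4 = 0"
    by (simp add: p5)
qed

lemma zeta_powi: "\<zeta> powi m = \<zeta> ^ nat (m mod 5)"
proof -
  have "\<zeta> powi m = \<zeta> powi (5 * (m div 5) + m mod 5)" by simp
  also have "\<dots> = (\<zeta> powi 5) powi (m div 5) * \<zeta> powi (m mod 5)"
    by (simp only: power_int_add[OF disjI1[OF zeta_nonzero]] power_int_mult)
  also have "\<zeta> powi 5 = 1" using zeta_power5 by simp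
  also have "\<zeta> powi (m mod 5) = \<zeta> ^ nat (m mod 5)"
    by (rule power_int_nonneg_exp) simp
  finally show ?thesis by simp
qed

lemma zeta_powers_cis:
  "\<zeta>^4 = cis (- (2 * pi / 5))" "\<zeta>^3 = cis (- (4 * pi / 5))" "\<zeta>^2 = cis (4 * pi / 5)"
proof -
  have z: "\<zeta> ^ n = cis (real n * (2 * pi / 5))" for n
    by (simp add: \<zeta>_def Complex.DeMoivre)
  have period: "cis (x + 2 * pi) = cis x" for x by (simp add: complex_eq_iff)
  show "\<zeta>^4 = cis (- (2 * pi / 5))" unfolding z period[of "- (2 * pi / 5)", symmetric] by (rule arg_cong[of _ _ cis]) simp
  show "\<zeta>^3 = cis (- (4 * pi / 5))" unfolding z period[of "- (4 * pi / 5)", symmetric] by (rule arg_cong[of _ _ cis]) simp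
  show "\<zeta>^2 = cis (4 * pi / 5)" unfolding z by (rule arg_cong[of _ _ cis]) simp
qed

lemma sqrt5_zeta: "complex_of_real (sqrt 5) = 2 * (\<zeta> + \<zeta>^4) + 1"
proof -
  define w where "w = 2 * (\<zeta> + \<zeta>^4) + 1"
  have w_real: "w = of_real (4 * cos (2 * pi / 5) + 1)"
    unfolding w_def zeta_powers_cis by (simp add: \<zeta>_def complex_eq_iff)
  have w2: "w^2 = 5"
    unfolding w_def using zeta_cyclotomic by algebra
  have "4 * cos (2 * pi / 5) + 1 = sqrt 5"
  proof (rule real_sqrt_unique[symmetric])
    show "(4 * cos (2 * pi / 5) + 1)\<^sup>2 = 5"
      using w2 unfolding w_real of_real_power[symmetric] by (metis of_real_eq_iff of_real_numeral)
    show "0 \<le> 4 * cos (2 * pi / 5) + 1"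
      using cos_gt_zero_pi[of "2 * pi / 5"] by simp
  qed
  then show ?thesis using w_real by (simp add: w_def)
qed

lemma cS_zeta:
  "- \<i> * of_real cS = - (\<zeta> + 2 * \<zeta>^2 - 2 * \<zeta>^3 - \<zeta>^4) / 5"
  "- \<i> * of_real cS' = - (2 * \<zeta> - \<zeta>^2 + \<zeta>^3 - 2 * \<zeta>^4) / 5"
proof -
  define w where "w = 2 * (\<zeta> + \<zeta>^4) + 1"
  have w: "complex_of_real (sqrt 5) = w" by (simp only: w_def sqrt5_zeta)
  have w2: "w^2 = 5"
    unfolding w_def using zeta_cyclotomic by algebra
  have w0: "w \<noteq> 0" using w2 by auto
  have s1: "complex_of_real (cos (pi / 10)) = (\<zeta> - \<zeta>^4) / (2 * \<i>)"
  proof -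
    have "cos (pi / 10) = sin (pi / 2 - pi / 10)" using cos_sin_eq[of "pi / 10"] by simp
    also have "pi / 2 - pi / 10 = 2 * pi / 5" by simp
    finally show ?thesis unfolding zeta_powers_cis by (simp add: \<zeta>_def complex_eq_iff Re_divide Im_divide)
  qed
  have s2: "complex_of_real (cos (3 * pi / 10)) = (\<zeta>^2 - \<zeta>^3) / (2 * \<i>)"
  proof -
    have "cos (3 * pi / 10) = sin (pi / 2 - 3 * pi / 10)" using cos_sin_eq[of "3 * pi / 10"] by simp
    also have "pi / 2 - 3 * pi / 10 = pi - 4 * pi / 5" by simp
    also have "sin (pi - 4 * pi / 5) = sin (4 * pi / 5)" by (rule sin_pi_minus)
    finally show ?thesis unfolding zeta_powers_cis by (simp add: complex_eq_iff Re_divide Im_divide)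
  qed
  have "- \<i> * of_real cS = - (\<zeta> - \<zeta>^4) / w"
    unfolding cS_def of_real_mult of_real_divide s1 w using w0 by (simp add: field_simps)
  also have "\<dots> = - (\<zeta> - \<zeta>^4) * w / w^2"
    using w0 by (simp add: power2_eq_square)
  also have "- (\<zeta> - \<zeta>^4) * w = - (\<zeta> + 2 * \<zeta>^2 - 2 * \<zeta>^3 - \<zeta>^4)"
    unfolding w_def using zeta_cyclotomic by algebra
  finally show "- \<i> * of_real cS = - (\<zeta> + 2 * \<zeta>^2 - 2 * \<zeta>^3 - \<zeta>^4) / 5" unfolding w2 .
  have "- \<i> * of_real cS' = - (\<zeta>^2 - \<zeta>^3) / w"
    unfolding cS'_def of_real_mult of_real_divide s2 w using w0 by (simp add: field_simps)
  also have "\<dots> = - (\<zeta>^2 - \<zeta>^3) * w / w^2"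
    using w0 by (simp add: power2_eq_square)
  also have "- (\<zeta>^2 - \<zeta>^3) * w = - (2 * \<zeta> - \<zeta>^2 + \<zeta>^3 - 2 * \<zeta>^4)"
    unfolding w_def using zeta_cyclotomic by algebra
  finally show "- \<i> * of_real cS' = - (2 * \<zeta> - \<zeta>^2 + \<zeta>^3 - 2 * \<zeta>^4) / 5" unfolding w2 .
qed

lemma cS_nonzero: "cS \<noteq> 0" "cS' \<noteq> 0"
  using cos_gt_zero_pi[of "pi / 10"] cos_gt_zero_pi[of "3 * pi / 10"] by (simp_all add: cS_def cS'_def)

lemma rep_S_zeta:
  "rep_S = mat2 (- (\<zeta> + 2 * \<zeta>^2 - 2 * \<zeta>^3 - \<zeta>^4) / 5) (- (2 * \<zeta> - \<zeta>^2 + \<zeta>^3 - 2 * \<zeta>^4) / 5)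
     (- (2 * \<zeta> - \<zeta>^2 + \<zeta>^3 - 2 * \<zeta>^4) / 5) ((\<zeta> + 2 * \<zeta>^2 - 2 * \<zeta>^3 - \<zeta>^4) / 5)"
proof -
  have "\<i> * of_real cS = (\<zeta> + 2 * \<zeta>^2 - 2 * \<zeta>^3 - \<zeta>^4) / 5"
    using arg_cong[OF cS_zeta(1), of uminus] by (simp add: minus_divide_left)
  then show ?thesis by (simp only: rep_S_def cS_zeta)
qed

definition torus :: "((int^2^2) \<times> (complex^2^2)) set" where
  "torus = {(mat2 1 0 0 1, mat2 1 0 0 1), (mat2 (-1) 0 0 (-1), mat2 (-1) 0 0 (-1)),
            (mat2 2 0 0 3, mat2 0 (-1) 1 0), (mat2 (-2) 0 0 (-3), mat2 0 1 (-1) 0)}"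

lemma mat_cong_iff: "mat_cong A B \<longleftrightarrow> [A$1$1 = B$1$1] (mod 5) \<and> [A$1$2 = B$1$2] (mod 5) \<and> [A$2$1 = B$2$1] (mod 5) \<and> [A$2$2 = B$2$2] (mod 5)"
  by (auto simp: mat_cong_def forall_2)

lemma mat2_mult: "mat2 a b c d ** mat2 e f g k = mat2 (a * e + b * g) (a * f + b * k) (c * e + d * g) (c * f + d * k)"
  for a b c d :: "'a::semiring_1"
  unfolding mat2_eq_iff mat2_mult_nth mat2_nth by simp

lemma mat2_inject: "mat2 a b c d = mat2 e f g k \<longleftrightarrow> a = e \<and> b = f \<and> c = g \<and> d = k"
  unfolding mat2_eq_iff mat2_nth ..

lemma torus_mult:
  assumes "(\<delta>, \<rho>) \<in> torus" "(\<delta>', \<rho>') \<in> torus"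
  obtains \<delta>'' where "(\<delta>'', \<rho> ** \<rho>') \<in> torus" "mat_cong (\<delta> ** \<delta>') \<delta>''"
proof -
  have "\<exists>\<delta>''. (\<delta>'', \<rho> ** \<rho>') \<in> torus \<and> mat_cong (\<delta> ** \<delta>') \<delta>''"
    using assms unfolding torus_def insert_iff empty_iff prod.inject
    by (elim disjE conjE FalseE; simp add: mat2_mult mat2_inject mat_cong_iff cong_def conj_disj_distribR ex_disj_distrib)
  then show ?thesis using that by blast
qed

lemma rep_T_add: "rep_T b ** rep_T c = rep_T (b + c)"
  by (simp add: rep_T_def mat2_eq_iff mat2_mult_nth distrib_left power_int_add)

lemma T_mat_add: "T_mat b ** T_mat c = T_mat (b + c)"
  by (simp add: T_mat_def mat2_eq_iff mat2_mult_nth)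

lemma rep_T_cong:
  assumes "[b = c] (mod 5)"
  shows "rep_T b = rep_T c"
proof -
  have "[2 * b = 2 * c] (mod 5)" "[3 * b = 3 * c] (mod 5)"
    using assms by (auto intro: cong_scalar_left)
  then show ?thesis
    unfolding rep_T_def zeta_powi cong_def by (simp only:)
qed

lemma torus_T:
  assumes "(\<delta>, \<rho>) \<in> torus"
  obtains b' where "mat_cong (T_mat b ** \<delta>) (\<delta> ** T_mat b')" "rep_T b ** \<rho> = \<rho> ** rep_T b'"
proof (cases "\<rho> $ 1 $ 1 = 0")
  case False
  then have "mat_cong (T_mat b ** \<delta>) (\<delta> ** T_mat b)" "rep_T b ** \<rho> = \<rho> ** rep_T b"
    using assms unfolding torus_def
    by (auto simp: mat_cong_iff T_mat_def rep_T_def mat2_eq_iff mat2_mult_nth)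
  then show ?thesis by (rule that)
next
  case True
  have "[2 * b = 3 * (- b)] (mod 5)" "[3 * b = 2 * (- b)] (mod 5)" "[b * 3 = 2 * (- b)] (mod 5)" "[b * (- 3) = - 2 * (- b)] (mod 5)"
    by (simp_all add: cong_iff_dvd_diff)
  moreover from this have "\<zeta> powi (2 * b) = \<zeta> powi (3 * (- b))" "\<zeta> powi (3 * b) = \<zeta> powi (2 * (- b))"
    unfolding zeta_powi cong_def by (simp_all only:)
  ultimately have "mat_cong (T_mat b ** \<delta>) (\<delta> ** T_mat (- b))" "rep_T b ** \<rho> = \<rho> ** rep_T (- b)"
    using assms True unfolding torus_def
    by (auto simp: mat_cong_iff T_mat_def rep_T_def mat2_eq_iff mat2_mult_nth)
  then show ?thesis by (rule that)
qed

lemma symmetric_triple_product: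
  fixes A B x y :: complex
  assumes "A * A * x + B * B * y = 5 * U" "A * B * x - A * B * y = 5 * V" "B * B * x + A * A * y = 5 * W"
  shows "mat2 (A / 5) (B / 5) (B / 5) (- A / 5) ** mat2 x 0 0 y ** mat2 (A / 5) (B / 5) (B / 5) (- A / 5) =
    mat2 (U / 5) (V / 5) (V / 5) (W / 5)"
proof -
  have UVW: "U = (A * A * x + B * B * y) / 5" "V = (A * B * x - A * B * y) / 5" "W = (B * B * x + A * A * y) / 5"
    using assms by simp_all
  show ?thesis
    unfolding UVW mat2_eq_iff mat2_mult_nth mat2_nth by (simp add: field_simps)
qed

lemma rep_STS:
  "rep_S ** rep_S = mat2 (-1) 0 0 (-1)"
  "rep_S ** rep_T 1 ** rep_S = mat2 1 0 0 1 ** rep_T (-1) ** rep_S ** rep_T (-1)"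
  "rep_S ** rep_T 2 ** rep_S = mat2 0 1 (-1) 0 ** rep_T (-2) ** rep_S ** rep_T (-3)"
  "rep_S ** rep_T 3 ** rep_S = mat2 0 (-1) 1 0 ** rep_T (-3) ** rep_S ** rep_T (-2)"
  "rep_S ** rep_T 4 ** rep_S = mat2 (-1) 0 0 (-1) ** rep_T (-4) ** rep_S ** rep_T (-4)"
proof -
  define z where "z = \<zeta>"
  have c: "1 + z + z^2 + z^3 + z^4 = 0" using zeta_cyclotomic by (simp add: z_def)
  define A where "A = - (z + 2 * z^2 - 2 * z^3 - z^4)"
  define B where "B = - (2 * z - z^2 + z^3 - 2 * z^4)"
  have S: "rep_S = mat2 (A / 5) (B / 5) (B / 5) (- A / 5)"
    by (simp add: rep_S_zeta A_def B_def z_def)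
  have T: "rep_T 1 = mat2 (z^2) 0 0 (z^3)" "rep_T (-1) = mat2 (z^3) 0 0 (z^2)"
    "rep_T 2 = mat2 (z^4) 0 0 z" "rep_T (-2) = mat2 z 0 0 (z^4)"
    "rep_T 3 = mat2 z 0 0 (z^4)" "rep_T (-3) = mat2 (z^4) 0 0 z"
    "rep_T 4 = mat2 (z^3) 0 0 (z^2)" "rep_T (-4) = mat2 (z^2) 0 0 (z^3)"
    unfolding rep_T_def zeta_powi z_def by simp_all
  have "A * A + B * B = - 25" unfolding A_def B_def using c by algebra
  then show "rep_S ** rep_S = mat2 (-1) 0 0 (-1)"
    unfolding S mat2_eq_iff mat2_mult_nth mat2_nth by (simp add: field_simps)
  have "A * A * z^2 + B * B * z^3 = 5 * (z^3 * A * z^3)" "A * B * z^2 - A * B * z^3 = 5 * (z^3 * B * z^2)"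
      "B * B * z^2 + A * A * z^3 = 5 * (- (z^2 * A * z^2))"
    unfolding A_def B_def using c by algebra+
  from symmetric_triple_product[OF this]
  show "rep_S ** rep_T 1 ** rep_S = mat2 1 0 0 1 ** rep_T (-1) ** rep_S ** rep_T (-1)"
    unfolding T S by (simp add: mat2_eq_iff mat2_mult_nth)
  have "A * A * z^4 + B * B * z = 5 * (z^4 * B * z^4)" "A * B * z^4 - A * B * z = 5 * (- (z^4 * A * z))"
      "B * B * z^4 + A * A * z = 5 * (- (z * B * z))"
    unfolding A_def B_def using c by algebra+
  from symmetric_triple_product[OF this]
  show "rep_S ** rep_T 2 ** rep_S = mat2 0 1 (-1) 0 ** rep_T (-2) ** rep_S ** rep_T (-3)"
    unfolding T S by (simp add: mat2_eq_iff mat2_mult_nth)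
  have "A * A * z + B * B * z^4 = 5 * (- (z * B * z))" "A * B * z - A * B * z^4 = 5 * (z * A * z^4)"
      "B * B * z + A * A * z^4 = 5 * (z^4 * B * z^4)"
    unfolding A_def B_def using c by algebra+
  from symmetric_triple_product[OF this]
  show "rep_S ** rep_T 3 ** rep_S = mat2 0 (-1) 1 0 ** rep_T (-3) ** rep_S ** rep_T (-2)"
    unfolding T S by (simp add: mat2_eq_iff mat2_mult_nth)
  have "A * A * z^3 + B * B * z^2 = 5 * (- (z^2 * A * z^2))" "A * B * z^3 - A * B * z^2 = 5 * (- (z^2 * B * z^3))"
      "B * B * z^3 + A * A * z^2 = 5 * (z^3 * A * z^3)"
    unfolding A_def B_def using c by algebra+
  from symmetric_triple_product[OF this]
  show "rep_S ** rep_T 4 ** rep_S = mat2 (-1) 0 0 (-1) ** rep_T (-4) ** rep_S ** rep_T (-4)"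
    unfolding T S by (simp add: mat2_eq_iff mat2_mult_nth)
qed

definition bruhat :: "int^2^2 \<Rightarrow> complex^2^2 \<Rightarrow> bool" where
  "bruhat A R \<longleftrightarrow> (\<exists>(\<delta>, \<rho>)\<in>torus. \<exists>b.
     (mat_cong A (\<delta> ** T_mat b) \<and> R = \<rho> ** rep_T b) \<or>
     (\<exists>c. mat_cong A (\<delta> ** T_mat b ** S_mat ** T_mat c) \<and> R = \<rho> ** rep_T b ** rep_S ** rep_T c))"

lemma bruhatI:
  assumes "(\<delta>, \<rho>) \<in> torus"
  shows "mat_cong A (\<delta> ** T_mat b) \<Longrightarrow> R = \<rho> ** rep_T b \<Longrightarrow> bruhat A R"
    and "mat_cong A (\<delta> ** T_mat b ** S_mat ** T_mat c) \<Longrightarrow> R = \<rho> ** rep_T b ** rep_S ** rep_T c \<Longrightarrow> bruhat A R"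
  using assms unfolding bruhat_def by blast+

lemma bruhatE:
  assumes "bruhat A R"
  obtains (borel) \<delta> \<rho> b where "(\<delta>, \<rho>) \<in> torus" "mat_cong A (\<delta> ** T_mat b)" "R = \<rho> ** rep_T b"
  | (big_cell) \<delta> \<rho> b c where "(\<delta>, \<rho>) \<in> torus" "mat_cong A (\<delta> ** T_mat b ** S_mat ** T_mat c)" "R = \<rho> ** rep_T b ** rep_S ** rep_T c"
  using assms unfolding bruhat_def by blast

lemma S_T_S_reduction:
  assumes "\<not> 5 dvd c"
  obtains \<delta> \<rho> x y where "(\<delta>, \<rho>) \<in> torus"
    "mat_cong (S_mat ** T_mat c ** S_mat) (\<delta> ** T_mat x ** S_mat ** T_mat y)"
    "rep_S ** rep_T c ** rep_S = \<rho> ** rep_T x ** rep_S ** rep_T y"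
proof -
  note result = that
  have step: thesis if "[c = j] (mod 5)" "(\<delta>, \<rho>) \<in> torus"
    "mat_cong (S_mat ** T_mat j ** S_mat) (\<delta> ** T_mat x ** S_mat ** T_mat y)"
    "rep_S ** rep_T j ** rep_S = \<rho> ** rep_T x ** rep_S ** rep_T y" for j \<delta> \<rho> x y
  proof (rule result[OF that(2)])
    have "mat_cong (T_mat c) (T_mat j)" using that(1) by (simp add: mat_cong_iff T_mat_def)
    then have "mat_cong (S_mat ** T_mat c ** S_mat) (S_mat ** T_mat j ** S_mat)"
      by (intro mat_cong_mult) auto
    then show "mat_cong (S_mat ** T_mat c ** S_mat) (\<delta> ** T_mat x ** S_mat ** T_mat y)"
      using that(3) by (rule mat_cong_trans)
    show "rep_S ** rep_T c ** rep_S = \<rho> ** rep_T x ** rep_S ** rep_T y"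
      using that(4) rep_T_cong[OF that(1)] by simp
  qed
  have "[c = 1] (mod 5) \<or> [c = 2] (mod 5) \<or> [c = 3] (mod 5) \<or> [c = 4] (mod 5)"
  proof -
    define x where "x = c mod 5"
    have "0 \<le> x" "x < 5" "x \<noteq> 0"
      using assms by (simp_all add: x_def dvd_eq_mod_eq_0)
    then have "x = 1 \<or> x = 2 \<or> x = 3 \<or> x = 4" by linarith
    then show ?thesis by (simp add: cong_def x_def)
  qed
  then show ?thesis
  proof (elim disjE)
    assume "[c = 1] (mod 5)"
    then show thesis
      by (rule step[OF _ _ _ rep_STS(2), where \<delta> = "mat2 1 0 0 1"]) (auto simp: torus_def mat_cong_iff mat2_mult_nth T_mat_def S_mat_def cong_def)
  next
    assume "[c = 2] (mod 5)"
    then show thesis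
      by (rule step[OF _ _ _ rep_STS(3), where \<delta> = "mat2 (-2) 0 0 (-3)"]) (auto simp: torus_def mat_cong_iff mat2_mult_nth T_mat_def S_mat_def cong_def)
  next
    assume "[c = 3] (mod 5)"
    then show thesis
      by (rule step[OF _ _ _ rep_STS(4), where \<delta> = "mat2 2 0 0 3"]) (auto simp: torus_def mat_cong_iff mat2_mult_nth T_mat_def S_mat_def cong_def)
  next
    assume "[c = 4] (mod 5)"
    then show thesis
      by (rule step[OF _ _ _ rep_STS(5), where \<delta> = "mat2 (-1) 0 0 (-1)"]) (auto simp: torus_def mat_cong_iff mat2_mult_nth T_mat_def S_mat_def cong_def)
  qed
qed

lemma bruhat_S:
  assumes "bruhat A R"
  shows "bruhat (A ** S_mat) (R ** rep_S)"
proof -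
  note assoc = matrix_mul_assoc[symmetric]
  show ?thesis
    using assms
  proof (cases rule: bruhatE)
    case 1: (borel \<delta> \<rho> b)
    have T0: "T_mat 0 = mat 1" "rep_T 0 = mat 1" by (simp_all add: T_mat_def rep_T_def mat2_eq_iff)
    have "mat_cong (A ** S_mat) (\<delta> ** T_mat b ** S_mat ** T_mat 0)" "R ** rep_S = \<rho> ** rep_T b ** rep_S ** rep_T 0"
      using mat_cong_mult[OF 1(2) mat_cong_refl[of S_mat]] 1(3) by (simp_all add: T0)
    then show ?thesis by (rule bruhatI(2)[OF 1(1)])
  next
    case 2: (big_cell \<delta> \<rho> b c)
    note t = 2(1)
    have AS: "mat_cong (A ** S_mat) (\<delta> ** T_mat b ** (S_mat ** T_mat c ** S_mat))"
      using mat_cong_mult[OF 2(2) mat_cong_refl[of S_mat]] by (simp add: assoc)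
    have RS: "R ** rep_S = \<rho> ** rep_T b ** (rep_S ** rep_T c ** rep_S)"
      by (simp add: 2(3) assoc)
    have left: "\<exists>\<delta>'' b'. (\<delta>'', \<rho> ** \<rho>') \<in> torus \<and> mat_cong (\<delta> ** T_mat b ** \<delta>') (\<delta>'' ** T_mat b') \<and>
        \<rho> ** rep_T b ** \<rho>' = \<rho> ** \<rho>' ** rep_T b'" if t': "(\<delta>', \<rho>') \<in> torus" for \<delta>' \<rho>'
    proof -
      obtain b' where b': "mat_cong (T_mat b ** \<delta>') (\<delta>' ** T_mat b')" "rep_T b ** \<rho>' = \<rho>' ** rep_T b'"
        using torus_T[OF t'] by blast
      obtain \<delta>'' where d: "(\<delta>'', \<rho> ** \<rho>') \<in> torus" "mat_cong (\<delta> ** \<delta>') \<delta>''"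
        using torus_mult[OF t t'] by blast
      have "mat_cong (\<delta> ** T_mat b ** \<delta>') (\<delta> ** \<delta>' ** T_mat b')"
        using mat_cong_mult[OF mat_cong_refl[of \<delta>] b'(1)] by (simp add: assoc)
      also have "mat_cong (\<delta> ** \<delta>' ** T_mat b') (\<delta>'' ** T_mat b')"
        by (rule mat_cong_mult[OF d(2) mat_cong_refl])
      finally have "mat_cong (\<delta> ** T_mat b ** \<delta>') (\<delta>'' ** T_mat b')" .
      moreover have "\<rho> ** rep_T b ** \<rho>' = \<rho> ** \<rho>' ** rep_T b'"
        using b'(2) by (simp add: assoc)
      ultimately show ?thesis using d(1) by blast
    qed
    show ?thesis
    proof (cases "5 dvd c")
      case True
      then have c0: "[c = 0] (mod 5)" by (simp add: cong_0_iff)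
      have "mat_cong (S_mat ** T_mat c ** S_mat) (mat2 (-1) 0 0 (-1))"
        using c0 by (simp add: mat_cong_iff mat2_mult_nth T_mat_def S_mat_def)
      then have AS': "mat_cong (A ** S_mat) (\<delta> ** T_mat b ** mat2 (-1) 0 0 (-1))"
        by (rule mat_cong_trans[OF AS mat_cong_mult[OF mat_cong_refl]])
      have "rep_T c = mat 1"
        using rep_T_cong[OF c0] by (simp add: rep_T_def mat2_eq_iff)
      then have RS': "R ** rep_S = \<rho> ** rep_T b ** mat2 (-1) 0 0 (-1)"
        unfolding RS by (simp add: rep_STS(1))
      have "(mat2 (-1) 0 0 (-1), mat2 (-1) 0 0 (-1)) \<in> torus" by (simp add: torus_def)
      from left[OF this] obtain \<delta>'' b' where l:
        "(\<delta>'', \<rho> ** mat2 (-1) 0 0 (-1)) \<in> torus" "mat_cong (\<delta> ** T_mat b ** mat2 (-1) 0 0 (-1)) (\<delta>'' ** T_mat b')"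
        "\<rho> ** rep_T b ** mat2 (-1) 0 0 (-1) = \<rho> ** mat2 (-1) 0 0 (-1) ** rep_T b'" by blast
      show ?thesis
        by (rule bruhatI(1)[OF l(1) mat_cong_trans[OF AS' l(2)]]) (simp only: RS' l(3))
    next
      case False
      obtain \<delta>' \<rho>' x y where r: "(\<delta>', \<rho>') \<in> torus"
        "mat_cong (S_mat ** T_mat c ** S_mat) (\<delta>' ** T_mat x ** S_mat ** T_mat y)"
        "rep_S ** rep_T c ** rep_S = \<rho>' ** rep_T x ** rep_S ** rep_T y"
        using S_T_S_reduction[OF False] by blast
      from left[OF r(1)] obtain \<delta>'' b' where l:
        "(\<delta>'', \<rho> ** \<rho>') \<in> torus" "mat_cong (\<delta> ** T_mat b ** \<delta>') (\<delta>'' ** T_mat b')"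
        "\<rho> ** rep_T b ** \<rho>' = \<rho> ** \<rho>' ** rep_T b'" by blast
      have "mat_cong (A ** S_mat) (\<delta> ** T_mat b ** (\<delta>' ** T_mat x ** S_mat ** T_mat y))"
        by (rule mat_cong_trans[OF AS mat_cong_mult[OF mat_cong_refl r(2)]])
      also have "\<delta> ** T_mat b ** (\<delta>' ** T_mat x ** S_mat ** T_mat y) = (\<delta> ** T_mat b ** \<delta>') ** (T_mat x ** S_mat ** T_mat y)"
        by (simp add: assoc)
      also have "mat_cong ((\<delta> ** T_mat b ** \<delta>') ** (T_mat x ** S_mat ** T_mat y)) ((\<delta>'' ** T_mat b') ** (T_mat x ** S_mat ** T_mat y))"
        by (rule mat_cong_mult[OF l(2) mat_cong_refl])
      also have "(\<delta>'' ** T_mat b') ** (T_mat x ** S_mat ** T_mat y) = \<delta>'' ** T_mat (b' + x) ** S_mat ** T_mat y"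
        by (simp add: matrix_mul_assoc T_mat_add[symmetric])
      finally have AS': "mat_cong (A ** S_mat) (\<delta>'' ** T_mat (b' + x) ** S_mat ** T_mat y)" .
      have "R ** rep_S = (\<rho> ** rep_T b ** \<rho>') ** (rep_T x ** rep_S ** rep_T y)"
        unfolding RS r(3) by (simp add: assoc)
      also have "\<dots> = \<rho> ** \<rho>' ** rep_T (b' + x) ** rep_S ** rep_T y"
        unfolding l(3) by (simp add: matrix_mul_assoc rep_T_add[symmetric])
      finally show ?thesis
        by (rule bruhatI(2)[OF l(1) AS'])
    qed
  qed
qed

lemma bruhat_T:
  assumes "bruhat A R"
  shows "bruhat (A ** T_mat k) (R ** rep_T k)"
proof -
  note assoc = matrix_mul_assoc[symmetric]
  show ?thesis
    using assms
  proof (cases rule: bruhatE)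
    case 1: (borel \<delta> \<rho> b)
    have "mat_cong (A ** T_mat k) (\<delta> ** T_mat (b + k))" "R ** rep_T k = \<rho> ** rep_T (b + k)"
      using mat_cong_mult[OF 1(2) mat_cong_refl[of "T_mat k"]] 1(3) by (simp_all add: assoc T_mat_add rep_T_add)
    then show ?thesis by (rule bruhatI(1)[OF 1(1)])
  next
    case 2: (big_cell \<delta> \<rho> b c)
    have "mat_cong (A ** T_mat k) (\<delta> ** T_mat b ** S_mat ** T_mat (c + k))" "R ** rep_T k = \<rho> ** rep_T b ** rep_S ** rep_T (c + k)"
      using mat_cong_mult[OF 2(2) mat_cong_refl[of "T_mat k"]] 2(3) by (simp_all add: assoc T_mat_add rep_T_add)
    then show ?thesis by (rule bruhatI(2)[OF 2(1)])
  qed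
qed

theorem bruhat_acts:
  assumes "A \<in> SL2Z"
  obtains R where "acts A R" "bruhat A R"
proof -
  have "\<exists>R. acts A R \<and> bruhat A R"
    using assms
  proof (induction A rule: SL2Z_induct)
    case one
    have 1: "mat2 1 0 0 1 = (mat 1 :: int^2^2)" "mat2 1 0 0 1 = (mat 1 :: complex^2^2)"
      by (simp_all add: mat2_eq_iff)
    have "(mat2 1 0 0 1, mat2 1 0 0 1) \<in> torus" by (simp add: torus_def)
    then have "bruhat (mat 1) (mat 1)"
      by (rule bruhatI(1)[where b = 0]) (simp_all add: T_mat_def rep_T_def 1)
    then show ?case using acts_1 by blast
  next
    case (translate A k)
    then show ?case using bruhat_T acts_mult[OF _ acts_T] by blast
  next
    case (invert A)
    then show ?case using bruhat_S acts_mult[OF _ acts_S] by blast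
  qed
  then show ?thesis using that by blast
qed

theorem acts_Gamma5:
  assumes "A \<in> \<Gamma>5"
  shows "acts A (mat 1)"
proof -
  have A: "A \<in> SL2Z" "mat_cong (mat 1) A" using assms by (auto simp: Gamma5_iff mat_cong_sym)
  obtain R where R: "acts A R" "bruhat A R" using bruhat_acts[OF A(1)] .
  from R(2) have "R = mat 1"
  proof (cases rule: bruhatE)
    case 1: (borel \<delta> \<rho> b)
    from 1(1) mat_cong_trans[OF A(2) 1(2)] have "\<rho> = mat2 1 0 0 1 \<and> [b = 0] (mod 5)"
      unfolding torus_def by (auto simp: mat_cong_iff mat2_mult_nth T_mat_def cong_def)
    with 1(3) rep_T_cong[of b 0] show ?thesis
      by (simp add: rep_T_def mat2_eq_iff mat2_mult_nth)
  next
    case 2: (big_cell \<delta> \<rho> b c)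
    from 2(1) mat_cong_trans[OF A(2) 2(2)] have False
      unfolding torus_def by (auto simp: mat_cong_iff mat2_mult_nth T_mat_def S_mat_def cong_def)
    then show ?thesis ..
  qed
  with R(1) show ?thesis by simp
qed

theorem acts_cases:
  assumes "A \<in> SL2Z"
  obtains R where "acts A R" "R$2$1 \<noteq> 0"
  | R s b where "acts A R" "R$2$1 = 0" "R$2$2 \<noteq> 0" "s = 1 \<or> s = -1" "mat_cong A (mat2 s (s * b) 0 s)"
proof -
  obtain R where R: "acts A R" "bruhat A R" using bruhat_acts[OF assms] .
  from R(2) show ?thesis
  proof (cases rule: bruhatE)
    case 2: (big_cell \<delta> \<rho> b c)
    have "R$2$1 \<noteq> 0"
      using 2(1) cS_nonzero unfolding 2(3) unfolding torus_def
      by (auto simp: mat2_mult_nth rep_T_def rep_S_def)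
    then show ?thesis using that(1) R(1) by blast
  next
    case 1: (borel \<delta> \<rho> b)
    show ?thesis
    proof (cases "R$2$1 = 0")
      case True
      then have "\<exists>s. (s = 1 \<or> s = -1) \<and> \<delta> = mat2 s 0 0 s \<and> R$2$2 \<noteq> 0"
        using 1(1) unfolding 1(3) torus_def by (auto simp: mat2_mult_nth rep_T_def)
      then obtain s where s: "s = 1 \<or> s = -1" "\<delta> = mat2 s 0 0 s" "R$2$2 \<noteq> 0" by blast
      have "\<delta> ** T_mat b = mat2 s (s * b) 0 s"
        by (simp add: s(2) T_mat_def mat2_eq_iff mat2_mult_nth)
      then show ?thesis using that(2)[OF R(1) True s(3,1)] 1(2) by metis
    qed (use that(1) R(1) in blast)
  qed
qed


section \<open>Expansions in powers of \<open>q\<^sup>1\<^sup>/\<^sup>5\<close>\<close>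

abbreviation q5 :: "complex \<Rightarrow> complex" where "q5 \<equiv> q_pow (1/5)"

lemma eventually_at_i_infinity: "eventually P at_i_infinity \<longleftrightarrow> (\<exists>Y. \<forall>\<tau>. Im \<tau> \<ge> Y \<longrightarrow> P \<tau>)"
  unfolding at_i_infinity_def eventually_filtercomap eventually_at_top_linorder
  by (metis (mono_tags, lifting) order_refl)

lemma eventually_uhp: "eventually (\<lambda>\<tau>. \<tau> \<in> uhp) at_i_infinity"
  unfolding eventually_at_i_infinity by (rule exI[of _ 1]) (auto simp: uhp_def)

lemma at_i_infinity_nontrivial: "at_i_infinity \<noteq> bot"
  unfolding trivial_limit_def eventually_at_i_infinity
  by (metis Im_i_times Re_complex_of_real order_refl)

lemma q_pow_tendsto_0:
  assumes "r > 0"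
  shows "(q_pow r \<longlongrightarrow> 0) at_i_infinity"
proof (rule tendsto_norm_zero_cancel)
  have "((\<lambda>y. exp (- (2 * pi * r) * y)) \<longlongrightarrow> 0) at_top"
    using assms by real_asymp
  then show "((\<lambda>\<tau>. norm (q_pow r \<tau>)) \<longlongrightarrow> 0) at_i_infinity"
    unfolding at_i_infinity_def norm_q_pow
    by (auto intro: filterlim_compose[OF _ filterlim_filtercomap])
qed

lemma holomorphic_tendsto_at_i_infinity:
  assumes "g holomorphic_on ball 0 1" "r > 0"
  shows "((\<lambda>\<tau>. g (q_pow r \<tau>)) \<longlongrightarrow> g 0) at_i_infinity"
proof -
  have "continuous_on (ball 0 1) g" by (rule holomorphic_on_imp_continuous_on[OF assms(1)])
  then have "isCont g 0" by (simp add: continuous_on_eq_continuous_at)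
  then show ?thesis by (rule isCont_tendsto_compose[OF _ q_pow_tendsto_0[OF assms(2)]])
qed

lemma tendsto_cong_uhp:
  assumes "(g \<longlongrightarrow> c) at_i_infinity" "\<And>\<tau>. \<tau> \<in> uhp \<Longrightarrow> f \<tau> = g \<tau>"
  shows "(f \<longlongrightarrow> c) at_i_infinity"
  using assms(1) by (rule Lim_transform_eventually) (use eventually_uhp assms(2) in \<open>auto elim!: eventually_mono\<close>)

lemma Bfun_if_tendsto:
  fixes f :: "complex \<Rightarrow> 'a::real_normed_vector"
  assumes "(f \<longlongrightarrow> c) F"
  shows "Bfun f F"
proof (rule BfunI)
  show "eventually (\<lambda>x. norm (f x) \<le> norm c + 1) F"
    using order_tendstoD(2)[OF tendsto_norm[OF assms], of "norm c + 1"] by (auto elim: eventually_mono)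
qed

lemma Bfun_cong_norm:
  fixes f :: "complex \<Rightarrow> 'a::real_normed_vector" and g :: "complex \<Rightarrow> 'b::real_normed_vector"
  assumes "Bfun f F" "eventually (\<lambda>x. norm (g x) = norm (f x)) F"
  shows "Bfun g F"
proof -
  obtain B where "eventually (\<lambda>x. norm (f x) \<le> B) F" using assms(1) by (auto simp: Bfun_def)
  then have "eventually (\<lambda>x. norm (g x) \<le> B) F" using assms(2) by eventually_elim simp
  then show ?thesis by (rule BfunI)
qed

lemma periodic_int:
  assumes "\<And>\<tau>. \<tau> \<in> uhp \<Longrightarrow> f (\<tau> + 5) = f \<tau>" "\<tau> \<in> uhp"
  shows "f (\<tau> + 5 * of_int n) = f \<tau>"
proof -
  have in_uhp: "\<tau> + 5 * of_int n \<in> uhp" for n using assms(2) by (simp add: uhp_def)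
  show ?thesis
  proof (induction n rule: int_induct[of _ 0])
    case (step1 i)
    have "f (\<tau> + 5 * of_int (i + 1)) = f (\<tau> + 5 * of_int i + 5)" by (simp add: algebra_simps)
    then show ?case using assms(1)[OF in_uhp[of i]] step1 by simp
  next
    case (step2 i)
    have "f (\<tau> + 5 * of_int i) = f (\<tau> + 5 * of_int (i - 1) + 5)" by (simp add: algebra_simps)
    then show ?case using assms(1)[OF in_uhp[of "i - 1"]] step2 by simp
  qed simp
qed

lemma q_expansion:
  assumes hol: "f holomorphic_on uhp" and per: "\<And>\<tau>. \<tau> \<in> uhp \<Longrightarrow> f (\<tau> + 5) = f \<tau>"
    and bdd: "Bfun f at_i_infinity"
  obtains g where "g holomorphic_on ball 0 1" "\<And>\<tau>. \<tau> \<in> uhp \<Longrightarrow> f \<tau> = g (q5 \<tau>)"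
proof -
  define c :: complex where "c = 2 * of_real pi * \<i> / 5"
  have c0: "c \<noteq> 0" by (simp add: c_def)
  have q5: "q5 \<tau> = exp (c * \<tau>)" for \<tau>
    by (simp add: q_pow_def c_def)
  have Im_c: "Im (z / c) = - 5 * Re z / (2 * pi)" for z
    by (simp add: c_def Im_divide power2_eq_square field_simps)
  define g0 where "g0 w = f (Ln w / c)" for w
  have lift_uhp: "z / c \<in> uhp" if "norm (exp z) < 1" for z
    using that by (simp add: uhp_def Im_c divide_less_0_iff)
  have g0: "f \<tau> = g0 (q5 \<tau>)" if \<tau>: "\<tau> \<in> uhp" for \<tau>
  proof -
    have "exp (Ln (q5 \<tau>)) = exp (c * \<tau>)" by (simp add: q5)
    then obtain n :: int where "Ln (q5 \<tau>) = c * \<tau> + complex_of_real (real_of_int (2 * n) * pi) * \<i>"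
      unfolding exp_eq by blast
    then have "Ln (q5 \<tau>) = c * (\<tau> + 5 * of_int n)"
      by (simp add: c_def algebra_simps)
    then have "Ln (q5 \<tau>) / c = \<tau> + 5 * of_int n" using c0 by simp
    then show ?thesis
      using periodic_int[of f, OF per \<tau>] by (simp add: g0_def)
  qed
  have "g0 holomorphic_on ball 0 1 - {0}"
    unfolding holomorphic_on_open[OF open_delete[OF open_ball]]
  proof
    fix w0 :: complex assume w0: "w0 \<in> ball 0 1 - {0}"
    define U where "U = ball w0 (min (norm w0) (1 - norm w0))"
    define t where "t w = (Ln (w / w0) + Ln w0) / c" for w
    have U: "open U" "w0 \<in> U" using w0 by (auto simp: U_def)
    have small: "norm w < 1" "w \<noteq> 0" "w / w0 \<notin> \<real>\<^sub>\<le>\<^sub>0" if "w \<in> U" for w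
    proof -
      have d: "norm (w - w0) < norm w0" "norm (w - w0) < 1 - norm w0"
        using that by (auto simp: U_def dist_norm norm_minus_commute)
      show "norm w < 1" using norm_triangle_ineq[of w0 "w - w0"] d(2) by simp
      show "w \<noteq> 0" using d(1) by auto
      have "norm (w / w0 - 1) < 1"
      proof -
        have "w / w0 - 1 = (w - w0) / w0" using w0 by (simp add: field_simps)
        then show ?thesis using d(1) w0 by (simp add: norm_divide)
      qed
      then have "Re (w / w0) > 0"
        using abs_Re_le_cmod[of "w / w0 - 1"] by (auto simp: abs_if split: if_splits)
      then show "w / w0 \<notin> \<real>\<^sub>\<le>\<^sub>0" by (auto simp: complex_nonpos_Reals_iff)
    qed
    have et: "exp (c * t w) = w" "t w \<in> uhp" if "w \<in> U" for w
    proof -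
      have "exp (Ln (w / w0) + Ln w0) = w" using w0 small[OF that] by (simp add: exp_add)
      moreover have "c * t w = Ln (w / w0) + Ln w0" using c0 by (simp add: t_def)
      ultimately show "exp (c * t w) = w" by simp
      have "norm (exp (Ln (w / w0) + Ln w0)) < 1"
        using \<open>exp (Ln (w / w0) + Ln w0) = w\<close> small[OF that] by simp
      then show "t w \<in> uhp" unfolding t_def by (rule lift_uhp)
    qed
    have "t holomorphic_on U"
      unfolding t_def[abs_def] using small(3) c0 w0 by (intro holomorphic_intros) auto
    then have "(\<lambda>w. f (t w)) holomorphic_on U"
      by (rule holomorphic_on_compose_gen[unfolded o_def, OF _ hol]) (use et in auto)
    moreover have "f (t w) = g0 w" if "w \<in> U" for w
      using g0[OF et(2)[OF that]] et(1)[OF that] by (simp add: q5)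
    ultimately have "g0 holomorphic_on U" by (rule holomorphic_transform)
    then show "\<exists>f'. (g0 has_field_derivative f') (at w0)"
      using U holomorphic_on_open[OF U(1)] by blast
  qed
  moreover have "\<exists>B. eventually (\<lambda>w. norm (g0 w) \<le> B) (at 0)"
  proof -
    obtain B Y where BY: "\<And>\<tau>. Im \<tau> \<ge> Y \<Longrightarrow> norm (f \<tau>) \<le> B"
      using bdd unfolding Bfun_def eventually_at_i_infinity by blast
    have "norm (g0 w) \<le> B" if "w \<noteq> 0" "norm w < exp (- (2 * pi * Y / 5))" for w
    proof -
      have "ln (norm w) < - (2 * pi * Y / 5)"
        using that ln_less_cancel_iff[of "norm w" "exp (- (2 * pi * Y / 5))"] by simp
      then have "Im (Ln w / c) \<ge> Y"
        unfolding Im_c using that by (simp add: field_simps)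
      then show ?thesis unfolding g0_def by (rule BY)
    qed
    then have "eventually (\<lambda>w. norm (g0 w) \<le> B) (at 0)"
      unfolding eventually_at by (intro exI[of _ "exp (- (2 * pi * Y / 5))"]) (auto simp: dist_norm)
    then show ?thesis by blast
  qed
  ultimately obtain g where g: "g holomorphic_on ball 0 1" "\<And>w. w \<in> ball 0 1 - {0} \<Longrightarrow> g w = g0 w"
    using holomorphic_on_extend_bounded[of g0 "ball 0 1" 0] by (auto simp: interior_open)
  show ?thesis
  proof (rule that[OF g(1)])
    fix \<tau> assume \<tau>: "\<tau> \<in> uhp"
    then show "f \<tau> = g (q5 \<tau>)"
      using g(2)[of "q5 \<tau>"] g0[OF \<tau>] q_pow_in_ball[OF \<tau>, of "1/5"] by simp
  qed
qed

lemma holomorphic_eq_if_eq_on_uhp: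
  assumes "g holomorphic_on ball 0 1" "g' holomorphic_on ball 0 1"
    and "\<And>\<tau>. \<tau> \<in> uhp \<Longrightarrow> g (q5 \<tau>) = g' (q5 \<tau>)" and "w \<in> ball 0 1"
  shows "g w = g' w"
proof -
  have nz: "g w = g' w" if w: "w \<in> ball 0 1 - {0}" for w
  proof -
    define \<tau> where "\<tau> = 5 * Ln w / (2 * of_real pi * \<i>)"
    have e: "2 * complex_of_real pi * \<i> * complex_of_real (1/5) * \<tau> = Ln w" by (simp add: \<tau>_def)
    have "q5 \<tau> = w" using w unfolding q_pow_def e by simp
    moreover have "\<tau> \<in> uhp"
    proof (rule ccontr)
      assume "\<tau> \<notin> uhp"
      then have "norm (q5 \<tau>) \<ge> 1" unfolding norm_q_pow uhp_def by (simp add: mult_nonneg_nonpos)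
      with \<open>q5 \<tau> = w\<close> w show False by simp
    qed
    ultimately show ?thesis using assms(3) by metis
  qed
  show ?thesis
  proof (cases "w = 0")
    case True
    have "((\<lambda>\<tau>. g (q5 \<tau>)) \<longlongrightarrow> g' 0) at_i_infinity"
      using holomorphic_tendsto_at_i_infinity[OF assms(2), of "1/5"]
      by (rule Lim_transform_eventually) (use assms(3) eventually_uhp in \<open>auto elim!: eventually_mono\<close>)
    then show ?thesis
      using holomorphic_tendsto_at_i_infinity[OF assms(1), of "1/5"] tendsto_unique[OF at_i_infinity_nontrivial] True by auto
  qed (use nz assms(4) in auto)
qed

lemma holomorphic_factor_zero:
  assumes "g holomorphic_on ball 0 1" "g 0 = 0"
  obtains g' where "g' holomorphic_on ball 0 1" "\<And>w. w \<in> ball 0 1 \<Longrightarrow> g w = w * g' w"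
proof
  define g' where "g' w = (if w = 0 then deriv g 0 else g w / w)" for w
  show "g' holomorphic_on ball 0 1"
    by (rule pole_theorem_open_0[OF assms(1) open_ball, where a = 0]) (auto simp: g'_def assms(2))
  show "g w = w * g' w" for w
    using assms(2) by (simp add: g'_def)
qed

definition f1_q :: "complex \<Rightarrow> complex" where "f1_q x = exp (- 3 / 5 * log_euler x) * theta_q 5 1 x"
definition f3_q :: "complex \<Rightarrow> complex" where "f3_q x = exp (- 3 / 5 * log_euler x) * theta_q 5 3 x"
definition h_q :: "complex \<Rightarrow> complex" where "h_q x = exp (24 / 5 * log_euler x)"

lemma f_q_holomorphic: "f1_q holomorphic_on ball 0 1" "f3_q holomorphic_on ball 0 1" "h_q holomorphic_on ball 0 1"
  unfolding f1_q_def[abs_def] f3_q_def[abs_def] h_q_def[abs_def]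
  by (intro holomorphic_intros log_euler_holomorphic theta51.theta_q_holomorphic theta53.theta_q_holomorphic)+

lemma f_q_0: "f1_q 0 = 1" "f3_q 0 = 1" "h_q 0 = 1"
  by (simp_all add: f1_q_def f3_q_def h_q_def theta51.theta_q_0 theta53.theta_q_0)

lemma f_eq_q:
  assumes "\<tau> \<in> uhp"
  shows "f1 \<tau> = f1_q (q_pow 1 \<tau>)" "f3 \<tau> = q5 \<tau> * f3_q (q_pow 1 \<tau>)" "h \<tau> = q5 \<tau> * h_q (q_pow 1 \<tau>)"
proof -
  have e: "exp (- 3 / 5 * log_eta \<tau>) = q_pow (- 1 / 40) \<tau> * exp (- 3 / 5 * log_euler (q_pow 1 \<tau>))"
    unfolding log_eta_def q_pow_def distrib_left exp_add
    by (rule arg_cong2[of _ _ _ _ "(*)"], rule arg_cong[of _ _ exp]) simp_all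
  have q: "q_pow (- 1 / 40) \<tau> * q_pow (1 / 40) \<tau> = 1" "q_pow (- 1 / 40) \<tau> * q_pow (9 / 40) \<tau> = q5 \<tau>"
    by (simp_all flip: q_pow_add)
  show "f1 \<tau> = f1_q (q_pow 1 \<tau>)"
    unfolding f13_eq[OF assms] e theta51.theta_eq_q f1_q_def using q(1) by (simp add: mult_ac)
  show "f3 \<tau> = q5 \<tau> * f3_q (q_pow 1 \<tau>)"
    unfolding f13_eq[OF assms] e theta53.theta_eq_q f3_q_def q(2)[symmetric] by (simp add: mult_ac)
  show "h \<tau> = q5 \<tau> * h_q (q_pow 1 \<tau>)"
    using eta_pow_eq_q[OF assms, of "24/5"] by (simp add: h_q_def)
qed

lemma f_tendsto:
  "(f1 \<longlongrightarrow> 1) at_i_infinity" "(f3 \<longlongrightarrow> 0) at_i_infinity" "(h \<longlongrightarrow> 0) at_i_infinity"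
proof -
  have lim: "((\<lambda>\<tau>. f1_q (q_pow 1 \<tau>)) \<longlongrightarrow> 1) at_i_infinity"
    "((\<lambda>\<tau>. f3_q (q_pow 1 \<tau>)) \<longlongrightarrow> 1) at_i_infinity" "((\<lambda>\<tau>. h_q (q_pow 1 \<tau>)) \<longlongrightarrow> 1) at_i_infinity"
    using f_q_holomorphic[THEN holomorphic_tendsto_at_i_infinity, of 1] by (simp_all add: f_q_0)
  show "(f1 \<longlongrightarrow> 1) at_i_infinity"
    by (rule tendsto_cong_uhp[OF lim(1) f_eq_q(1)])
  have q0: "(q5 \<longlongrightarrow> 0) at_i_infinity" by (rule q_pow_tendsto_0) simp
  show "(f3 \<longlongrightarrow> 0) at_i_infinity"
    by (rule tendsto_cong_uhp[OF _ f_eq_q(2)]) (use tendsto_mult[OF q0 lim(2)] in simp)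
  show "(h \<longlongrightarrow> 0) at_i_infinity"
    by (rule tendsto_cong_uhp[OF _ f_eq_q(3)]) (use tendsto_mult[OF q0 lim(3)] in simp)
qed

lemma f1_f3: "\<tau> \<in> uhp \<Longrightarrow> f1 \<tau> * f3 \<tau> = eta (5 * \<tau>) / eta_pow (1/5) \<tau>"
proof -
  assume \<tau>: "\<tau> \<in> uhp"
  have "f1 \<tau> * f3 \<tau> = exp (- 3 / 5 * log_eta \<tau>) * exp (- 3 / 5 * log_eta \<tau>) * (theta 5 1 \<tau> * theta 5 3 \<tau>)"
    by (simp only: f13_eq[OF \<tau>] mult_ac)
  also have "\<dots> = exp (- 3 / 5 * log_eta \<tau> + - 3 / 5 * log_eta \<tau> + log_eta \<tau>) * eta (5 * \<tau>)"
    by (simp only: theta5_mult[OF \<tau>] eta_eq[OF \<tau>] exp_add mult.assoc)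
  also have "- 3 / 5 * log_eta \<tau> + - 3 / 5 * log_eta \<tau> + log_eta \<tau> = - (1 / 5 * log_eta \<tau>)"
    by (simp add: field_simps)
  finally have "f1 \<tau> * f3 \<tau> = inverse (exp (1 / 5 * log_eta \<tau>)) * eta (5 * \<tau>)"
    by (simp only: exp_minus)
  moreover have "eta_pow (1 / 5) \<tau> = exp (1 / 5 * log_eta \<tau>)"
    using eta_pow_eq[OF \<tau>, of "1/5"] by (simp only: of_real_divide of_real_1 of_real_numeral)
  ultimately show ?thesis by (simp only: divide_inverse mult.commute)
qed

lemma f_nonzero: "\<tau> \<in> uhp \<Longrightarrow> f1 \<tau> \<noteq> 0" "\<tau> \<in> uhp \<Longrightarrow> f3 \<tau> \<noteq> 0"
proof -
  have "f1 \<tau> * f3 \<tau> \<noteq> 0" if \<tau>: "\<tau> \<in> uhp" for \<tau>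
  proof -
    have "5 * \<tau> \<in> uhp" using \<tau> by (simp add: uhp_def)
    then show ?thesis unfolding f1_f3[OF \<tau>] by (simp add: eta_eq eta_pow_nonzero[OF \<tau>])
  qed
  then show "\<tau> \<in> uhp \<Longrightarrow> f1 \<tau> \<noteq> 0" "\<tau> \<in> uhp \<Longrightarrow> f3 \<tau> \<noteq> 0" by auto
qed

lemma eta_pow_holomorphic: "eta_pow r holomorphic_on uhp"
proof (rule holomorphic_transform)
  show "(\<lambda>\<tau>. exp (of_real r * log_eta \<tau>)) holomorphic_on uhp"
    by (intro holomorphic_intros log_eta_holomorphic)
qed (simp add: eta_pow_eq)

lemma f_holomorphic: "f1 holomorphic_on uhp" "f3 holomorphic_on uhp"
  by (rule holomorphic_transform[of "\<lambda>\<tau>. exp (- 3 / 5 * log_eta \<tau>) * theta 5 1 \<tau>"],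
      intro holomorphic_intros log_eta_holomorphic theta51.theta_holomorphic, simp only: f13_eq,
      rule holomorphic_transform[of "\<lambda>\<tau>. exp (- 3 / 5 * log_eta \<tau>) * theta 5 3 \<tau>"],
      intro holomorphic_intros log_eta_holomorphic theta53.theta_holomorphic, simp only: f13_eq)


section \<open>The ring of modular forms\<close>

lemma moebius_holomorphic:
  assumes "A \<in> SL2Z"
  shows "moebius_map A holomorphic_on uhp" "denom A holomorphic_on uhp"
proof -
  have d: "denom A holomorphic_on uhp"
    unfolding denom_def[abs_def] by (intro holomorphic_intros)
  then show "moebius_map A holomorphic_on uhp" "denom A holomorphic_on uhp"
    unfolding moebius_map_def[abs_def] using denom_nonzero[OF assms] by (auto intro!: holomorphic_intros)
qed

lemma holomorphic_moebius_compose: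
  assumes "f holomorphic_on uhp" "A \<in> SL2Z"
  shows "(\<lambda>\<tau>. f (moebius_map A \<tau>)) holomorphic_on uhp"
  by (rule holomorphic_on_compose_gen[unfolded o_def, OF moebius_holomorphic(1)[OF assms(2)] assms(1)])
     (use moebius_in_uhp[OF assms(2)] in auto)

lemma slash_holomorphic:
  assumes "f holomorphic_on uhp" "A \<in> SL2Z"
  shows "slash k f A holomorphic_on uhp"
proof -
  have "(\<lambda>\<tau>. denom A \<tau> ^ 5 * (h \<tau> / h (moebius_map A \<tau>))\<^sup>2) holomorphic_on uhp"
    using eta_pow_nonzero[OF moebius_in_uhp[OF assms(2)]]
    by (intro holomorphic_on_mult holomorphic_on_power holomorphic_on_divide moebius_holomorphic assms
        eta_pow_holomorphic holomorphic_moebius_compose[OF eta_pow_holomorphic]) auto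
  then have "J15 A holomorphic_on uhp" by (simp add: J15_def[abs_def])
  then show ?thesis
    unfolding slash_def[abs_def] using J15_nonzero[OF assms(2)]
    by (intro holomorphic_on_divide holomorphic_on_power holomorphic_moebius_compose assms) auto
qed

lemma slash_cong:
  assumes "\<And>\<tau>. \<tau> \<in> uhp \<Longrightarrow> f \<tau> = g \<tau>" "A \<in> SL2Z" "\<tau> \<in> uhp"
  shows "slash k f A \<tau> = slash k g A \<tau>"
  using assms moebius_in_uhp by (simp add: slash_def)

lemma modular_forms_iff:
  "f \<in> modular_forms k \<longleftrightarrow> f \<in> extensional uhp \<and> f holomorphic_on uhp \<and>
     (\<forall>A\<in>\<Gamma>5. \<forall>\<tau>\<in>uhp. slash k f A \<tau> = f \<tau>) \<and> (\<forall>A\<in>SL2Z. Bfun (slash k f A) at_i_infinity)"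
proof -
  have "Bfun (abs_slash k f A) at_i_infinity \<longleftrightarrow> Bfun (slash k f A) at_i_infinity" if "A \<in> SL2Z" for A
  proof -
    have *: "eventually (\<lambda>\<tau>. norm (abs_slash k f A \<tau>) = norm (slash k f A \<tau>)) at_i_infinity"
      using eventually_uhp by eventually_elim (simp add: abs_slash_eq[OF that])
    then have **: "eventually (\<lambda>\<tau>. norm (slash k f A \<tau>) = norm (abs_slash k f A \<tau>)) at_i_infinity"
      by (auto elim: eventually_mono)
    show ?thesis
      using Bfun_cong_norm[OF _ *] Bfun_cong_norm[OF _ **] by (rule iffI[rotated])
  qed
  then show ?thesis by (auto simp: modular_forms_def invariant_iff_slash)
qed

lemma cusp_forms_iff:
  "f \<in> cusp_forms k \<longleftrightarrow> f \<in> modular_forms k \<and> (\<forall>A\<in>SL2Z. (slash k f A \<longlongrightarrow> 0) at_i_infinity)"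
proof -
  have "(abs_slash k f A \<longlongrightarrow> 0) at_i_infinity \<longleftrightarrow> (slash k f A \<longlongrightarrow> 0) at_i_infinity" if "A \<in> SL2Z" for A
  proof -
    have "(abs_slash k f A \<longlongrightarrow> 0) at_i_infinity \<longleftrightarrow> ((\<lambda>\<tau>. norm (slash k f A \<tau>)) \<longlongrightarrow> 0) at_i_infinity"
      by (rule tendsto_cong) (use eventually_uhp abs_slash_eq[OF that] in \<open>auto elim: eventually_mono\<close>)
    then show ?thesis by (simp add: tendsto_norm_zero_iff)
  qed
  then show ?thesis by (auto simp: cusp_forms_def)
qed

lemma slash_q_expansion:
  assumes f: "f \<in> modular_forms k" and A: "A \<in> SL2Z"
  obtains g where "g holomorphic_on ball 0 1" "\<And>\<tau>. \<tau> \<in> uhp \<Longrightarrow> slash k f A \<tau> = g (q5 \<tau>)"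
    "(slash k f A \<longlongrightarrow> g 0) at_i_infinity"
proof -
  have inv: "invariant_of_weight k f" using f by (simp add: modular_forms_def)
  have "slash k f A (\<tau> + 5) = slash k f A \<tau>" if \<tau>: "\<tau> \<in> uhp" for \<tau>
  proof -
    have J: "J15 (T_mat 5) \<tau> = 1"
      unfolding J15_T[OF \<tau>] using cos_int_2pin[of "-2"] sin_int_2pin[of "-2"] by (simp add: complex_eq_iff)
    have "mat_cong (T_mat 5) (mat 1)" by (simp add: mat_cong_iff T_mat_def cong_def)
    then have cong: "mat_cong (A ** T_mat 5) A"
      using mat_cong_mult[OF mat_cong_refl[of A]] by fastforce
    have "slash k f A (\<tau> + 5) = slash k f (A ** T_mat 5) \<tau>"
      using slash_mult_matrix[OF A T_S_inv2_SL2Z(1) \<tau>, of k f 5] by (simp add: J moebius_simps)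
    also have "\<dots> = slash k f A \<tau>"
      by (rule slash_cong_class[OF inv SL2Z_mult[OF A T_S_inv2_SL2Z(1)] A cong \<tau>])
    finally show ?thesis .
  qed
  moreover have "slash k f A holomorphic_on uhp" "Bfun (slash k f A) at_i_infinity"
    using f A slash_holomorphic by (auto simp: modular_forms_iff)
  ultimately obtain g where g: "g holomorphic_on ball 0 1" "\<And>\<tau>. \<tau> \<in> uhp \<Longrightarrow> slash k f A \<tau> = g (q5 \<tau>)"
    using q_expansion by metis
  have "(slash k f A \<longlongrightarrow> g 0) at_i_infinity"
    by (rule tendsto_cong_uhp[OF holomorphic_tendsto_at_i_infinity[OF g(1)] g(2)]) auto
  with g show ?thesis by (rule that)
qed

lemma modular_forms_q_expansion:
  assumes f: "f \<in> modular_forms k"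
  obtains g where "g holomorphic_on ball 0 1" "\<And>\<tau>. \<tau> \<in> uhp \<Longrightarrow> f \<tau> = g (q5 \<tau>)" "(f \<longlongrightarrow> g 0) at_i_infinity"
proof -
  obtain g where g: "g holomorphic_on ball 0 1" "\<And>\<tau>. \<tau> \<in> uhp \<Longrightarrow> slash k f (mat 1) \<tau> = g (q5 \<tau>)"
    "(slash k f (mat 1) \<longlongrightarrow> g 0) at_i_infinity"
    using slash_q_expansion[OF f SL2Z_1] by metis
  have "slash k f (mat 1) \<tau> = f \<tau>" if "\<tau> \<in> uhp" for \<tau>
    using that by (simp add: slash_def moebius_simps)
  then show ?thesis
    using that[OF g(1)] g(2) tendsto_cong_uhp[OF g(3), of f] by simp
qed

subsection \<open>Closure properties\<close>

lemma holomorphic_restrict: "f holomorphic_on uhp \<Longrightarrow> restrict f uhp holomorphic_on uhp"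
  by (rule holomorphic_transform) auto

lemma restrict_in_modular_forms:
  assumes "f holomorphic_on uhp" "\<And>A \<tau>. A \<in> \<Gamma>5 \<Longrightarrow> \<tau> \<in> uhp \<Longrightarrow> slash k f A \<tau> = f \<tau>"
    "\<And>A. A \<in> SL2Z \<Longrightarrow> Bfun (slash k f A) at_i_infinity"
  shows "restrict f uhp \<in> modular_forms k"
  unfolding modular_forms_iff
proof (intro conjI ballI)
  have eq: "slash k (restrict f uhp) A \<tau> = slash k f A \<tau>" if "A \<in> SL2Z" "\<tau> \<in> uhp" for A \<tau>
    by (rule slash_cong[OF _ that]) simp
  show "slash k (restrict f uhp) A \<tau> = restrict f uhp \<tau>" if "A \<in> \<Gamma>5" "\<tau> \<in> uhp" for A \<tau>
    using that assms(2) eq by (simp add: Gamma5_iff)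
  show "Bfun (slash k (restrict f uhp) A) at_i_infinity" if "A \<in> SL2Z" for A
    by (rule Bfun_cong_norm[OF assms(3)[OF that]]) (use eventually_uhp eq[OF that] in \<open>auto elim: eventually_mono\<close>)
qed (use assms(1) in \<open>auto intro: holomorphic_restrict\<close>)

lemma Bfun_slash_iff_tendsto: "f \<in> modular_forms k \<Longrightarrow> A \<in> SL2Z \<Longrightarrow> \<exists>c. (slash k f A \<longlongrightarrow> c) at_i_infinity"
  using slash_q_expansion by metis

lemma modular_forms_add:
  assumes "f \<in> modular_forms k" "g \<in> modular_forms k"
  shows "(\<lambda>\<tau>\<in>uhp. f \<tau> + g \<tau>) \<in> modular_forms k"
proof (rule restrict_in_modular_forms)
  have eq: "slash k (\<lambda>\<tau>. f \<tau> + g \<tau>) A = (\<lambda>\<tau>. slash k f A \<tau> + slash k g A \<tau>)" for A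
    by (simp add: slash_def[abs_def] add_divide_distrib)
  show "(\<lambda>\<tau>. f \<tau> + g \<tau>) holomorphic_on uhp"
    using assms by (auto simp: modular_forms_iff intro!: holomorphic_intros)
  show "slash k (\<lambda>\<tau>. f \<tau> + g \<tau>) A \<tau> = f \<tau> + g \<tau>" if "A \<in> \<Gamma>5" "\<tau> \<in> uhp" for A \<tau>
    unfolding eq using assms that by (simp add: modular_forms_iff)
  show "Bfun (slash k (\<lambda>\<tau>. f \<tau> + g \<tau>) A) at_i_infinity" if "A \<in> SL2Z" for A
    unfolding eq using Bfun_slash_iff_tendsto[OF assms(1) that] Bfun_slash_iff_tendsto[OF assms(2) that]
    by (metis Bfun_if_tendsto tendsto_add)
qed

lemma modular_forms_mult:
  assumes "f \<in> modular_forms k" "g \<in> modular_forms l"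
  shows "(\<lambda>\<tau>\<in>uhp. f \<tau> * g \<tau>) \<in> modular_forms (k + l)"
proof (rule restrict_in_modular_forms)
  have eq: "slash (k + l) (\<lambda>\<tau>. f \<tau> * g \<tau>) A = (\<lambda>\<tau>. slash k f A \<tau> * slash l g A \<tau>)" for A
    by (simp add: slash_def[abs_def] power_add)
  show "(\<lambda>\<tau>. f \<tau> * g \<tau>) holomorphic_on uhp"
    using assms by (auto simp: modular_forms_iff intro!: holomorphic_intros)
  show "slash (k + l) (\<lambda>\<tau>. f \<tau> * g \<tau>) A \<tau> = f \<tau> * g \<tau>" if "A \<in> \<Gamma>5" "\<tau> \<in> uhp" for A \<tau>
    unfolding eq using assms that by (simp add: modular_forms_iff)
  show "Bfun (slash (k + l) (\<lambda>\<tau>. f \<tau> * g \<tau>) A) at_i_infinity" if "A \<in> SL2Z" for A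
    unfolding eq using Bfun_slash_iff_tendsto[OF assms(1) that] Bfun_slash_iff_tendsto[OF assms(2) that]
    by (metis Bfun_if_tendsto tendsto_mult)
qed

lemma modular_forms_const: "(\<lambda>\<tau>\<in>uhp. c) \<in> modular_forms 0"
  by (rule restrict_in_modular_forms) (auto simp: slash_def[abs_def])

lemma modular_forms_zero: "(\<lambda>\<tau>\<in>uhp. 0) \<in> modular_forms k"
  by (rule restrict_in_modular_forms) (auto simp: slash_def[abs_def])

lemma modular_forms_scale:
  assumes "f \<in> modular_forms k"
  shows "(\<lambda>\<tau>\<in>uhp. c * f \<tau>) \<in> modular_forms k"
proof -
  have "(\<lambda>\<tau>\<in>uhp. c * f \<tau>) = (\<lambda>\<tau>\<in>uhp. (\<lambda>\<tau>\<in>uhp. c) \<tau> * f \<tau>)"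
    by (auto simp: restrict_def)
  then show ?thesis using modular_forms_mult[OF modular_forms_const assms] by simp
qed

lemma modular_forms_sum:
  assumes "finite I" "\<And>i. i \<in> I \<Longrightarrow> f i \<in> modular_forms k"
  shows "(\<lambda>\<tau>\<in>uhp. \<Sum>i\<in>I. f i \<tau>) \<in> modular_forms k"
  using assms
proof (induction I)
  case empty
  show ?case unfolding sum.empty by (rule modular_forms_zero)
next
  case (insert i I)
  have eq: "(\<lambda>\<tau>\<in>uhp. \<Sum>i\<in>insert i I. f i \<tau>) = (\<lambda>\<tau>\<in>uhp. f i \<tau> + (\<lambda>\<tau>\<in>uhp. \<Sum>i\<in>I. f i \<tau>) \<tau>)"
    using insert.hyps by (auto simp: restrict_def)
  have "(\<lambda>\<tau>\<in>uhp. \<Sum>i\<in>I. f i \<tau>) \<in> modular_forms k"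
    by (rule insert.IH) (use insert.prems in auto)
  then show ?case unfolding eq by (rule modular_forms_add[OF insert.prems[OF insertI1]])
qed

lemma modular_forms_power:
  assumes "f \<in> modular_forms k"
  shows "(\<lambda>\<tau>\<in>uhp. f \<tau> ^ n) \<in> modular_forms (n * k)"
proof (induction n)
  case 0
  show ?case unfolding power_0 mult_0 by (rule modular_forms_const)
next
  case (Suc n)
  have eq: "(\<lambda>\<tau>\<in>uhp. f \<tau> ^ Suc n) = (\<lambda>\<tau>\<in>uhp. f \<tau> * (\<lambda>\<tau>\<in>uhp. f \<tau> ^ n) \<tau>)"
    by (auto simp: restrict_def)
  show ?case unfolding eq mult_Suc by (rule modular_forms_mult[OF assms Suc])
qed

lemma f_in_modular_forms: "restrict f1 uhp \<in> modular_forms 1" "restrict f3 uhp \<in> modular_forms 1"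
proof -
  have lim: "\<exists>c. (slash 1 f1 A \<longlongrightarrow> c) at_i_infinity" "\<exists>c. (slash 1 f3 A \<longlongrightarrow> c) at_i_infinity" if A: "A \<in> SL2Z" for A
  proof -
    obtain R where R: "acts A R" using bruhat_acts[OF A] .
    have l: "((\<lambda>\<tau>. x * f1 \<tau> + y * f3 \<tau>) \<longlongrightarrow> x * 1 + y * 0) at_i_infinity" for x y
      by (intro tendsto_intros f_tendsto)
    show "\<exists>c. (slash 1 f1 A \<longlongrightarrow> c) at_i_infinity" "\<exists>c. (slash 1 f3 A \<longlongrightarrow> c) at_i_infinity"
      using R tendsto_cong_uhp[OF l] unfolding acts_def by blast+
  qed
  have inv: "slash 1 f1 A \<tau> = f1 \<tau>" "slash 1 f3 A \<tau> = f3 \<tau>" if "A \<in> \<Gamma>5" "\<tau> \<in> uhp" for A \<tau>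
    using acts_Gamma5[OF that(1)] that(2) unfolding acts_def mat_1_nth by simp_all
  show "restrict f1 uhp \<in> modular_forms 1"
    by (rule restrict_in_modular_forms[OF f_holomorphic(1) inv(1)]) (use lim(1) Bfun_if_tendsto in blast)+
  show "restrict f3 uhp \<in> modular_forms 1"
    by (rule restrict_in_modular_forms[OF f_holomorphic(2) inv(2)]) (use lim(2) Bfun_if_tendsto in blast)+
qed

lemma slash_h:
  assumes A: "A \<in> SL2Z" and \<tau>: "\<tau> \<in> uhp"
  shows "slash 12 h A \<tau> = h \<tau>"
proof -
  let ?x = "h \<tau>" and ?y = "h (moebius_map A \<tau>)" and ?d = "denom A \<tau>"
  have nz: "?x \<noteq> 0" "?y \<noteq> 0" "?d \<noteq> 0"
    using eta_pow_nonzero \<tau> moebius_in_uhp[OF A \<tau>] denom_nonzero[OF A \<tau>] by auto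
  have "?y * ?y ^ 24 = (?y ^ 5) ^ 5" by (simp flip: power_Suc power_mult)
  also have "\<dots> = ?d ^ 60 * ?x ^ 25"
    unfolding Delta_moebius[OF A \<tau>] by (simp add: power_mult_distrib flip: power_mult)
  finally have "?y * ?y ^ 24 = ?x * (?d ^ 60 * ?x ^ 24)"
    by (simp add: mult.left_commute flip: power_Suc)
  moreover have "J15 A \<tau> ^ 12 = ?d ^ 60 * ?x ^ 24 / ?y ^ 24"
    by (simp add: J15_def power_mult_distrib power_divide flip: power_mult)
  then have "?d ^ 60 * ?x ^ 24 = J15 A \<tau> ^ 12 * ?y ^ 24" using nz by simp
  ultimately have "?y * ?y ^ 24 = (?x * J15 A \<tau> ^ 12) * ?y ^ 24" by (simp only: mult.assoc)
  then have "?y = ?x * J15 A \<tau> ^ 12" using nz by (simp only: mult_right_cancel power_not_zero not_False_eq_True)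
  then show ?thesis
    using J15_nonzero[OF A \<tau>] by (simp add: slash_def)
qed

lemma h_in_modular_forms: "restrict h uhp \<in> modular_forms 12"
proof (rule restrict_in_modular_forms[OF eta_pow_holomorphic])
  show "slash 12 h A \<tau> = h \<tau>" if "A \<in> \<Gamma>5" "\<tau> \<in> uhp" for A \<tau>
    using slash_h that by (simp add: Gamma5_iff)
  show "Bfun (slash 12 h A) at_i_infinity" if "A \<in> SL2Z" for A
    by (rule Bfun_if_tendsto[OF tendsto_cong_uhp[OF f_tendsto(3) slash_h[OF that]]])
qed

subsection \<open>Forms of weight zero are constant\<close>

theorem modular_forms_0_constant:
  assumes f: "f \<in> modular_forms 0"
  obtains c where "\<And>\<tau>. \<tau> \<in> uhp \<Longrightarrow> f \<tau> = c"
proof -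
  obtain F where F: "finite F" "F \<subseteq> SL2Z" "\<And>A. A \<in> SL2Z \<Longrightarrow> \<exists>B\<in>F. mat_cong A B"
    using finite_classes by blast
  have inv: "invariant_of_weight 0 f" using f by (simp add: modular_forms_def)
  have "\<forall>A\<in>SL2Z. \<exists>g. g holomorphic_on ball 0 1 \<and> (\<forall>\<tau>\<in>uhp. slash 0 f A \<tau> = g (q5 \<tau>))"
    using slash_q_expansion[OF f] by metis
  then obtain G where G: "\<And>A. A \<in> SL2Z \<Longrightarrow> G A holomorphic_on ball 0 1"
    "\<And>A \<tau>. A \<in> SL2Z \<Longrightarrow> \<tau> \<in> uhp \<Longrightarrow> slash 0 f A \<tau> = G A (q5 \<tau>)"
    by metis
  define \<rho> where "\<rho> = exp (- (pi / 5))"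
  have \<rho>: "0 < \<rho>" "\<rho> < 1" by (auto simp: \<rho>_def)
  define K where "K = cball (0 :: complex) \<rho>"
  have K: "compact K" "K \<noteq> {}" "K \<subseteq> ball 0 1" "0 \<in> K" using \<rho> by (auto simp: K_def)
  have "\<exists>w\<in>K. \<forall>w'\<in>K. norm (G A w') \<le> norm (G A w)" if "A \<in> SL2Z" for A
    using G(1)[OF that] K by (intro continuous_attains_sup) (auto intro!: continuous_intros dest: holomorphic_on_imp_continuous_on continuous_on_subset)
  then obtain W where W: "\<And>A. A \<in> SL2Z \<Longrightarrow> W A \<in> K" "\<And>A w. A \<in> SL2Z \<Longrightarrow> w \<in> K \<Longrightarrow> norm (G A w) \<le> norm (G A (W A))"
    by metis
  have "F \<noteq> {}" using F(3)[OF SL2Z_1] by blast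
  then have fin: "finite ((\<lambda>A. norm (G A (W A))) ` F)" "(\<lambda>A. norm (G A (W A))) ` F \<noteq> {}"
    using F(1) by auto
  obtain A0 where A0: "A0 \<in> F" "\<And>A. A \<in> F \<Longrightarrow> norm (G A (W A)) \<le> norm (G A0 (W A0))"
  proof -
    from Max_in[OF fin] obtain A0 where A0: "A0 \<in> F" "norm (G A0 (W A0)) = Max ((\<lambda>A. norm (G A (W A))) ` F)"
      by auto
    have "norm (G A (W A)) \<le> norm (G A0 (W A0))" if "A \<in> F" for A
      unfolding A0(2) by (rule Max_ge[OF fin(1) imageI[OF that]])
    with A0(1) show ?thesis by (rule that)
  qed
  have A0S: "A0 \<in> SL2Z" using A0(1) F(2) by blast
  define M where "M = norm (G A0 (W A0))"
  have f_le: "norm (f \<tau>) \<le> M" if \<tau>: "\<tau> \<in> uhp" for \<tau>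
  proof -
    obtain B where B: "B \<in> SL2Z" "Im (moebius_map B \<tau>) \<ge> 1 / 2" using exists_large_Im[OF \<tau>] .
    define \<sigma> where "\<sigma> = moebius_map B \<tau>"
    have \<sigma>: "\<sigma> \<in> uhp" unfolding \<sigma>_def by (rule moebius_in_uhp[OF B(1) \<tau>])
    obtain C where C: "C \<in> F" "mat_cong (inv2 B) C" using F(3)[OF T_S_inv2_SL2Z(3)[OF B(1)]] by blast
    have CS: "C \<in> SL2Z" using C(1) F(2) by blast
    have "f \<tau> = slash 0 f (inv2 B) \<sigma>"
      using moebius_inv2(1)[OF B(1) \<tau>] by (simp add: slash_def \<sigma>_def)
    also have "\<dots> = slash 0 f C \<sigma>"
      by (rule slash_cong_class[OF inv T_S_inv2_SL2Z(3)[OF B(1)] CS C(2) \<sigma>])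
    also have "\<dots> = G C (q5 \<sigma>)" by (rule G(2)[OF CS \<sigma>])
    finally have "f \<tau> = G C (q5 \<sigma>)" .
    moreover have "q5 \<sigma> \<in> K"
    proof -
      have "pi * (1 / 2) \<le> pi * Im \<sigma>" using B(2) by (intro mult_left_mono) (auto simp: \<sigma>_def)
      then show ?thesis by (simp add: K_def \<rho>_def norm_q_pow)
    qed
    ultimately show ?thesis
      using W(2)[OF CS, of "q5 \<sigma>"] A0(2)[OF C(1)] by (simp add: M_def)
  qed
  have G_le: "norm (G A0 w) \<le> M" if w: "w \<in> ball 0 1" for w
  proof -
    have "continuous_on (ball 0 1) (\<lambda>w. norm (G A0 w))"
      by (intro continuous_on_norm holomorphic_on_imp_continuous_on G(1) A0S)
    show ?thesis
    proof (cases "w = 0")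
      case True
      then show ?thesis using W(2)[OF A0S K(4)] by (simp add: M_def)
    next
      case False
      define \<tau> where "\<tau> = 5 * Ln w / (2 * of_real pi * \<i>)"
      have e: "2 * complex_of_real pi * \<i> * complex_of_real (1/5) * \<tau> = Ln w" by (simp add: \<tau>_def)
      have q: "q5 \<tau> = w" using False unfolding q_pow_def e by simp
      have \<tau>: "\<tau> \<in> uhp"
      proof (rule ccontr)
        assume "\<tau> \<notin> uhp"
        then have "norm (q5 \<tau>) \<ge> 1" unfolding norm_q_pow uhp_def by (simp add: mult_nonneg_nonpos)
        with q w show False by simp
      qed
      have "G A0 w = slash 0 f A0 \<tau>" using G(2)[OF A0S \<tau>] q by simp
      also have "\<dots> = f (moebius_map A0 \<tau>)" by (simp add: slash_def)
      finally show ?thesis using f_le[OF moebius_in_uhp[OF A0S \<tau>]] by simp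
    qed
  qed
  have "G A0 constant_on ball 0 1"
  proof (rule maximum_modulus_principle[OF G(1)[OF A0S] open_ball _ open_ball subset_refl])
    show "W A0 \<in> ball 0 1" using W(1)[OF A0S] K(3) by blast
    show "norm (G A0 z) \<le> norm (G A0 (W A0))" if "z \<in> ball 0 1" for z
      using G_le[OF that] by (simp add: M_def)
  qed auto
  then obtain c where c: "\<And>w. w \<in> ball 0 1 \<Longrightarrow> G A0 w = c" by (auto simp: constant_on_def)
  show ?thesis
  proof (rule that[of c])
    fix \<tau> assume \<tau>: "\<tau> \<in> uhp"
    define \<sigma> where "\<sigma> = moebius_map (inv2 A0) \<tau>"
    have \<sigma>: "\<sigma> \<in> uhp" unfolding \<sigma>_def by (rule moebius_in_uhp[OF T_S_inv2_SL2Z(3)[OF A0S] \<tau>])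
    have "f \<tau> = slash 0 f A0 \<sigma>" using moebius_inv2(2)[OF A0S \<tau>] by (simp add: slash_def \<sigma>_def)
    also have "\<dots> = c" using G(2)[OF A0S \<sigma>] c q_pow_in_ball[OF \<sigma>] by simp
    finally show "f \<tau> = c" .
  qed
qed

subsection \<open>Division by \<open>f\<^sub>5\<^sub>,\<^sub>3\<close> and by \<open>\<eta>\<^sup>2\<^sup>4\<^sup>/\<^sup>5\<close>\<close>

lemma slash_divide:
  assumes "A \<in> SL2Z" "\<tau> \<in> uhp" "l \<le> k" "g (moebius_map A \<tau>) \<noteq> 0"
  shows "slash (k - l) (\<lambda>\<tau>. f \<tau> / g \<tau>) A \<tau> = slash k f A \<tau> / slash l g A \<tau>"
proof -
  have "J15 A \<tau> ^ k = J15 A \<tau> ^ (k - l) * J15 A \<tau> ^ l" using assms(3) by (simp flip: power_add)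
  then show ?thesis using J15_nonzero[OF assms(1,2)] assms(4) by (simp add: slash_def field_simps)
qed

lemma divide_in_modular_forms:
  assumes f: "f \<in> modular_forms k" and g: "restrict g uhp \<in> modular_forms l" and lk: "l \<le> k"
    and nz: "\<And>\<tau>. \<tau> \<in> uhp \<Longrightarrow> g \<tau> \<noteq> 0" and g_hol: "g holomorphic_on uhp"
    and bdd: "\<And>A. A \<in> SL2Z \<Longrightarrow> Bfun (\<lambda>\<tau>. slash k f A \<tau> / slash l g A \<tau>) at_i_infinity"
  shows "(\<lambda>\<tau>\<in>uhp. f \<tau> / g \<tau>) \<in> modular_forms (k - l)"
proof (rule restrict_in_modular_forms)
  have eq: "slash (k - l) (\<lambda>\<tau>. f \<tau> / g \<tau>) A \<tau> = slash k f A \<tau> / slash l g A \<tau>" if "A \<in> SL2Z" "\<tau> \<in> uhp" for A \<tau>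
    by (rule slash_divide[where g = g, OF that lk nz[OF moebius_in_uhp[OF that]]])
  show "(\<lambda>\<tau>. f \<tau> / g \<tau>) holomorphic_on uhp"
    using f g_hol nz by (intro holomorphic_on_divide) (auto simp: modular_forms_iff)
  show "slash (k - l) (\<lambda>\<tau>. f \<tau> / g \<tau>) A \<tau> = f \<tau> / g \<tau>" if A: "A \<in> \<Gamma>5" and \<tau>: "\<tau> \<in> uhp" for A \<tau>
  proof -
    have AS: "A \<in> SL2Z" using A by (simp add: Gamma5_iff)
    have "slash l g A \<tau> = slash l (restrict g uhp) A \<tau>" by (rule slash_cong[OF _ AS \<tau>]) simp
    also have "\<dots> = g \<tau>" using g A \<tau> by (simp add: modular_forms_iff)
    finally have "slash l g A \<tau> = g \<tau>" .
    moreover have "slash k f A \<tau> = f \<tau>" using f A \<tau> by (simp add: modular_forms_iff)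
    ultimately show ?thesis by (simp add: eq[OF AS \<tau>])
  qed
  show "Bfun (slash (k - l) (\<lambda>\<tau>. f \<tau> / g \<tau>) A) at_i_infinity" if A: "A \<in> SL2Z" for A
    by (rule Bfun_cong_norm[OF bdd[OF A]]) (use eventually_uhp eq[OF A] in \<open>auto elim: eventually_mono\<close>)
qed

lemma norm_J15_triangular:
  assumes "s = 1 \<or> s = -1" "\<tau> \<in> uhp"
  shows "norm (J15 (mat2 s (s * b) 0 s) \<tau>) = 1" "moebius_map (mat2 s (s * b) 0 s) \<tau> = \<tau> + of_int b"
proof -
  have S: "mat2 s (s * b) 0 s \<in> SL2Z" using assms(1) by (auto simp: SL2Z_iff)
  have "norm (denom (mat2 s (s * b) 0 s) \<tau>) = 1" using assms(1) by (auto simp: denom_def)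
  then show "norm (J15 (mat2 s (s * b) 0 s) \<tau>) = 1" using norm_J15[OF S assms(2)] by simp
  show "moebius_map (mat2 s (s * b) 0 s) \<tau> = \<tau> + of_int b"
    using assms(1) by (auto simp: moebius_map_def denom_def)
qed

theorem divide_f3:
  assumes f: "f \<in> modular_forms k" and k: "k \<ge> 1" and lim: "(f \<longlongrightarrow> 0) at_i_infinity"
  shows "(\<lambda>\<tau>\<in>uhp. f \<tau> / f3 \<tau>) \<in> modular_forms (k - 1)"
proof (rule divide_in_modular_forms[OF f f_in_modular_forms(2) k f_nonzero(2) f_holomorphic(2)])
  fix A assume A: "A \<in> SL2Z"
  have inv: "invariant_of_weight k f" using f by (simp add: modular_forms_def)
  show "Bfun (\<lambda>\<tau>. slash k f A \<tau> / slash 1 f3 A \<tau>) at_i_infinity"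
    using A
  proof (cases rule: acts_cases)
    case (1 R)
    obtain c where c: "(slash k f A \<longlongrightarrow> c) at_i_infinity" using Bfun_slash_iff_tendsto[OF f A] by blast
    have "((\<lambda>\<tau>. R$2$1 * f1 \<tau> + R$2$2 * f3 \<tau>) \<longlongrightarrow> R$2$1 * 1 + R$2$2 * 0) at_i_infinity"
      by (intro tendsto_intros f_tendsto)
    then have "(slash 1 f3 A \<longlongrightarrow> R$2$1 * 1 + R$2$2 * 0) at_i_infinity"
      by (rule tendsto_cong_uhp) (use 1(1) in \<open>simp add: acts_def\<close>)
    with c have "((\<lambda>\<tau>. slash k f A \<tau> / slash 1 f3 A \<tau>) \<longlongrightarrow> c / (R$2$1 * 1 + R$2$2 * 0)) at_i_infinity"
      by (rule tendsto_divide) (use 1(2) in simp)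
    then show ?thesis by (rule Bfun_if_tendsto)
  next
    case (2 R s b)
    define B where "B = mat2 s (s * b) 0 s"
    have B: "B \<in> SL2Z" using 2(4) by (auto simp: SL2Z_iff B_def)
    obtain g where g: "g holomorphic_on ball 0 1" "\<And>\<tau>. \<tau> \<in> uhp \<Longrightarrow> f \<tau> = g (q5 \<tau>)" "(f \<longlongrightarrow> g 0) at_i_infinity"
      using modular_forms_q_expansion[OF f] by metis
    have "g 0 = 0" using tendsto_unique[OF at_i_infinity_nontrivial g(3) lim] .
    then obtain g' where g': "g' holomorphic_on ball 0 1" "\<And>w. w \<in> ball 0 1 \<Longrightarrow> g w = w * g' w"
      using holomorphic_factor_zero[OF g(1)] by blast
    have norm_eq: "norm (slash k f A \<tau> / slash 1 f3 A \<tau>) = norm (g' (q5 (\<tau> + of_int b)) / (R$2$2 * f3_q (q_pow 1 \<tau>)))"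
      if \<tau>: "\<tau> \<in> uhp" for \<tau>
    proof -
      have \<tau>b: "\<tau> + of_int b \<in> uhp" using \<tau> by (simp add: uhp_def)
      have "slash k f A \<tau> = slash k f B \<tau>"
        by (rule slash_cong_class[OF inv A B _ \<tau>]) (use 2(5) in \<open>simp add: B_def\<close>)
      also have "norm \<dots> = norm (f (\<tau> + of_int b))"
        using norm_J15_triangular[OF 2(4) \<tau>] by (simp add: slash_def B_def norm_divide norm_power)
      also have "\<dots> = norm (q5 \<tau>) * norm (g' (q5 (\<tau> + of_int b)))"
        using g(2)[OF \<tau>b] g'(2)[OF q_pow_in_ball[OF \<tau>b, of "1/5"]] by (simp add: norm_mult norm_q_pow)
      finally have 1: "norm (slash k f A \<tau>) = norm (q5 \<tau>) * norm (g' (q5 (\<tau> + of_int b)))" .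
      have "slash 1 f3 A \<tau> = R$2$2 * f3 \<tau>" using 2(1,2) \<tau> by (simp add: acts_def)
      then have "norm (slash 1 f3 A \<tau>) = norm (q5 \<tau>) * norm (R$2$2 * f3_q (q_pow 1 \<tau>))"
        by (simp add: f_eq_q(2)[OF \<tau>] norm_mult)
      with 1 show ?thesis by (simp add: norm_divide)
    qed
    have q5b: "((\<lambda>\<tau>. q5 (\<tau> + of_int b)) \<longlongrightarrow> 0) at_i_infinity"
    proof (rule tendsto_norm_zero_cancel)
      have "((\<lambda>\<tau>. norm (q5 \<tau>)) \<longlongrightarrow> 0) at_i_infinity" by (intro tendsto_norm_zero q_pow_tendsto_0) simp
      then show "((\<lambda>\<tau>. norm (q5 (\<tau> + of_int b))) \<longlongrightarrow> 0) at_i_infinity" by (simp add: norm_q_pow)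
    qed
    have "isCont g' 0"
      using holomorphic_on_imp_continuous_on[OF g'(1)] by (simp add: continuous_on_eq_continuous_at)
    from isCont_tendsto_compose[OF this q5b]
    have "((\<lambda>\<tau>. g' (q5 (\<tau> + of_int b)) / (R$2$2 * f3_q (q_pow 1 \<tau>))) \<longlongrightarrow> g' 0 / (R$2$2 * f3_q 0)) at_i_infinity"
      using 2(3) by (intro tendsto_intros holomorphic_tendsto_at_i_infinity f_q_holomorphic) (auto simp: f_q_0)
    from Bfun_if_tendsto[OF this] show ?thesis
      by (rule Bfun_cong_norm) (use eventually_uhp norm_eq in \<open>auto elim: eventually_mono\<close>)
  qed
qed

lemma cusp_form_slash_factor:
  assumes f: "f \<in> cusp_forms k" and A: "A \<in> SL2Z"
  obtains g c where "g = (\<lambda>\<tau>. slash k f A \<tau> / slash 12 h A \<tau>)" "(g \<longlongrightarrow> c) at_i_infinity"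
proof -
  have f': "f \<in> modular_forms k" "(slash k f A \<longlongrightarrow> 0) at_i_infinity" using f A by (auto simp: cusp_forms_iff)
  obtain g where g: "g holomorphic_on ball 0 1" "\<And>\<tau>. \<tau> \<in> uhp \<Longrightarrow> slash k f A \<tau> = g (q5 \<tau>)" "(slash k f A \<longlongrightarrow> g 0) at_i_infinity"
    using slash_q_expansion[OF f'(1) A] by metis
  have "g 0 = 0" using tendsto_unique[OF at_i_infinity_nontrivial g(3) f'(2)] .
  then obtain g' where g': "g' holomorphic_on ball 0 1" "\<And>w. w \<in> ball 0 1 \<Longrightarrow> g w = w * g' w"
    using holomorphic_factor_zero[OF g(1)] by blast
  have "((\<lambda>\<tau>. g' (q5 \<tau>) / h_q (q_pow 1 \<tau>)) \<longlongrightarrow> g' 0 / h_q 0) at_i_infinity"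
    by (intro tendsto_divide holomorphic_tendsto_at_i_infinity g' f_q_holomorphic) (auto simp: f_q_0)
  then have "((\<lambda>\<tau>. slash k f A \<tau> / slash 12 h A \<tau>) \<longlongrightarrow> g' 0 / h_q 0) at_i_infinity"
    by (rule tendsto_cong_uhp) (use g(2) g'(2) q_pow_in_ball slash_h[OF A] f_eq_q(3) in simp)
  then show ?thesis by (rule that[OF refl])
qed

theorem divide_h:
  assumes f: "f \<in> cusp_forms k" and k: "k \<ge> 12"
  shows "(\<lambda>\<tau>\<in>uhp. f \<tau> / h \<tau>) \<in> modular_forms (k - 12)"
proof (rule divide_in_modular_forms[OF _ h_in_modular_forms k eta_pow_nonzero eta_pow_holomorphic])
  show "f \<in> modular_forms k" using f by (simp add: cusp_forms_iff)
  show "Bfun (\<lambda>\<tau>. slash k f A \<tau> / slash 12 h A \<tau>) at_i_infinity" if "A \<in> SL2Z" for A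
    using cusp_form_slash_factor[OF f that] Bfun_if_tendsto by metis
qed

theorem cusp_forms_small_weight:
  assumes f: "f \<in> cusp_forms k" and k: "k < 12" and \<tau>: "\<tau> \<in> uhp"
  shows "f \<tau> = 0"
proof -
  define F where "F = (\<lambda>\<tau>\<in>uhp. f \<tau> ^ 12)"
  define H where "H = (\<lambda>\<tau>. h \<tau> ^ k)"
  have fm: "f \<in> modular_forms k" using f by (simp add: cusp_forms_iff)
  have F: "F \<in> modular_forms (12 * k)" unfolding F_def by (rule modular_forms_power[OF fm])
  have "(\<lambda>\<tau>\<in>uhp. restrict h uhp \<tau> ^ k) \<in> modular_forms (k * 12)" by (rule modular_forms_power[OF h_in_modular_forms])
  moreover have "(\<lambda>\<tau>\<in>uhp. restrict h uhp \<tau> ^ k) = restrict H uhp" by (auto simp: H_def restrict_def)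
  ultimately have H: "restrict H uhp \<in> modular_forms (12 * k)" by (simp add: mult.commute)
  have lim: "((\<lambda>\<tau>. slash (12 * k) F A \<tau> / slash (12 * k) H A \<tau>) \<longlongrightarrow> 0) at_i_infinity" if A: "A \<in> SL2Z" for A
  proof -
    obtain c where c: "((\<lambda>\<tau>. slash k f A \<tau> / slash 12 h A \<tau>) \<longlongrightarrow> c) at_i_infinity"
      using cusp_form_slash_factor[OF f A] by metis
    have "((\<lambda>\<tau>. (slash k f A \<tau> / slash 12 h A \<tau>) ^ 12 * h \<tau> ^ (12 - k)) \<longlongrightarrow> c ^ 12 * 0 ^ (12 - k)) at_i_infinity"
      by (intro tendsto_intros c f_tendsto)
    then have "((\<lambda>\<tau>. (slash k f A \<tau> / slash 12 h A \<tau>) ^ 12 * h \<tau> ^ (12 - k)) \<longlongrightarrow> 0) at_i_infinity"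
      using k by (simp add: power_0_left)
    then show ?thesis
    proof (rule tendsto_cong_uhp)
      fix \<tau> assume \<tau>: "\<tau> \<in> uhp"
      have "slash (12 * k) F A \<tau> = slash k f A \<tau> ^ 12"
        using moebius_in_uhp[OF A \<tau>] by (simp add: slash_def F_def power_divide mult.commute flip: power_mult)
      moreover have "slash (12 * k) H A \<tau> = slash 12 h A \<tau> ^ k"
        by (simp add: slash_def H_def power_divide flip: power_mult)
      moreover have "h \<tau> ^ 12 = h \<tau> ^ (12 - k) * h \<tau> ^ k" using k by (simp flip: power_add)
      ultimately show "slash (12 * k) F A \<tau> / slash (12 * k) H A \<tau> = (slash k f A \<tau> / slash 12 h A \<tau>) ^ 12 * h \<tau> ^ (12 - k)"
        using eta_pow_nonzero[OF \<tau>, of "24/5"] by (simp add: slash_h[OF A \<tau>] power_divide)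
    qed
  qed
  have "(\<lambda>\<tau>\<in>uhp. F \<tau> / H \<tau>) \<in> modular_forms (12 * k - 12 * k)"
  proof (rule divide_in_modular_forms[OF F H order_refl])
    show "H \<tau> \<noteq> 0" if "\<tau> \<in> uhp" for \<tau> using eta_pow_nonzero[OF that] by (simp add: H_def)
    show "H holomorphic_on uhp" unfolding H_def by (intro holomorphic_intros eta_pow_holomorphic)
  qed (rule Bfun_if_tendsto[OF lim])
  then obtain c where c: "\<And>\<tau>. \<tau> \<in> uhp \<Longrightarrow> F \<tau> / H \<tau> = c"
    using modular_forms_0_constant[of "\<lambda>\<tau>\<in>uhp. F \<tau> / H \<tau>"] by (metis diff_self_eq_0 restrict_apply')
  have "((\<lambda>\<tau>. F \<tau> / H \<tau>) \<longlongrightarrow> 0) at_i_infinity"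
    by (rule tendsto_cong_uhp[OF lim[OF SL2Z_1]]) (simp add: slash_def moebius_simps)
  moreover have "((\<lambda>\<tau>. F \<tau> / H \<tau>) \<longlongrightarrow> c) at_i_infinity"
    by (rule tendsto_cong_uhp[OF tendsto_const c])
  ultimately have "c = 0" using tendsto_unique[OF at_i_infinity_nontrivial] by blast
  with c[OF \<tau>] show ?thesis
    using \<tau> eta_pow_nonzero[OF \<tau>] by (simp add: F_def H_def)
qed


section \<open>Generators of the ring of modular forms\<close>

lemma subalgebra_scale:
  assumes "f \<in> subalgebra_generated G"
  shows "(\<lambda>\<tau>\<in>uhp. c * f \<tau>) \<in> subalgebra_generated G"
proof -
  have eq: "(\<lambda>\<tau>\<in>uhp. c * f \<tau>) = (\<lambda>\<tau>\<in>uhp. (\<lambda>\<tau>\<in>uhp. c) \<tau> * f \<tau>)"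
    by (auto simp: restrict_def)
  show ?thesis
    unfolding eq by (rule subalgebra_generated.mult[OF subalgebra_generated.const assms])
qed

lemma subalgebra_power:
  assumes "f \<in> subalgebra_generated G"
  shows "(\<lambda>\<tau>\<in>uhp. f \<tau> ^ n) \<in> subalgebra_generated G"
proof (induction n)
  case 0
  show ?case unfolding power_0 by (rule subalgebra_generated.const)
next
  case (Suc n)
  have eq: "(\<lambda>\<tau>\<in>uhp. f \<tau> ^ Suc n) = (\<lambda>\<tau>\<in>uhp. f \<tau> * (\<lambda>\<tau>\<in>uhp. f \<tau> ^ n) \<tau>)"
    by (auto simp: restrict_def)
  show ?case unfolding eq by (rule subalgebra_generated.mult[OF assms Suc])
qed

lemma subalgebra_sum:
  assumes "finite I" "\<And>i. i \<in> I \<Longrightarrow> f i \<in> subalgebra_generated G"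
  shows "(\<lambda>\<tau>\<in>uhp. \<Sum>i\<in>I. f i \<tau>) \<in> subalgebra_generated G"
  using assms
proof (induction I)
  case empty
  show ?case unfolding sum.empty by (rule subalgebra_generated.const)
next
  case (insert i I)
  have eq: "(\<lambda>\<tau>\<in>uhp. \<Sum>i\<in>insert i I. f i \<tau>) = (\<lambda>\<tau>\<in>uhp. f i \<tau> + (\<lambda>\<tau>\<in>uhp. \<Sum>i\<in>I. f i \<tau>) \<tau>)"
    using insert.hyps by (auto simp: restrict_def)
  have "(\<lambda>\<tau>\<in>uhp. \<Sum>i\<in>I. f i \<tau>) \<in> subalgebra_generated G"
    by (rule insert.IH) (use insert.prems in auto)
  then show ?case unfolding eq by (rule subalgebra_generated.add[OF insert.prems[OF insertI1]])
qed

lemma subalgebra_generated_subset: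
  assumes "\<And>g. g \<in> G \<Longrightarrow> restrict g uhp \<in> subalgebra_generated H"
  shows "subalgebra_generated G \<subseteq> subalgebra_generated H"
proof
  fix f assume "f \<in> subalgebra_generated G"
  then show "f \<in> subalgebra_generated H"
    by induction (rule subalgebra_generated.intros assms; assumption)+
qed

lemma modular_forms_extensional: "f \<in> modular_forms k \<Longrightarrow> f = restrict f uhp"
  by (simp add: modular_forms_iff extensional_restrict)

lemma modular_forms_subset_subalgebra:
  assumes "f \<in> modular_forms k"
  shows "f \<in> subalgebra_generated {f1, f3}"
  using assms
proof (induction k arbitrary: f)
  case 0
  obtain c where c: "\<And>\<tau>. \<tau> \<in> uhp \<Longrightarrow> f \<tau> = c" using modular_forms_0_constant[OF 0] by metis
  have "f = restrict f uhp" by (rule modular_forms_extensional[OF 0])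
  also have "\<dots> = (\<lambda>\<tau>\<in>uhp. c)" by (rule restrict_ext) (rule c)
  finally show ?case by (simp only: subalgebra_generated.const)
next
  case (Suc k)
  have gen: "restrict f1 uhp \<in> subalgebra_generated {f1, f3}" "restrict f3 uhp \<in> subalgebra_generated {f1, f3}"
    by (rule subalgebra_generated.gen, rule insertI1,
        rule subalgebra_generated.gen, rule insertI2, rule singletonI)
  obtain c where c: "(f \<longlongrightarrow> c) at_i_infinity"
    using modular_forms_q_expansion[OF Suc.prems] by metis
  define P where "P = (\<lambda>\<tau>\<in>uhp. restrict f1 uhp \<tau> ^ Suc k)"
  define f0 where "f0 = (\<lambda>\<tau>\<in>uhp. f \<tau> + (\<lambda>\<tau>\<in>uhp. - c * P \<tau>) \<tau>)"
  define f' where "f' = (\<lambda>\<tau>\<in>uhp. f0 \<tau> / f3 \<tau>)"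
  have "P \<in> modular_forms (Suc k * 1)"
    unfolding P_def by (rule modular_forms_power[OF f_in_modular_forms(1)])
  then have "f0 \<in> modular_forms (Suc k)"
    unfolding f0_def mult_1_right by (intro modular_forms_add modular_forms_scale Suc.prems)
  moreover have "(f0 \<longlongrightarrow> 0) at_i_infinity"
  proof -
    have "((\<lambda>\<tau>. f \<tau> + - c * f1 \<tau> ^ Suc k) \<longlongrightarrow> c + - c * 1 ^ Suc k) at_i_infinity"
      by (intro tendsto_intros c f_tendsto)
    then have "((\<lambda>\<tau>. f \<tau> + - c * f1 \<tau> ^ Suc k) \<longlongrightarrow> 0) at_i_infinity" unfolding power_one by simp
    then show ?thesis by (rule tendsto_cong_uhp) (simp only: f0_def P_def restrict_apply' if_True)
  qed
  ultimately have "f' \<in> modular_forms (Suc k - 1)"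
    unfolding f'_def by (intro divide_f3) simp_all
  then have f': "f' \<in> subalgebra_generated {f1, f3}" unfolding diff_Suc_1 by (rule Suc.IH)
  have "(\<lambda>\<tau>\<in>uhp. (\<lambda>\<tau>\<in>uhp. c * P \<tau>) \<tau> + (\<lambda>\<tau>\<in>uhp. restrict f3 uhp \<tau> * f' \<tau>) \<tau>) \<in> subalgebra_generated {f1, f3}"
    unfolding P_def by (intro subalgebra_generated.add subalgebra_generated.mult subalgebra_scale subalgebra_power gen f')
  moreover have "(\<lambda>\<tau>\<in>uhp. (\<lambda>\<tau>\<in>uhp. c * P \<tau>) \<tau> + (\<lambda>\<tau>\<in>uhp. restrict f3 uhp \<tau> * f' \<tau>) \<tau>) = restrict f uhp"
  proof (rule restrict_ext)
    fix \<tau> assume \<tau>: "\<tau> \<in> uhp"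
    have "f3 \<tau> * f' \<tau> = f \<tau> - c * P \<tau>"
      using f_nonzero(2)[OF \<tau>] \<tau> by (simp only: f'_def f0_def restrict_apply' if_True) simp
    then show "(\<lambda>\<tau>\<in>uhp. c * P \<tau>) \<tau> + (\<lambda>\<tau>\<in>uhp. restrict f3 uhp \<tau> * f' \<tau>) \<tau> = f \<tau>"
      using \<tau> by (simp only: restrict_apply' if_True) simp
  qed
  ultimately show ?case using modular_forms_extensional[OF Suc.prems] by simp
qed

lemma sum_in_modular_forms_ring:
  assumes I: "finite I" and f: "\<And>i. i \<in> I \<Longrightarrow> f i \<in> modular_forms (d i)"
  shows "(\<lambda>\<tau>\<in>uhp. \<Sum>i\<in>I. f i \<tau>) \<in> modular_forms_ring"
proof -
  define g where "g k = (\<lambda>\<tau>\<in>uhp. \<Sum>i\<in>{i\<in>I. d i = k}. f i \<tau>)" for k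
  have "g k \<in> modular_forms k" for k
    unfolding g_def using I f by (intro modular_forms_sum) auto
  moreover have "(\<lambda>\<tau>\<in>uhp. \<Sum>i\<in>I. f i \<tau>) = (\<lambda>\<tau>\<in>uhp. \<Sum>k\<in>d ` I. g k \<tau>)"
    by (rule restrict_ext) (simp add: g_def sum.group[OF I, of "d ` I" d] I)
  ultimately show ?thesis
    unfolding modular_forms_ring_def graded_sum_def using I by blast
qed

lemma modular_forms_ringE:
  assumes "f \<in> modular_forms_ring"
  obtains K g where "finite K" "\<And>k. k \<in> K \<Longrightarrow> g k \<in> modular_forms k" "f = (\<lambda>\<tau>\<in>uhp. \<Sum>k\<in>K. g k \<tau>)"
  using assms unfolding modular_forms_ring_def graded_sum_def by blast

lemma modular_forms_subset_ring: "f \<in> modular_forms k \<Longrightarrow> f \<in> modular_forms_ring"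
  using sum_in_modular_forms_ring[of "{k}" "\<lambda>_. f" "\<lambda>_. k"] modular_forms_extensional[of f k] by simp

theorem modular_forms_ring_eq: "modular_forms_ring = subalgebra_generated {f1, f3}"
proof (intro equalityI subsetI)
  fix f assume "f \<in> modular_forms_ring"
  then obtain K g where K: "finite K" "\<And>k. k \<in> K \<Longrightarrow> g k \<in> modular_forms k" and f: "f = (\<lambda>\<tau>\<in>uhp. \<Sum>k\<in>K. g k \<tau>)"
    using modular_forms_ringE by metis
  show "f \<in> subalgebra_generated {f1, f3}"
    unfolding f by (rule subalgebra_sum[OF K(1)]) (rule modular_forms_subset_subalgebra[OF K(2)])
next
  fix f assume "f \<in> subalgebra_generated {f1, f3}"
  then show "f \<in> modular_forms_ring"
  proof induction
    case (const c)
    show ?case by (rule modular_forms_subset_ring[OF modular_forms_const])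
  next
    case (gen g)
    then have "restrict g uhp \<in> modular_forms 1" using f_in_modular_forms by (elim insertE emptyE) (simp_all only:)
    then show ?case by (rule modular_forms_subset_ring)
  next
    case (add f g)
    obtain K \<phi> where K: "finite K" "\<And>k. k \<in> K \<Longrightarrow> \<phi> k \<in> modular_forms k" and f: "f = (\<lambda>\<tau>\<in>uhp. \<Sum>k\<in>K. \<phi> k \<tau>)"
      using modular_forms_ringE[OF add.IH(1)] by metis
    obtain L \<psi> where L: "finite L" "\<And>k. k \<in> L \<Longrightarrow> \<psi> k \<in> modular_forms k" and g: "g = (\<lambda>\<tau>\<in>uhp. \<Sum>k\<in>L. \<psi> k \<tau>)"
      using modular_forms_ringE[OF add.IH(2)] by metis
    have "(\<lambda>\<tau>\<in>uhp. \<Sum>i\<in>K <+> L. case_sum \<phi> \<psi> i \<tau>) \<in> modular_forms_ring"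
      by (rule sum_in_modular_forms_ring[of _ _ "case_sum (\<lambda>k. k) (\<lambda>k. k)"]) (use K L in auto)
    moreover have "(\<lambda>\<tau>\<in>uhp. \<Sum>i\<in>K <+> L. case_sum \<phi> \<psi> i \<tau>) = (\<lambda>\<tau>\<in>uhp. f \<tau> + g \<tau>)"
      by (rule restrict_ext) (simp add: f g sum.Plus[OF K(1) L(1)])
    ultimately show ?case by (simp only:)
  next
    case (mult f g)
    obtain K \<phi> where K: "finite K" "\<And>k. k \<in> K \<Longrightarrow> \<phi> k \<in> modular_forms k" and f: "f = (\<lambda>\<tau>\<in>uhp. \<Sum>k\<in>K. \<phi> k \<tau>)"
      using modular_forms_ringE[OF mult.IH(1)] by metis
    obtain L \<psi> where L: "finite L" "\<And>k. k \<in> L \<Longrightarrow> \<psi> k \<in> modular_forms k" and g: "g = (\<lambda>\<tau>\<in>uhp. \<Sum>k\<in>L. \<psi> k \<tau>)"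
      using modular_forms_ringE[OF mult.IH(2)] by metis
    have "(\<lambda>\<tau>\<in>uhp. \<Sum>i\<in>K \<times> L. (\<lambda>\<tau>\<in>uhp. \<phi> (fst i) \<tau> * \<psi> (snd i) \<tau>) \<tau>) \<in> modular_forms_ring"
    proof (rule sum_in_modular_forms_ring)
      show "(\<lambda>\<tau>\<in>uhp. \<phi> (fst i) \<tau> * \<psi> (snd i) \<tau>) \<in> modular_forms (fst i + snd i)" if "i \<in> K \<times> L" for i
        using that by (intro modular_forms_mult K L) auto
    qed (use K L in simp)
    moreover have "(\<lambda>\<tau>\<in>uhp. \<Sum>i\<in>K \<times> L. (\<lambda>\<tau>\<in>uhp. \<phi> (fst i) \<tau> * \<psi> (snd i) \<tau>) \<tau>) = (\<lambda>\<tau>\<in>uhp. f \<tau> * g \<tau>)"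
      by (rule restrict_ext) (simp add: f g sum_product sum.cartesian_product split_beta)
    ultimately show ?case by (simp only:)
  qed
qed

section \<open>The ideal of cusp forms\<close>

lemma cusp_forms_mult_h:
  assumes f: "f \<in> modular_forms k"
  shows "(\<lambda>\<tau>\<in>uhp. f \<tau> * h \<tau>) \<in> cusp_forms (k + 12)"
proof -
  have eq: "(\<lambda>\<tau>\<in>uhp. f \<tau> * h \<tau>) = (\<lambda>\<tau>\<in>uhp. f \<tau> * restrict h uhp \<tau>)" by (auto simp: restrict_def)
  have m: "(\<lambda>\<tau>\<in>uhp. f \<tau> * h \<tau>) \<in> modular_forms (k + 12)"
    unfolding eq by (rule modular_forms_mult[OF f h_in_modular_forms])
  have "(slash (k + 12) (\<lambda>\<tau>\<in>uhp. f \<tau> * h \<tau>) A \<longlongrightarrow> 0) at_i_infinity" if A: "A \<in> SL2Z" for A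
  proof -
    obtain c where c: "(slash k f A \<longlongrightarrow> c) at_i_infinity" using slash_q_expansion[OF f A] by metis
    have "((\<lambda>\<tau>. slash k f A \<tau> * h \<tau>) \<longlongrightarrow> c * 0) at_i_infinity"
      by (intro tendsto_mult c f_tendsto)
    then have "((\<lambda>\<tau>. slash k f A \<tau> * h \<tau>) \<longlongrightarrow> 0) at_i_infinity" by simp
    then show ?thesis
    proof (rule tendsto_cong_uhp)
      fix \<tau> assume \<tau>: "\<tau> \<in> uhp"
      have "slash (k + 12) (\<lambda>\<tau>\<in>uhp. f \<tau> * h \<tau>) A \<tau> = slash k f A \<tau> * slash 12 h A \<tau>"
        using moebius_in_uhp[OF A \<tau>] by (simp add: slash_def power_add)
      then show "slash (k + 12) (\<lambda>\<tau>\<in>uhp. f \<tau> * h \<tau>) A \<tau> = slash k f A \<tau> * h \<tau>"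
        by (simp only: slash_h[OF A \<tau>])
    qed
  qed
  with m show ?thesis by (simp add: cusp_forms_iff)
qed

theorem cusp_forms_ideal_eq: "cusp_forms_ideal = (\<lambda>f. \<lambda>\<tau>\<in>uhp. f \<tau> * h \<tau>) ` modular_forms_ring"
proof (intro equalityI subsetI)
  fix f assume "f \<in> cusp_forms_ideal"
  then obtain K g where K: "finite K" and g: "\<And>k. k \<in> K \<Longrightarrow> g k \<in> cusp_forms k" and f: "f = (\<lambda>\<tau>\<in>uhp. \<Sum>k\<in>K. g k \<tau>)"
    unfolding cusp_forms_ideal_def graded_sum_def by blast
  let ?L = "{k\<in>K. 12 \<le> k}"
  define \<phi> where "\<phi> k = (\<lambda>\<tau>\<in>uhp. g k \<tau> / h \<tau>)" for k
  have "(\<lambda>\<tau>\<in>uhp. \<Sum>k\<in>?L. \<phi> k \<tau>) \<in> modular_forms_ring"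
  proof (rule sum_in_modular_forms_ring)
    show "\<phi> k \<in> modular_forms (k - 12)" if "k \<in> ?L" for k
      unfolding \<phi>_def by (rule divide_h[OF g]) (use that in auto)
  qed (use K in simp)
  moreover have "f = (\<lambda>\<tau>\<in>uhp. (\<lambda>\<tau>\<in>uhp. \<Sum>k\<in>?L. \<phi> k \<tau>) \<tau> * h \<tau>)"
    unfolding f
  proof (rule restrict_ext)
    fix \<tau> assume \<tau>: "\<tau> \<in> uhp"
    have "g k \<tau> = 0" if "k \<in> K - ?L" for k
      by (rule cusp_forms_small_weight[OF g _ \<tau>]) (use that in auto)
    then have "(\<Sum>k\<in>K. g k \<tau>) = (\<Sum>k\<in>?L. g k \<tau>)"
      using K by (intro sum.mono_neutral_right ballI) auto
    also have "\<dots> = (\<Sum>k\<in>?L. \<phi> k \<tau> * h \<tau>)"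
      using \<tau> eta_pow_nonzero[OF \<tau>] by (simp add: \<phi>_def)
    finally show "(\<Sum>k\<in>K. g k \<tau>) = (\<lambda>\<tau>\<in>uhp. \<Sum>k\<in>?L. \<phi> k \<tau>) \<tau> * h \<tau>"
      using \<tau> by (simp add: sum_distrib_right)
  qed
  ultimately show "f \<in> (\<lambda>f. \<lambda>\<tau>\<in>uhp. f \<tau> * h \<tau>) ` modular_forms_ring" by blast
next
  fix f assume "f \<in> (\<lambda>f. \<lambda>\<tau>\<in>uhp. f \<tau> * h \<tau>) ` modular_forms_ring"
  then obtain e where e: "e \<in> modular_forms_ring" and f: "f = (\<lambda>\<tau>\<in>uhp. e \<tau> * h \<tau>)" by blast
  obtain K g where K: "finite K" "\<And>k. k \<in> K \<Longrightarrow> g k \<in> modular_forms k" and e: "e = (\<lambda>\<tau>\<in>uhp. \<Sum>k\<in>K. g k \<tau>)"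
    using modular_forms_ringE[OF e] by metis
  define \<phi> where "\<phi> l = (\<lambda>\<tau>\<in>uhp. g (l - 12) \<tau> * h \<tau>)" for l
  have "f = (\<lambda>\<tau>\<in>uhp. \<Sum>l\<in>(\<lambda>k. k + 12) ` K. \<phi> l \<tau>)"
    unfolding f e by (rule restrict_ext) (simp add: \<phi>_def sum.reindex sum_distrib_right)
  moreover have "\<phi> l \<in> cusp_forms l" if "l \<in> (\<lambda>k. k + 12) ` K" for l
  proof -
    obtain k where k: "k \<in> K" "l = k + 12" using \<open>l \<in> _\<close> by blast
    show ?thesis unfolding k(2) \<phi>_def diff_add_inverse2 by (rule cusp_forms_mult_h[OF K(2)[OF k(1)]])
  qed
  ultimately show "f \<in> cusp_forms_ideal"
    unfolding cusp_forms_ideal_def graded_sum_def using K(1) by blast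
qed

section \<open>The second pair of generators\<close>

lemma eta_fifth:
  assumes \<tau>: "\<tau> \<in> uhp"
  shows "eta (\<tau> / 5) / eta_pow (1/5) \<tau> = (f1 \<tau>)\<^sup>2 - f1 \<tau> * f3 \<tau> - (f3 \<tau>)\<^sup>2"
proof -
  define L where "L = Ln (- \<i> * \<tau>)"
  define S S' where "S = complex_of_real cS" and "S' = complex_of_real cS'"
  define w where "w = complex_of_real (sqrt 5)"
  have w0: "w \<noteq> 0" by (simp add: w_def)
  have S: "S * S' * w = 1" "(S\<^sup>2 - S'\<^sup>2) * w = 1"
  proof -
    define A B where "A = - (\<zeta> + 2 * \<zeta>^2 - 2 * \<zeta>^3 - \<zeta>^4) / 5" and "B = - (2 * \<zeta> - \<zeta>^2 + \<zeta>^3 - 2 * \<zeta>^4) / 5"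
    have AB: "- \<i> * S = A" "- \<i> * S' = B"
      unfolding S_def S'_def A_def B_def by (rule cS_zeta)+
    have "5 * A = - (\<zeta> + 2 * \<zeta>^2 - 2 * \<zeta>^3 - \<zeta>^4)" "5 * B = - (2 * \<zeta> - \<zeta>^2 + \<zeta>^3 - 2 * \<zeta>^4)"
      unfolding A_def B_def by simp_all
    then have "25 * (A * B * w) = - 25" "25 * ((A^2 - B^2) * w) = - 25"
      unfolding w_def sqrt5_zeta using zeta_cyclotomic by algebra+
    moreover have "x = - 1" if "25 * x = - 25" for x :: complex
      using that mult_left_cancel[of "25::complex" x "- 1"] by simp
    ultimately have "A * B * w = - 1" "(A^2 - B^2) * w = - 1" by blast+
    then show "S * S' * w = 1" "(S\<^sup>2 - S'\<^sup>2) * w = 1"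
      unfolding AB[symmetric] by (simp_all add: power_mult_distrib algebra_simps)
  qed
  have \<tau>5: "\<tau> / 5 \<in> uhp" using \<tau> by (simp add: uhp_def)
  have inv: "5 * (- 1 / \<tau>) = - 1 / (\<tau> / 5)" by simp
  have "Ln (- \<i> * (\<tau> / 5)) = L - of_real (ln 5)"
    using Ln_divide_of_real[of 5 "- \<i> * \<tau>"] uhp_nonzero[OF \<tau>] by (simp add: L_def)
  moreover have "exp (complex_of_real (ln 5) / 2) = w"
  proof -
    have "exp (complex_of_real (ln 5) / 2) = of_real (exp (ln 5 / 2))"
      by (simp flip: exp_of_real)
    also have "exp (ln 5 / 2) = sqrt (5::real)"
      by (simp flip: ln_sqrt)
    finally show ?thesis unfolding w_def .
  qed
  ultimately have c: "csqrt_tau (\<tau> / 5) * w = exp (L / 2)"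
    unfolding csqrt_tau_def by (simp add: diff_divide_distrib exp_diff w0)
  have eta5: "eta (5 * (- 1 / \<tau>)) = csqrt_tau (\<tau> / 5) * eta (\<tau> / 5)"
    unfolding inv by (rule eta_inversion[OF \<tau>5])
  have pow: "eta_pow (1/5) (- 1 / \<tau>) = eta_pow (1/5) \<tau> * exp (L / 10)"
    unfolding eta_pow_eq[OF inversion_in_uhp[OF \<tau>]] eta_pow_eq[OF \<tau>] log_eta_inversion[OF \<tau>] L_def exp_add[symmetric]
    by (simp add: field_simps)
  have e: "exp (L / 2) = exp (L / 5) * exp (L / 5) * exp (L / 10)"
    unfolding exp_add[symmetric] by (rule arg_cong[of _ _ exp]) simp
  have nz: "eta_pow (1/5) \<tau> \<noteq> 0" "exp (L / 10) \<noteq> 0" "exp (L / 5) \<noteq> 0"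
    using eta_pow_nonzero[OF \<tau>] by simp_all
  define X where "X = eta (\<tau> / 5) / eta_pow (1/5) \<tau>"
  have "f1 (- 1 / \<tau>) * f3 (- 1 / \<tau>) * w = (csqrt_tau (\<tau> / 5) * w) * eta (\<tau> / 5) / (eta_pow (1/5) \<tau> * exp (L / 10))"
    unfolding f1_f3[OF inversion_in_uhp[OF \<tau>]] eta5 pow by (simp only: times_divide_eq_left times_divide_eq_right mult_ac)
  also have "\<dots> = exp (L / 5) * exp (L / 5) * X"
    unfolding c e X_def using nz by (simp add: field_simps)
  finally have "exp (L / 5) * exp (L / 5) * X = exp (L / 5) * exp (L / 5) * ((S * f1 \<tau> + S' * f3 \<tau>) * (S' * f1 \<tau> - S * f3 \<tau>) * w)"
    unfolding f5_inversion[OF \<tau>] L_def S_def S'_def by (simp only: mult_ac)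
  then have "X = (S * f1 \<tau> + S' * f3 \<tau>) * (S' * f1 \<tau> - S * f3 \<tau>) * w"
    using nz by (simp only: mult_cancel_left mult_eq_0_iff simp_thms)
  also have "\<dots> = (S * S' * w) * (f1 \<tau>)\<^sup>2 - ((S\<^sup>2 - S'\<^sup>2) * w) * (f1 \<tau> * f3 \<tau>) - (S * S' * w) * (f3 \<tau>)\<^sup>2"
    by algebra
  also have "\<dots> = (f1 \<tau>)\<^sup>2 - f1 \<tau> * f3 \<tau> - (f3 \<tau>)\<^sup>2"
    unfolding S by (simp only: mult_1_left)
  finally show ?thesis unfolding X_def .
qed

lemma eta_chi5_radicand_eq:
  assumes "\<tau> \<in> uhp"
  shows "eta_chi5_radicand \<tau> = (f1 \<tau> - \<i> * f3 \<tau>)\<^sup>2"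
proof -
  have "(x\<^sup>2 - x * y - y\<^sup>2) + (1 - 2 * \<i>) * (x * y) = (x - \<i> * y)\<^sup>2" for x y
    by (simp add: power2_eq_square algebra_simps)
  then show ?thesis
    unfolding eta_chi5_radicand_def eta_fifth[OF assms] f1_f3[OF assms, symmetric] .
qed

definition f_comb_q :: "complex \<Rightarrow> complex \<Rightarrow> complex" where
  "f_comb_q s w = f1_q (w ^ 5) + s * (w * f3_q (w ^ 5))"

lemma f_comb_q: "\<tau> \<in> uhp \<Longrightarrow> f1 \<tau> + s * f3 \<tau> = f_comb_q s (q5 \<tau>)"
proof -
  have "q_pow 1 \<tau> = q5 \<tau> ^ 5" using q_pow_power[of "1/5" \<tau> 5] by simp
  then show "\<tau> \<in> uhp \<Longrightarrow> ?thesis" unfolding f_comb_q_def by (simp only: f_eq_q)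
qed

lemma f_comb_q_holomorphic: "f_comb_q s holomorphic_on ball 0 1"
proof -
  have p: "(\<lambda>w::complex. w ^ 5) holomorphic_on ball 0 1" "(\<lambda>w::complex. w ^ 5) ` ball 0 1 \<subseteq> ball 0 1"
    by (auto intro!: holomorphic_intros simp: norm_power power_less_one_iff)
  note c = holomorphic_on_compose_gen[unfolded o_def, OF p(1) _ p(2)]
  show ?thesis
    unfolding f_comb_q_def[abs_def]
    by (intro holomorphic_on_add holomorphic_on_mult holomorphic_on_const holomorphic_on_ident c f_q_holomorphic)
qed

lemma f_comb_q_0: "f_comb_q s 0 = 1"
  by (simp add: f_comb_q_def f_q_0)

lemma q5_sums_unique:
  assumes g: "g holomorphic_on ball 0 1"
    and sums: "\<And>\<tau>. \<tau> \<in> uhp \<Longrightarrow> (\<lambda>n. fps_nth G n * q5 \<tau> ^ n) sums g (q5 \<tau>)"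
  shows "G = fps_expansion g 0"
proof -
  have ge_1: "fps_conv_radius G \<ge> 1"
    unfolding fps_conv_radius_def
  proof (rule conv_radius_geI_ex)
    fix r :: real assume r: "0 < r" "ereal r < 1"
    define \<tau> where "\<tau> = \<i> * of_real (- 5 * ln r / (2 * pi))"
    have "\<tau> \<in> uhp" using r by (simp add: \<tau>_def uhp_def divide_less_0_iff)
    then have "summable (\<lambda>n. fps_nth G n * q5 \<tau> ^ n)" by (rule sums_summable[OF sums])
    moreover have "norm (q5 \<tau>) = r" using r by (simp add: norm_q_pow \<tau>_def)
    ultimately show "\<exists>z. norm z = r \<and> summable (\<lambda>n. fps_nth G n * z ^ n)" by blast
  qed
  have less: "ereal t < fps_conv_radius G" if "t < 1" for t
  proof -
    have "ereal t < 1" using that by simp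
    then show ?thesis using ge_1 by (rule less_le_trans)
  qed
  have rad: "fps_conv_radius G > 0" using less[of 0] by (simp add: zero_ereal_def)
  have hol: "eval_fps G holomorphic_on ball 0 1"
    by (intro holomorphic_on_eval_fps) (auto intro: less)
  have eq: "eval_fps G w = g w" if "w \<in> ball 0 1" for w
  proof (rule holomorphic_eq_if_eq_on_uhp[OF hol g _ that])
    show "eval_fps G (q5 \<tau>) = g (q5 \<tau>)" if "\<tau> \<in> uhp" for \<tau>
      using sums_unique[OF sums[OF that]] by (simp add: eval_fps_def)
  qed
  have "eventually (\<lambda>w. w \<in> ball 0 1) (nhds (0::complex))"
    by (intro eventually_nhds_in_open) auto
  then have "eventually (\<lambda>w. eval_fps G w = g w) (nhds 0)"
    by (rule eventually_mono) (rule eq)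
  with rad have "g has_fps_expansion G" by (simp add: has_fps_expansion_def)
  then show ?thesis by (rule fps_expansion_eqI[symmetric])
qed

lemma fps_expansion_sums:
  assumes "g holomorphic_on ball 0 1" "norm w < 1"
  shows "(\<lambda>n. fps_nth (fps_expansion g 0) n * w ^ n) sums g w"
proof (rule has_fps_expansion_imp_sums_complex[where r = "ereal 1"])
  show "g has_fps_expansion fps_expansion g 0"
    by (rule has_fps_expansion_fps_expansion[OF open_ball _ assms(1)]) simp
qed (use assms in simp_all)

lemma eta_chi5_radicand_fps_eq: "eta_chi5_radicand_fps = (fps_expansion (f_comb_q (- \<i>)) 0)\<^sup>2"
proof -
  let ?g = "\<lambda>w. f_comb_q (- \<i>) w * f_comb_q (- \<i>) w"
  have hol: "?g holomorphic_on ball 0 1"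
    by (intro holomorphic_on_mult f_comb_q_holomorphic)
  have rad: "eta_chi5_radicand \<tau> = ?g (q5 \<tau>)" if "\<tau> \<in> uhp" for \<tau>
    unfolding eta_chi5_radicand_eq[OF that] f_comb_q[OF that, symmetric] by (simp add: power2_eq_square)
  have "eta_chi5_radicand_fps = fps_expansion ?g 0"
    unfolding eta_chi5_radicand_fps_def
  proof (rule the_equality)
    show "\<forall>\<tau>\<in>uhp. (\<lambda>n. fps_nth (fps_expansion ?g 0) n * q5 \<tau> ^ n) sums eta_chi5_radicand \<tau>"
    proof
      fix \<tau> assume \<tau>: "\<tau> \<in> uhp"
      have "norm (q5 \<tau>) < 1" using q_pow_in_ball[OF \<tau>, of "1/5"] by simp
      then show "(\<lambda>n. fps_nth (fps_expansion ?g 0) n * q5 \<tau> ^ n) sums eta_chi5_radicand \<tau>"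
        unfolding rad[OF \<tau>] by (rule fps_expansion_sums[OF hol])
    qed
    show "G = fps_expansion ?g 0" if "\<forall>\<tau>\<in>uhp. (\<lambda>n. fps_nth G n * q5 \<tau> ^ n) sums eta_chi5_radicand \<tau>" for G
      by (rule q5_sums_unique[OF hol]) (use that rad in metis)
  qed
  also have "\<dots> = fps_expansion (f_comb_q (- \<i>)) 0 * fps_expansion (f_comb_q (- \<i>)) 0"
    by (intro fps_expansion_eqI has_fps_expansion_mult has_fps_expansion_fps_expansion[OF open_ball _ f_comb_q_holomorphic]) simp_all
  finally show ?thesis by (simp only: power2_eq_square)
qed

lemma eta_chi5_fps_eq: "eta_chi5_fps = fps_expansion (f_comb_q (- \<i>)) 0"
  unfolding eta_chi5_fps_def eta_chi5_radicand_fps_eq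
proof (rule the_equality)
  have 0: "fps_nth (fps_expansion (f_comb_q (- \<i>)) 0) 0 = 1"
    by (simp add: fps_expansion_def f_comb_q_0)
  then show "fps_nth (fps_expansion (f_comb_q (- \<i>)) 0) 0 = 1 \<and>
      (fps_expansion (f_comb_q (- \<i>)) 0)\<^sup>2 = (fps_expansion (f_comb_q (- \<i>)) 0)\<^sup>2" by simp
  fix F :: "complex fps"
  assume "fps_nth F 0 = 1 \<and> F\<^sup>2 = (fps_expansion (f_comb_q (- \<i>)) 0)\<^sup>2"
  then show "F = fps_expansion (f_comb_q (- \<i>)) 0"
    using 0 by (auto simp: power2_eq_iff)
qed

lemma cnj_log_euler:
  assumes "norm q < 1"
  shows "log_euler (cnj q) = cnj (log_euler q)"
proof -
  have "Ln (1 - cnj q ^ Suc n) = cnj (Ln (1 - q ^ Suc n))" for n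
  proof -
    have "Re (q ^ Suc n) < 1"
      using norm_power_Suc_less_1[OF assms] complex_Re_le_cmod[of "q ^ Suc n"] by (rule le_less_trans[rotated])
    then have "1 - q ^ Suc n \<notin> \<real>\<^sub>\<le>\<^sub>0" by (auto simp: complex_nonpos_Reals_iff)
    from cnj_Ln[OF this] show ?thesis by simp
  qed
  moreover have "(\<lambda>n. cnj (Ln (1 - q ^ Suc n))) sums cnj (log_euler q)"
    unfolding sums_cnj log_euler_def by (rule summable_sums[OF Ln_euler_summable[OF assms]])
  ultimately show ?thesis
    unfolding log_euler_def[of "cnj q"] by (simp only: sums_unique[symmetric])
qed

lemma cnj_theta_q: "theta_q N r (cnj q) = cnj (theta_q N r q)"
proof -
  have "(-1) powi p * cnj q ^ theta_exponent N r p = cnj ((-1) powi p * q ^ theta_exponent N r p)" for p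
    by simp
  then show ?thesis unfolding theta_q_def by (simp only: infsum_cnj)
qed

lemma cnj_f_comb_q:
  assumes "norm w < 1"
  shows "cnj (f_comb_q s (cnj w)) = f_comb_q (cnj s) w"
proof -
  have w5: "norm (w ^ 5) < 1" using assms by (simp add: norm_power power_less_one_iff)
  have cnj_exp: "exp (- 3 / 5 * cnj z) = cnj (exp (- 3 / 5 * z))" for z
    unfolding exp_cnj by simp
  show ?thesis
    unfolding f_comb_q_def f1_q_def f3_q_def complex_cnj_power[symmetric] cnj_log_euler[OF w5] cnj_theta_q cnj_exp
      complex_cnj_add complex_cnj_mult complex_cnj_cnj ..
qed

theorem eta_chi5_eq:
  assumes \<tau>: "\<tau> \<in> uhp"
  shows "eta_chi5 \<tau> = f1 \<tau> - \<i> * f3 \<tau>" "eta_chi5_conj \<tau> = f1 \<tau> + \<i> * f3 \<tau>"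
proof -
  let ?w = "q5 \<tau>"
  have w: "norm ?w < 1" using q_pow_in_ball[OF \<tau>, of "1/5"] by simp
  have "eta_chi5 \<tau> = f_comb_q (- \<i>) ?w"
    unfolding eta_chi5_def eta_chi5_fps_eq eval_fps_def
    by (rule sums_unique[symmetric]) (rule fps_expansion_sums[OF f_comb_q_holomorphic w])
  then show "eta_chi5 \<tau> = f1 \<tau> - \<i> * f3 \<tau>"
    unfolding f_comb_q[OF \<tau>, symmetric] by simp
  have "(\<lambda>n. fps_nth (fps_expansion (f_comb_q (- \<i>)) 0) n * cnj ?w ^ n) sums f_comb_q (- \<i>) (cnj ?w)"
    using fps_expansion_sums[OF f_comb_q_holomorphic] w unfolding complex_mod_cnj[of ?w, symmetric] .
  then have "(\<lambda>n. cnj (fps_nth (fps_expansion (f_comb_q (- \<i>)) 0) n) * ?w ^ n) sums cnj (f_comb_q (- \<i>) (cnj ?w))"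
    unfolding sums_cnj[symmetric, of "\<lambda>n. _ n * cnj ?w ^ n"] complex_cnj_mult complex_cnj_power complex_cnj_cnj .
  then have "eta_chi5_conj \<tau> = cnj (f_comb_q (- \<i>) (cnj ?w))"
    unfolding eta_chi5_conj_def eta_chi5_fps_eq eval_fps_def fps_nth_Abs_fps
    by (rule sums_unique[symmetric])
  also have "\<dots> = f_comb_q \<i> ?w" unfolding cnj_f_comb_q[OF w] by simp
  finally show "eta_chi5_conj \<tau> = f1 \<tau> + \<i> * f3 \<tau>"
    unfolding f_comb_q[OF \<tau>, symmetric] .
qed

theorem subalgebra_generated_eta_chi5:
  "subalgebra_generated {f1, f3} = subalgebra_generated {eta_chi5, eta_chi5_conj}"
proof (rule equalityI; rule subalgebra_generated_subset)
  let ?sub = "subalgebra_generated {f1, f3}"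
  have gen: "restrict f1 uhp \<in> ?sub" "restrict f3 uhp \<in> ?sub"
    by (rule subalgebra_generated.gen, rule insertI1,
        rule subalgebra_generated.gen, rule insertI2, rule singletonI)
  have comb: "(\<lambda>\<tau>\<in>uhp. restrict f1 uhp \<tau> + (\<lambda>\<tau>\<in>uhp. c * restrict f3 uhp \<tau>) \<tau>) \<in> ?sub" for c
    by (intro subalgebra_generated.add subalgebra_scale gen)
  have "restrict eta_chi5 uhp = (\<lambda>\<tau>\<in>uhp. restrict f1 uhp \<tau> + (\<lambda>\<tau>\<in>uhp. - \<i> * restrict f3 uhp \<tau>) \<tau>)"
    "restrict eta_chi5_conj uhp = (\<lambda>\<tau>\<in>uhp. restrict f1 uhp \<tau> + (\<lambda>\<tau>\<in>uhp. \<i> * restrict f3 uhp \<tau>) \<tau>)"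
    by (rule restrict_ext, simp add: eta_chi5_eq)+
  with comb have "restrict eta_chi5 uhp \<in> ?sub" "restrict eta_chi5_conj uhp \<in> ?sub"
    by (simp_all only:)
  then show "restrict g uhp \<in> ?sub" if "g \<in> {eta_chi5, eta_chi5_conj}" for g
    using that by (elim insertE emptyE) (simp_all only:)
next
  let ?sub = "subalgebra_generated {eta_chi5, eta_chi5_conj}" and ?e = "restrict eta_chi5 uhp" and ?e' = "restrict eta_chi5_conj uhp"
  have gen: "?e \<in> ?sub" "?e' \<in> ?sub"
    by (rule subalgebra_generated.gen, rule insertI1,
        rule subalgebra_generated.gen, rule insertI2, rule singletonI)
  have comb: "(\<lambda>\<tau>\<in>uhp. (\<lambda>\<tau>\<in>uhp. c * ?e \<tau>) \<tau> + (\<lambda>\<tau>\<in>uhp. d * ?e' \<tau>) \<tau>) \<in> ?sub" for c d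
    by (intro subalgebra_generated.add subalgebra_scale gen)
  have "restrict f1 uhp = (\<lambda>\<tau>\<in>uhp. (\<lambda>\<tau>\<in>uhp. 1 / 2 * ?e \<tau>) \<tau> + (\<lambda>\<tau>\<in>uhp. 1 / 2 * ?e' \<tau>) \<tau>)"
    "restrict f3 uhp = (\<lambda>\<tau>\<in>uhp. (\<lambda>\<tau>\<in>uhp. \<i> / 2 * ?e \<tau>) \<tau> + (\<lambda>\<tau>\<in>uhp. - \<i> / 2 * ?e' \<tau>) \<tau>)"
    by (rule restrict_ext, simp add: eta_chi5_eq field_simps)+
  with comb have "restrict f1 uhp \<in> ?sub" "restrict f3 uhp \<in> ?sub"
    by (simp_all only:)
  then show "restrict g uhp \<in> ?sub" if "g \<in> {f1, f3}" for g
    using that by (elim insertE emptyE) (simp_all only:)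
qed

theorem theorem25:
  shows "modular_forms_ring = subalgebra_generated {f5 1, f5 3} \<and>
         subalgebra_generated {f5 1, f5 3} = subalgebra_generated {eta_chi5, eta_chi5_conj} \<and>
         cusp_forms_ideal = (\<lambda>f. \<lambda>\<tau>\<in>uhp. f \<tau> * eta_pow (24/5) \<tau>) ` modular_forms_ring"
  by (intro conjI modular_forms_ring_eq subalgebra_generated_eta_chi5 cusp_forms_ideal_eq)


end
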